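(* Let $p\geq 2$ and $s>s_p^\star$, where $s_p^\star=1/4$ if $p\leq 4$ and $s_p^\star=1/2-1/p$ if $p>4$. Let $R_s(x)=\sum_{n=1}^\infty n^{-2s}e^{2\pi i n^2 x}$ on $\mathbb T=\mathbb R/\mathbb Z$. Then, as $N\to\infty$, \[ F_{R_s,p}(N)\simeq \begin{cases} 1, & p<4,\\ \log N, & p=4,\\ N^{p/4-1}, & p>4,\end{cases} \] where the implicit constants do not depend on $N$.
   Context: $\mathbb T=\mathbb R/\mathbb Z$ and $\|\cdot\|_p$ denotes the $L^p(\mathbb T)$ norm. For $s\le 1/2$ the series defining $R_s$ is not absolutely convergent; $R_s$ is then understood as the limit in $L^p(\mathbb T)$ of its partial sums. For $f(x)=\sum_{n\in\mathbb Z}a_ne^{2\pi i n x}$, the high-pass filter is $f_{\geq N}(x)=\sum_{|n|\geq N}a_ne^{2\pi i n x}$; for $R_s$ this means $(R_s)_{\ge N}(x)=\sum_{n\ge1,\ n^2\ge N} n^{-2s}e^{2\pi i n^2x}$. The flatness in the sense of high-pass filters is $F_{f,p}(N)=\|f_{\geq N}\|_{p}^p/\|f_{\geq N}\|_{2}^p$. $A\simeq B$ means $c B\le A\le CB$ for constants $c,C>0$. *)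

theory Defs
  imports "HOL-Analysis.Analysis"
begin

text \<open>Functions on the torus R/Z are represented as functions real => complex,
  integrated over one period [0,1].\<close>

definition Lp_pow :: "real \<Rightarrow> (real \<Rightarrow> complex) \<Rightarrow> ennreal" where
  "Lp_pow p f = (\<integral>\<^sup>+ x \<in> {0..1}. ennreal (cmod (f x) powr p) \<partial>lborel)"

definition Lp_limit :: "real \<Rightarrow> (nat \<Rightarrow> real \<Rightarrow> complex) \<Rightarrow> (real \<Rightarrow> complex) \<Rightarrow> bool" where
  "Lp_limit p S g \<longleftrightarrow> g \<in> borel_measurable lborel \<and>
     (\<lambda>M. Lp_pow p (\<lambda>x. S M x - g x)) \<longlonglongrightarrow> 0"

definition Rs_high_partial :: "real \<Rightarrow> nat \<Rightarrow> nat \<Rightarrow> real \<Rightarrow> complex" where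
  "Rs_high_partial s N M x =
     sum (\<lambda>n. complex_of_real (real n powr (- 2 * s)) * cis (2 * pi * real (n ^ 2) * x))
       {n. 1 \<le> n \<and> N \<le> n ^ 2 \<and> n \<le> M}"

definition flatness :: "real \<Rightarrow> (real \<Rightarrow> complex) \<Rightarrow> real" where
  "flatness p g = enn2real (Lp_pow p g) / (enn2real (Lp_pow 2 g)) powr (p/2)"

definition s_star :: "real \<Rightarrow> real" where
  "s_star p = (if p \<le> 4 then 1/4 else 1/2 - 1/p)"

definition flat_rate :: "real \<Rightarrow> nat \<Rightarrow> real" where
  "flat_rate p N = (if p < 4 then 1 else if p = 4 then ln (real N) else real N powr (p/4 - 1))"

end

theory Submission
  imports Defs "HOL-Number_Theory.Totient" "HOL-Number_Theory.Modular_Inverse"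
begin

text \<open>
  Write \<open>L = \<lceil>sqrt N\<rceil>\<close>. Since the \<open>L\<^sup>2\<close> norm of the tail is of size \<open>L\<^bsup>1/2 - 2s\<^esup>\<close> by
  orthogonality, the theorem amounts to a two-sided estimate of its \<open>L\<^sup>p\<close> norm.

  Upper bound. For a quadratic exponential sum with a tent-shaped weight of width \<open>w\<close>, Weyl
  differencing loses no logarithm: with \<open>x = a/q + \<beta>\<close> given by Dirichlet's theorem (\<open>q \<lesssim> w\<close>,
  \<open>\<bar>\<beta>\<bar> \<le> 1/(8 w q)\<close>) its square is at most a constant times \<open>w + (w\<^sup>2/q) (1 + w\<^sup>2 \<bar>\<beta>\<bar>)\<^bsup>-\<eta>\<^esup>\<close> for
  any \<open>\<eta> < 1\<close>. Taking \<open>\<eta> > 2/p\<close> and integrating over all arcs gives the \<open>L\<^sup>p\<close> norm for every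
  \<open>p > 2\<close>, the three regimes coming from \<open>\<Sum>q \<lesssim> w. q\<^bsup>1 - p/2\<^esup>\<close>. A sharply cut interval is a
  superposition of tents of geometrically decreasing widths, and partial summation together
  with a dyadic decomposition yields the weighted tails. The same bounds show that the partial
  sums are Cauchy, so the limit exists by completeness.

  Lower bound. For \<open>p < 4\<close> this is monotonicity of the \<open>L\<^sup>p\<close> norms in \<open>p\<close>. For \<open>p = 4\<close> the
  coefficients are positive, so it suffices to count solutions of
  \<open>n\<^sub>1\<^sup>2 + n\<^sub>2\<^sup>2 = n\<^sub>3\<^sup>2 + n\<^sub>4\<^sup>2\<close> of size \<open>L\<close>; there are at least \<open>c L\<^sup>2 log L\<close> of them, by
  summing greatest common divisors. For \<open>p > 4\<close> one tests against a Fejer kernel.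
\<close>

section \<open>Bounds for \<open>L\<^sup>p\<close> norms\<close>

lemma Bernoulli_inequality_powr:
  fixes x r :: real
  assumes "0 \<le> x" "1 \<le> r"
  shows "1 + r * (x - 1) \<le> x powr r"
proof (cases "x = 0")
  case False
  have "(x powr r) powr (1/r) * 1 powr (1 - 1/r) \<le> 1/r * x powr r + (1 - 1/r) * 1"
    by (rule Youngs_inequality_0) (use assms False in auto)
  then have "r * x \<le> r * (1/r * x powr r + (1 - 1/r))"
    using assms by (intro mult_left_mono) (auto simp: powr_powr)
  also have "\<dots> = x powr r + r - 1"
    using assms by (simp add: field_simps)
  finally show ?thesis by (simp add: algebra_simps)
qed (use assms in simp)

lemma powr_convex_nonneg:
  fixes p :: real
  assumes "p \<ge> 1"
  shows "convex_on {0..} (\<lambda>x. x powr p)"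
proof (rule convex_on_linorderI)
  fix t x y :: real
  assume t: "0 < t" "t < 1" and xy: "x \<in> {0..}" "y \<in> {0..}" "x < y"
  show "((1 - t) *\<^sub>R x + t *\<^sub>R y) powr p \<le> (1 - t) * x powr p + t * y powr p"
  proof (cases "x = 0")
    case True
    have "t powr p \<le> t" using powr_mono'[of 1 p t] t assms by simp
    then show ?thesis using True by (simp add: powr_mult mult_right_mono)
  next
    case False
    then show ?thesis using convex_onD[OF powr_convex[OF assms], of t x y] t xy by simp
  qed
qed simp

text \<open>The inequality \<open>\<parallel>f\<parallel>\<^sub>p \<le> a\<close>, in a form that needs no separate finiteness hypothesis.\<close>

definition Lp_bound :: "real \<Rightarrow> (real \<Rightarrow> complex) \<Rightarrow> real \<Rightarrow> bool" where
  "Lp_bound p f a \<longleftrightarrow> f \<in> borel_measurable borel \<and> 0 \<le> a \<and> Lp_pow p f \<le> ennreal (a powr p)"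

lemma Lp_bound_measurable: "Lp_bound p f a \<Longrightarrow> f \<in> borel_measurable borel"
  by (simp add: Lp_bound_def)

lemma Lp_bound_nonneg: "Lp_bound p f a \<Longrightarrow> 0 \<le> a"
  by (simp add: Lp_bound_def)

lemma Lp_bound_zero: "0 \<le> a \<Longrightarrow> Lp_bound p (\<lambda>x. 0) a"
  by (simp add: Lp_bound_def Lp_pow_def)

lemma Lp_bound_mono: "Lp_bound p f a \<Longrightarrow> a \<le> b \<Longrightarrow> 0 \<le> p \<Longrightarrow> Lp_bound p f b"
  unfolding Lp_bound_def by (meson dual_order.trans ennreal_leI powr_mono2)

lemma Lp_bound_scale:
  assumes "Lp_bound p f a" "p \<ge> 0"
  shows "Lp_bound p (\<lambda>x. c * f x) (cmod c * a)"
proof -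
  have "Lp_pow p (\<lambda>x. c * f x) = ennreal (cmod c powr p) * Lp_pow p f"
    unfolding Lp_pow_def using assms
    by (subst nn_integral_cmult[symmetric])
       (auto simp: Lp_bound_def norm_mult powr_mult ennreal_mult mult.assoc)
  also have "\<dots> \<le> ennreal (cmod c powr p) * ennreal (a powr p)"
    using assms by (intro mult_left_mono) (auto simp: Lp_bound_def)
  also have "\<dots> = ennreal ((cmod c * a) powr p)"
    using assms by (simp add: powr_mult ennreal_mult Lp_bound_def)
  finally show ?thesis using assms by (auto simp: Lp_bound_def)
qed

lemma le_ennreal_powr_epsilon:
  assumes le: "\<And>\<epsilon>. \<epsilon> > 0 \<Longrightarrow> x \<le> ennreal ((a + \<epsilon>) powr p)" and "0 \<le> a" "0 < p"
  shows "x \<le> ennreal (a powr p)"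
proof -
  have "(\<lambda>n. ennreal ((a + inverse (real (Suc n))) powr p)) \<longlonglongrightarrow> ennreal ((a + 0) powr p)"
    using assms by (intro tendsto_intros LIMSEQ_inverse_real_of_nat)
      (auto intro!: always_eventually)
  then have "x \<le> ennreal ((a + 0) powr p)"
    by (rule LIMSEQ_le_const) (use le in simp)
  then show ?thesis by simp
qed

lemma Lp_bound_le_epsilon:
  assumes "\<And>\<epsilon>. \<epsilon> > 0 \<Longrightarrow> Lp_bound p f (a + \<epsilon>)" "0 \<le> a" "0 < p"
  shows "Lp_bound p f a"
  using assms le_ennreal_powr_epsilon[of "Lp_pow p f" a p] assms(1)[of 1]
  by (auto simp: Lp_bound_def)

lemma Lp_pow_le_linear_combination:
  assumes [measurable]: "f \<in> borel_measurable borel" "g \<in> borel_measurable borel"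
    and AB: "0 \<le> A" "0 \<le> B"
    and le: "\<And>x. cmod (h x) powr q \<le> A * cmod (f x) powr p + B * cmod (g x) powr r"
  shows "Lp_pow q h \<le> ennreal A * Lp_pow p f + ennreal B * Lp_pow r g"
proof -
  have "Lp_pow q h \<le> (\<integral>\<^sup>+ x. ennreal A * (ennreal (cmod (f x) powr p) * indicator {0..1} x)
             + ennreal B * (ennreal (cmod (g x) powr r) * indicator {0..1} x) \<partial>lborel)"
    unfolding Lp_pow_def
    by (rule nn_integral_mono)
      (use le AB in \<open>auto simp: indicator_def ennreal_mult[symmetric] simp flip: ennreal_plus
         intro!: ennreal_leI\<close>)
  also have "\<dots> = ennreal A * Lp_pow p f + ennreal B * Lp_pow r g"
    unfolding Lp_pow_def by (subst nn_integral_add) (auto simp: nn_integral_cmult)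
  finally show ?thesis .
qed

text \<open>Minkowski's inequality, because \<open>(f + g) / (a + b)\<close> is a convex combination of \<open>f / a\<close>
  and \<open>g / b\<close>.\<close>

lemma Lp_bound_add_pos:
  assumes f: "Lp_bound p f a" and g: "Lp_bound p g b" and "a > 0" "b > 0" "p \<ge> 1"
  shows "Lp_bound p (\<lambda>x. f x + g x) (a + b)"
proof -
  define t where "t = b / (a + b)"
  define A where "A = (a + b) powr p * ((1 - t) / a powr p)"
  define B where "B = (a + b) powr p * (t / b powr p)"
  have t: "0 \<le> t" "t \<le> 1" using assms by (auto simp: t_def)
  have weights: "(a + b) * (1 - t) = a" "(a + b) * t = b"
    using assms by (simp_all add: t_def right_diff_distrib)
  have AB: "A \<ge> 0" "B \<ge> 0" using t by (auto simp: A_def B_def)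
  have pointwise: "cmod (f x + g x) powr p \<le> A * cmod (f x) powr p + B * cmod (g x) powr p" for x
  proof -
    have "cmod (f x + g x) powr p \<le> (cmod (f x) + cmod (g x)) powr p"
      using assms by (intro powr_mono2 norm_triangle_ineq) auto
    also have "cmod (f x) + cmod (g x)
        = (a + b) * ((1 - t) *\<^sub>R (cmod (f x) / a) + t *\<^sub>R (cmod (g x) / b))"
      unfolding distrib_left real_scaleR_def mult.assoc[symmetric] weights using assms by simp
    also have "\<dots> powr p
        = (a + b) powr p * ((1 - t) *\<^sub>R (cmod (f x) / a) + t *\<^sub>R (cmod (g x) / b)) powr p"
      by (rule powr_mult)
    also have "\<dots>
        \<le> (a + b) powr p * ((1 - t) * (cmod (f x) / a) powr p + t * (cmod (g x) / b) powr p)"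
      using assms t by (intro mult_left_mono convex_onD[OF powr_convex_nonneg]) auto
    also have "\<dots> = A * cmod (f x) powr p + B * cmod (g x) powr p"
      by (simp add: A_def B_def powr_divide algebra_simps)
    finally show ?thesis .
  qed
  have ends: "A * a powr p = (a + b) powr p * (1 - t)" "B * b powr p = (a + b) powr p * t"
    using assms by (simp_all add: A_def B_def)
  have "Lp_pow p (\<lambda>x. f x + g x) \<le> ennreal A * Lp_pow p f + ennreal B * Lp_pow p g"
    using f g AB pointwise by (intro Lp_pow_le_linear_combination) (auto simp: Lp_bound_def)
  also have "\<dots> \<le> ennreal A * ennreal (a powr p) + ennreal B * ennreal (b powr p)"
    using f g by (intro add_mono mult_left_mono) (auto simp: Lp_bound_def)
  also have "\<dots> = ennreal (A * a powr p + B * b powr p)"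
    using AB by (simp add: ennreal_mult ennreal_plus)
  also have "A * a powr p + B * b powr p = (a + b) powr p"
    unfolding ends by (simp add: algebra_simps)
  finally show ?thesis using f g by (auto simp: Lp_bound_def)
qed

lemma Lp_bound_add:
  assumes f: "Lp_bound p f a" and g: "Lp_bound p g b" and "p \<ge> 1"
  shows "Lp_bound p (\<lambda>x. f x + g x) (a + b)"
proof (rule Lp_bound_le_epsilon)
  fix \<epsilon> :: real assume "\<epsilon> > 0"
  then have "Lp_bound p (\<lambda>x. f x + g x) ((a + \<epsilon>/2) + (b + \<epsilon>/2))"
    using assms f[THEN Lp_bound_nonneg] g[THEN Lp_bound_nonneg]
    by (intro Lp_bound_add_pos Lp_bound_mono[OF f] Lp_bound_mono[OF g]) auto
  moreover have "(a + \<epsilon>/2) + (b + \<epsilon>/2) = a + b + \<epsilon>" by simp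
  ultimately show "Lp_bound p (\<lambda>x. f x + g x) (a + b + \<epsilon>)" by (simp only:)
qed (use assms in \<open>auto simp: Lp_bound_def\<close>)

lemma Lp_bound_uminus: "Lp_bound p f a \<Longrightarrow> p \<ge> 0 \<Longrightarrow> Lp_bound p (\<lambda>x. - f x) a"
  using Lp_bound_scale[of p f a "- 1"] by simp

lemma Lp_bound_diff:
  "Lp_bound p f a \<Longrightarrow> Lp_bound p g b \<Longrightarrow> p \<ge> 1 \<Longrightarrow> Lp_bound p (\<lambda>x. f x - g x) (a + b)"
  using Lp_bound_add[of p f a "\<lambda>x. - g x" b] Lp_bound_uminus[of p g b] by simp

lemma Lp_bound_sum:
  assumes "finite I" "\<And>i. i \<in> I \<Longrightarrow> Lp_bound p (f i) (a i)" "p \<ge> 1"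
  shows "Lp_bound p (\<lambda>x. \<Sum>i\<in>I. f i x) (\<Sum>i\<in>I. a i)"
  using assms
proof (induction I rule: finite_induct)
  case (insert i I)
  then show ?case using Lp_bound_add[of p "f i" "a i" "\<lambda>x. \<Sum>i\<in>I. f i x" "\<Sum>i\<in>I. a i"] by simp
qed (simp add: Lp_bound_zero)

lemma Lp_bound_antimono_exponent_pos:
  assumes f: "Lp_bound p f a" and q: "0 < q" "q \<le> p" and "a > 0"
  shows "Lp_bound q f a"
proof -
  define A where "A = a powr q * (q / p / a powr p)"
  define B where "B = a powr q * (1 - q / p)"
  have AB: "A \<ge> 0" "B \<ge> 0" using q by (auto simp: A_def B_def)
  have pointwise: "cmod (f x) powr q \<le> A * cmod (f x) powr p + B * cmod 1 powr 1" for x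
  proof -
    define u where "u = cmod (f x) / a"
    have "1 + p/q * (u powr q - 1) \<le> (u powr q) powr (p/q)"
      using assms by (intro Bernoulli_inequality_powr) auto
    then have "q / p * (1 + p / q * (u powr q - 1)) \<le> q / p * u powr p"
      using q by (intro mult_left_mono) (auto simp: powr_powr)
    then have "u powr q \<le> q / p * u powr p + (1 - q / p)"
      using q by (simp add: distrib_left)
    then have "a powr q * u powr q \<le> a powr q * (q / p * u powr p + (1 - q / p))"
      by (intro mult_left_mono) auto
    then show ?thesis
      using \<open>a > 0\<close> by (simp add: u_def A_def B_def powr_divide algebra_simps)
  qed
  have "Lp_pow q f \<le> ennreal A * Lp_pow p f + ennreal B * Lp_pow 1 (\<lambda>_. 1)"
    using AB f by (intro Lp_pow_le_linear_combination pointwise) (auto simp: Lp_bound_def)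
  also have "\<dots> \<le> ennreal A * ennreal (a powr p) + ennreal B"
    using f by (intro add_mono mult_left_mono) (auto simp: Lp_bound_def Lp_pow_def)
  also have "\<dots> = ennreal (A * a powr p + B)"
    using AB by (simp add: ennreal_mult)
  also have "A * a powr p + B = a powr q"
    using assms by (simp add: A_def B_def right_diff_distrib)
  finally show ?thesis using f by (simp add: Lp_bound_def)
qed

lemma Lp_bound_antimono_exponent:
  assumes f: "Lp_bound p f a" and q: "0 < q" "q \<le> p"
  shows "Lp_bound q f a"
proof (rule Lp_bound_le_epsilon)
  fix \<epsilon> :: real assume "\<epsilon> > 0"
  then have "Lp_bound p f (a + \<epsilon>)" "a + \<epsilon> > 0"
    using q f[THEN Lp_bound_nonneg] by (auto intro: Lp_bound_mono[OF f])
  then show "Lp_bound q f (a + \<epsilon>)"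
    by (intro Lp_bound_antimono_exponent_pos[OF _ q])
qed (use assms in \<open>auto simp: Lp_bound_def\<close>)

lemma ex_Lp_bound_eq:
  assumes "f \<in> borel_measurable borel" "Lp_pow p f < \<infinity>" "p > 0"
  obtains a where "Lp_bound p f a" "Lp_pow p f = ennreal (a powr p)"
proof (rule that)
  show eq: "Lp_pow p f = ennreal ((enn2real (Lp_pow p f) powr (1/p)) powr p)"
    using assms by (simp add: powr_powr)
  show "Lp_bound p f (enn2real (Lp_pow p f) powr (1/p))"
    unfolding Lp_bound_def by (subst eq[symmetric]) (use assms in simp)
qed

definition Lp_lower_bound :: "real \<Rightarrow> (real \<Rightarrow> complex) \<Rightarrow> real \<Rightarrow> bool" where
  "Lp_lower_bound p f a \<longleftrightarrow> 0 \<le> a \<and> ennreal (a powr p) \<le> Lp_pow p f"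

lemma Lp_lower_bound_mono_exponent:
  assumes a: "Lp_lower_bound q f a" and f: "f \<in> borel_measurable borel" and q: "0 < q" "q \<le> p"
  shows "Lp_lower_bound p f a"
proof (cases "Lp_pow p f < \<infinity>")
  case True
  then obtain b where b: "Lp_bound p f b" "Lp_pow p f = ennreal (b powr p)"
    using ex_Lp_bound_eq[OF f, of p] q by auto
  have "ennreal (a powr q) \<le> Lp_pow q f"
    using a by (simp add: Lp_lower_bound_def)
  also have "\<dots> \<le> ennreal (b powr q)"
    using Lp_bound_antimono_exponent[OF b(1) q] by (simp add: Lp_bound_def)
  finally have "a powr q \<le> b powr q" by (simp add: ennreal_le_iff)
  then have "a \<le> b"
    using q Lp_bound_nonneg[OF b(1)] powr_less_mono2[of q b a] by linarith
  then show ?thesis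
    using a b q by (auto simp: Lp_lower_bound_def intro!: ennreal_leI powr_mono2)
qed (use a in \<open>simp add: Lp_lower_bound_def less_top[symmetric]\<close>)

text \<open>Replacing \<open>t powr p\<close> by its tangent at \<open>b\<close> makes the integrand linear in \<open>Re (S x)\<close>.\<close>

lemma Lp_pow_ge_weighted_mean:
  assumes S: "continuous_on {0..1} S" and "p \<ge> 1" "b > 0" "B > 0"
    and \<phi>: "(\<phi> has_integral m) {0..1}" "\<And>x. 0 \<le> \<phi> x" "\<And>x. \<phi> x \<le> B"
    and W: "((\<lambda>x. Re (S x) * \<phi> x) has_integral W) {0..1}" "b * m \<le> W"
  shows "ennreal (b powr p * m / B) \<le> Lp_pow p S"
proof -
  define I where "I = integral {0..1} (\<lambda>x. cmod (S x) powr p)"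
  define h where "h x = b powr p / B * ((1 - p) * \<phi> x + p / b * (Re (S x) * \<phi> x))" for x
  have "(\<lambda>x. cmod (S x) powr p) integrable_on {0..1}"
    using \<open>p \<ge> 1\<close> S
    by (intro integrable_continuous_real continuous_on_powr' continuous_intros) auto
  then have I: "((\<lambda>x. cmod (S x) powr p) has_integral I) {0..1}"
    unfolding I_def by (rule integrable_integral)
  have h: "(h has_integral b powr p / B * ((1 - p) * m + p / b * W)) {0..1}"
    unfolding h_def by (intro has_integral_mult_right has_integral_add \<phi> W)
  have h_le: "h x \<le> cmod (S x) powr p" for x
  proof -
    have "h x = b powr p * (1 + p * (Re (S x) / b - 1)) * (\<phi> x / B)"
      using \<open>b > 0\<close> by (simp add: h_def algebra_simps add_divide_distrib diff_divide_distrib)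
    also have "\<dots> \<le> b powr p * (1 + p * (cmod (S x) / b - 1)) * (\<phi> x / B)"
      using assms by (intro mult_right_mono mult_left_mono add_left_mono diff_right_mono
          divide_right_mono complex_Re_le_cmod) auto
    also have "\<dots> \<le> b powr p * (cmod (S x) / b) powr p * (\<phi> x / B)"
      using assms by (intro mult_right_mono mult_left_mono Bernoulli_inequality_powr) auto
    also have "\<dots> \<le> cmod (S x) powr p * 1"
      using assms by (intro mult_mono) (auto simp: powr_divide)
    finally show ?thesis by simp
  qed
  have "b powr p * m / B = b powr p / B * ((1 - p) * m + p / b * (b * m))"
    using \<open>b > 0\<close> by (simp add: algebra_simps)
  also have "\<dots> \<le> b powr p / B * ((1 - p) * m + p / b * W)"
    using assms by (intro mult_left_mono add_left_mono) auto
  also have "\<dots> \<le> I" by (rule has_integral_le[OF h I h_le])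
  finally have "ennreal (b powr p * m / B) \<le> ennreal I" by (rule ennreal_leI)
  also have "ennreal I = Lp_pow p S"
    unfolding Lp_pow_def using I by (intro nn_integral_has_integral_lebesgue'[symmetric]) auto
  finally show ?thesis .
qed

section \<open>Convergence in \<open>L\<^sup>p\<close>\<close>

lemma Lp_limit_iff_eventually_Lp_bound:
  assumes S: "\<And>M. S M \<in> borel_measurable borel" and "p > 0"
  shows "Lp_limit p S g \<longleftrightarrow> g \<in> borel_measurable borel \<and>
    (\<forall>\<epsilon>>0. \<forall>\<^sub>F M in sequentially. Lp_bound p (\<lambda>x. S M x - g x) \<epsilon>)"
proof (intro iffI conjI allI impI)
  fix \<epsilon> :: real assume lim: "Lp_limit p S g" and "\<epsilon> > 0"
  then have g: "g \<in> borel_measurable borel" by (simp add: Lp_limit_def)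
  have "\<forall>\<^sub>F M in sequentially. Lp_pow p (\<lambda>x. S M x - g x) < ennreal (\<epsilon> powr p)"
    using lim \<open>\<epsilon> > 0\<close> by (intro order_tendstoD(2)[of _ 0]) (auto simp: Lp_limit_def)
  then show "\<forall>\<^sub>F M in sequentially. Lp_bound p (\<lambda>x. S M x - g x) \<epsilon>"
    by eventually_elim
      (use \<open>\<epsilon> > 0\<close> S g in \<open>auto simp: Lp_bound_def intro!: borel_measurable_diff less_imp_le\<close>)
next
  assume R: "g \<in> borel_measurable borel \<and>
    (\<forall>\<epsilon>>0. \<forall>\<^sub>F M in sequentially. Lp_bound p (\<lambda>x. S M x - g x) \<epsilon>)"
  have "(\<lambda>M. Lp_pow p (\<lambda>x. S M x - g x)) \<longlonglongrightarrow> 0"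
  proof (rule order_tendstoI)
    fix a :: ennreal assume "0 < a"
    then obtain y where y: "0 < y" "y < a" using dense by blast
    then obtain r where r: "r > 0" "ennreal r < a"
      by (cases y) auto
    have "\<forall>\<^sub>F M in sequentially. Lp_bound p (\<lambda>x. S M x - g x) (r powr (1/p))"
      using R r by auto
    then show "\<forall>\<^sub>F M in sequentially. Lp_pow p (\<lambda>x. S M x - g x) < a"
      by eventually_elim (use r \<open>p > 0\<close> in \<open>auto simp: Lp_bound_def powr_powr intro: le_less_trans\<close>)
  qed simp
  then show "Lp_limit p S g" using R by (simp add: Lp_limit_def)
qed (simp add: Lp_limit_def)

lemma Lp_limit_antimono_exponent:
  assumes "Lp_limit p S g" "\<And>M. S M \<in> borel_measurable borel" "0 < q" "q \<le> p"
  shows "Lp_limit q S g"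
  using assms by (auto simp: Lp_limit_iff_eventually_Lp_bound
      elim!: eventually_mono intro: Lp_bound_antimono_exponent)

lemma Lp_limit_obtain:
  assumes "Lp_limit p S g" "\<And>M. S M \<in> borel_measurable borel" "p > 0" "\<epsilon> > 0"
    and "\<forall>\<^sub>F M in sequentially. P M"
  obtains M where "P M" "Lp_bound p (\<lambda>x. S M x - g x) \<epsilon>"
proof -
  have "\<forall>\<^sub>F M in sequentially. P M \<and> Lp_bound p (\<lambda>x. S M x - g x) \<epsilon>"
    using assms by (intro eventually_conj) (auto simp: Lp_limit_iff_eventually_Lp_bound)
  then show thesis
    using that eventually_happens'[OF sequentially_bot] by blast
qed

lemma Lp_bound_limit:
  assumes lim: "Lp_limit p S g" and S: "\<And>M. Lp_bound p (S M) a" and "p \<ge> 1"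
  shows "Lp_bound p g a"
proof (rule Lp_bound_le_epsilon)
  fix \<epsilon> :: real assume "\<epsilon> > 0"
  then obtain M where "Lp_bound p (\<lambda>x. S M x - g x) \<epsilon>"
    using Lp_limit_obtain[OF lim, where P = "\<lambda>_. True"] S \<open>p \<ge> 1\<close> by (auto simp: Lp_bound_def)
  from Lp_bound_diff[OF S[of M] this \<open>p \<ge> 1\<close>] show "Lp_bound p g (a + \<epsilon>)" by simp
qed (use S[of 0] \<open>p \<ge> 1\<close> in \<open>auto simp: Lp_bound_def\<close>)

lemma Lp_lower_bound_limit:
  assumes lim: "Lp_limit p S g" and S: "\<And>M. S M \<in> borel_measurable borel"
    and ge: "\<forall>\<^sub>F M in sequentially. Lp_lower_bound p (S M) a" and "p \<ge> 1"
  shows "Lp_lower_bound p g a"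
proof (cases "Lp_pow p g < \<infinity>")
  case True
  then obtain b where b: "Lp_bound p g b" "Lp_pow p g = ennreal (b powr p)"
    using ex_Lp_bound_eq[of g p] lim \<open>p \<ge> 1\<close> by (auto simp: Lp_limit_def)
  have "ennreal (a powr p) \<le> ennreal (b powr p)"
  proof (rule le_ennreal_powr_epsilon)
    fix \<epsilon> :: real assume "\<epsilon> > 0"
    then obtain M where M: "Lp_lower_bound p (S M) a" "Lp_bound p (\<lambda>x. S M x - g x) \<epsilon>"
      using Lp_limit_obtain[OF lim S _ _ ge] \<open>p \<ge> 1\<close> by auto
    have "Lp_bound p (S M) (b + \<epsilon>)"
      using Lp_bound_add[OF b(1) M(2) \<open>p \<ge> 1\<close>] by simp
    then have "Lp_pow p (S M) \<le> ennreal ((b + \<epsilon>) powr p)" by (simp add: Lp_bound_def)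
    with M(1) show "ennreal (a powr p) \<le> ennreal ((b + \<epsilon>) powr p)"
      unfolding Lp_lower_bound_def by (blast intro: order_trans)
  qed (use b \<open>p \<ge> 1\<close> in \<open>auto simp: Lp_bound_def\<close>)
  moreover have "0 \<le> a"
    using eventually_happens'[OF sequentially_bot ge] by (auto simp: Lp_lower_bound_def)
  ultimately show ?thesis using b by (simp add: Lp_lower_bound_def)
next
  case False
  then show ?thesis
    using eventually_happens'[OF sequentially_bot ge]
    by (auto simp: Lp_lower_bound_def less_top[symmetric])
qed

lemma AE_summable_of_Lp_bound_1:
  assumes f: "\<And>k. Lp_bound 1 (f k) (a k)" and "summable a"
  shows "AE x in lborel. x \<in> {0..1} \<longrightarrow> summable (\<lambda>k. cmod (f k x))"
proof -
  have [measurable]: "f k \<in> borel_measurable borel" for k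
    by (rule Lp_bound_measurable[OF f])
  have a: "Lp_pow 1 (f k) \<le> ennreal (a k)" "0 \<le> a k" for k
    using f[of k] by (auto simp: Lp_bound_def)
  have "(\<integral>\<^sup>+ x. (\<Sum>k. ennreal (cmod (f k x)) * indicator {0..1} x) \<partial>lborel)
     = (\<Sum>k. Lp_pow 1 (f k))"
    unfolding Lp_pow_def by (subst nn_integral_suminf) simp_all
  also have "\<dots> \<le> (\<Sum>k. ennreal (a k))"
    using a by (intro suminf_le) auto
  also have "\<dots> = ennreal (\<Sum>k. a k)"
    using a \<open>summable a\<close> by (intro suminf_ennreal_eq summable_sums)
  also have "\<dots> < \<infinity>" by simp
  finally have "AE x in lborel. (\<Sum>k. ennreal (cmod (f k x)) * indicator {0..1} x) \<noteq> \<infinity>"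
    by (intro nn_integral_PInf_AE) auto
  then show ?thesis
  proof eventually_elim
    case (elim x)
    then show ?case by (auto intro: summable_suminf_not_top)
  qed
qed

lemma Lp_bound_AE_limit:
  assumes S: "\<forall>\<^sub>F k in sequentially. Lp_bound p (S k) a" "\<And>k. S k \<in> borel_measurable borel"
    and g: "g \<in> borel_measurable borel"
    and lim: "AE x in lborel. x \<in> {0..1} \<longrightarrow> (\<lambda>k. S k x) \<longlonglongrightarrow> g x" and "p > 0"
  shows "Lp_bound p g a"
proof -
  note [measurable] = S(2)
  have "Lp_pow p g
      \<le> (\<integral>\<^sup>+ x. liminf (\<lambda>k. ennreal (cmod (S k x) powr p) * indicator {0..1} x) \<partial>lborel)"
    unfolding Lp_pow_def
  proof (rule nn_integral_mono_AE, rule AE_mp[OF lim], intro AE_I2 impI)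
    fix x :: real assume "x \<in> {0..1} \<longrightarrow> (\<lambda>k. S k x) \<longlonglongrightarrow> g x"
    then have "(\<lambda>k. ennreal (cmod (S k x) powr p) * indicator {0..1} x)
        \<longlonglongrightarrow> ennreal (cmod (g x) powr p) * indicator {0..1} x"
      using \<open>p > 0\<close>
      by (cases "x \<in> {0..1}") (auto intro!: tendsto_ennrealI tendsto_powr' tendsto_norm)
    then show "ennreal (cmod (g x) powr p) * indicator {0..1} x
        \<le> liminf (\<lambda>k. ennreal (cmod (S k x) powr p) * indicator {0..1} x)"
      by (simp add: lim_imp_Liminf)
  qed
  also have "\<dots> \<le> liminf (\<lambda>k. Lp_pow p (S k))"
    unfolding Lp_pow_def by (rule nn_integral_liminf) measurable
  also have "\<dots> \<le> ennreal (a powr p)"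
    using S(1) by (intro Liminf_le) (auto elim!: eventually_mono simp: Lp_bound_def)
  finally have "Lp_pow p g \<le> ennreal (a powr p)" .
  moreover have "0 \<le> a"
    using eventually_happens'[OF sequentially_bot S(1)] by (auto simp: Lp_bound_def)
  ultimately show ?thesis using g by (simp add: Lp_bound_def)
qed

definition Lp_Cauchy :: "real \<Rightarrow> (nat \<Rightarrow> real \<Rightarrow> complex) \<Rightarrow> bool" where
  "Lp_Cauchy p S \<longleftrightarrow> (\<forall>\<epsilon>>0. \<exists>N. \<forall>m\<ge>N. \<forall>n\<ge>N. Lp_bound p (\<lambda>x. S m x - S n x) \<epsilon>)"

lemma Lp_Cauchy_AE_convergent_subseq:
  assumes "Lp_Cauchy p S" "p \<ge> 1"
  obtains r :: "nat \<Rightarrow> nat" where "\<And>k. k \<le> r k"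
    "AE x in lborel. x \<in> {0..1} \<longrightarrow> convergent (\<lambda>k. S (r k) x)"
proof -
  have "\<exists>N. \<forall>k. \<forall>m\<ge>N k. \<forall>n\<ge>N k. Lp_bound p (\<lambda>x. S m x - S n x) ((1/2) ^ k)"
    using assms(1) unfolding Lp_Cauchy_def by (intro choice) auto
  then obtain N where
    N: "\<And>k m n. m \<ge> N k \<Longrightarrow> n \<ge> N k \<Longrightarrow> Lp_bound p (\<lambda>x. S m x - S n x) ((1/2) ^ k)"
    by blast
  define r where "r k = k + (\<Sum>j\<le>k. N j)" for k
  have "N k \<le> r k" "r k \<le> r (Suc k)" for k
    using member_le_sum[of k "{..k}" N] by (auto simp: r_def)
  then have "Lp_bound p (\<lambda>x. S (r (Suc k)) x - S (r k) x) ((1/2) ^ k)" for k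
    by (intro N) (auto intro: order_trans)
  then have "Lp_bound 1 (\<lambda>x. S (r (Suc k)) x - S (r k) x) ((1/2) ^ k)" for k
    by (rule Lp_bound_antimono_exponent) (use \<open>p \<ge> 1\<close> in auto)
  then have "AE x in lborel. x \<in> {0..1} \<longrightarrow> summable (\<lambda>k. cmod (S (r (Suc k)) x - S (r k) x))"
    by (rule AE_summable_of_Lp_bound_1) (simp add: summable_geometric)
  moreover have "convergent (\<lambda>k. S (r k) x)"
    if "summable (\<lambda>k. cmod (S (r (Suc k)) x - S (r k) x))" for x
  proof -
    have "convergent (\<lambda>n. \<Sum>k<n. S (r (Suc k)) x - S (r k) x)"
      using summable_norm_cancel[OF that] by (simp only: summable_iff_convergent)
    then have "convergent (\<lambda>n. (S (r n) x - S (r 0) x) + S (r 0) x)"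
      unfolding sum_lessThan_telescope[of "\<lambda>k. S (r k) x"]
      by (intro convergent_add convergent_const)
    then show ?thesis by simp
  qed
  ultimately have "AE x in lborel. x \<in> {0..1} \<longrightarrow> convergent (\<lambda>k. S (r k) x)" by auto
  then show thesis by (intro that[of r]) (auto simp: r_def)
qed

lemma Lp_complete:
  assumes S: "\<And>M. S M \<in> borel_measurable borel" and Cauchy: "Lp_Cauchy p S" and "p \<ge> 1"
  shows "\<exists>g. Lp_limit p S g"
proof -
  obtain r :: "nat \<Rightarrow> nat" where r: "\<And>k. k \<le> r k"
    and conv: "AE x in lborel. x \<in> {0..1} \<longrightarrow> convergent (\<lambda>k. S (r k) x)"
    using Lp_Cauchy_AE_convergent_subseq[OF Cauchy \<open>p \<ge> 1\<close>] by blast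
  define g where "g x = lim (\<lambda>k. S (r k) x)" for x
  note [measurable] = S
  have g [measurable]: "g \<in> borel_measurable borel" unfolding g_def by measurable
  have "\<forall>\<^sub>F M in sequentially. Lp_bound p (\<lambda>x. S M x - g x) \<epsilon>" if "\<epsilon> > 0" for \<epsilon>
  proof -
    obtain N where N: "\<And>m n. m \<ge> N \<Longrightarrow> n \<ge> N \<Longrightarrow> Lp_bound p (\<lambda>x. S m x - S n x) \<epsilon>"
      using Cauchy \<open>\<epsilon> > 0\<close> unfolding Lp_Cauchy_def by blast
    have "Lp_bound p (\<lambda>x. S M x - g x) \<epsilon>" if "M \<ge> N" for M
    proof (rule Lp_bound_AE_limit)
      show "\<forall>\<^sub>F k in sequentially. Lp_bound p (\<lambda>x. S M x - S (r k) x) \<epsilon>"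
        using eventually_ge_at_top[of N]
        by eventually_elim (use N[OF that] r order_trans in blast)
      show "AE x in lborel. x \<in> {0..1} \<longrightarrow> (\<lambda>k. S M x - S (r k) x) \<longlonglongrightarrow> S M x - g x"
        using conv
        by eventually_elim (auto simp: g_def convergent_LIMSEQ_iff intro!: tendsto_intros)
    qed (use \<open>p \<ge> 1\<close> in auto)
    then show ?thesis by (auto simp: eventually_at_top_linorder)
  qed
  then have "Lp_limit p S g"
    using S g \<open>p \<ge> 1\<close> by (simp add: Lp_limit_iff_eventually_Lp_bound)
  then show ?thesis by blast
qed

section \<open>Trigonometric polynomials\<close>

definition unit_exp :: "real \<Rightarrow> complex" where
  "unit_exp x = cis (2 * pi * x)"

lemma unit_exp_add: "unit_exp (x + y) = unit_exp x * unit_exp y"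
  by (simp add: unit_exp_def cis_mult algebra_simps)

lemma cnj_unit_exp: "cnj (unit_exp x) = unit_exp (- x)"
  by (simp add: unit_exp_def cis_cnj)

lemma norm_unit_exp [simp]: "cmod (unit_exp x) = 1"
  by (simp add: unit_exp_def)

lemma unit_exp_of_int [simp]: "unit_exp (of_int k) = 1"
  by (auto simp: unit_exp_def complex_eq_iff intro: cos_int_2pin sin_int_2pin)

lemma unit_exp_0 [simp]: "unit_exp 0 = 1"
  by (simp add: unit_exp_def)

lemma unit_exp_add_of_int: "unit_exp (of_int m + x) = unit_exp x"
  by (simp add: unit_exp_add)

lemma unit_exp_power: "unit_exp x ^ n = unit_exp (real n * x)"
  by (simp add: unit_exp_def Complex.DeMoivre mult_ac)

lemma continuous_on_unit_exp [continuous_intros]: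
  "continuous_on S f \<Longrightarrow> continuous_on S (\<lambda>x. unit_exp (f x))"
  unfolding unit_exp_def by (intro continuous_intros)

lemma has_integral_unit_exp:
  fixes k :: int
  shows "((\<lambda>x. unit_exp (of_int k * x)) has_integral (if k = 0 then 1 else 0)) {0..1}"
proof (cases "k = 0")
  case True
  then show ?thesis using has_integral_const_real[of "1::complex" 0 1] by simp
next
  case False
  define c where "c = 2 * pi * of_int k"
  define F where "F x = cis (c * x) / (\<i> * complex_of_real c)" for x
  have c: "c \<noteq> 0" using False by (simp add: c_def)
  have F: "(F has_vector_derivative unit_exp (of_int k * x)) (at x within {0..1})" for x
  proof -
    have "(F has_vector_derivative
        (complex_of_real c * \<i> * cis (c * x)) / (\<i> * complex_of_real c)) (at x within {0..1})"
      unfolding has_vector_derivative_def F_def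
      by (rule has_derivative_eq_rhs, (rule derivative_intros)+)
         (use c in \<open>auto simp: fun_eq_iff scaleR_conv_of_real field_simps\<close>)
    then show ?thesis using c by (simp add: unit_exp_def c_def mult.assoc)
  qed
  have "((\<lambda>x. unit_exp (of_int k * x)) has_integral (F 1 - F 0)) {0..1}"
    by (rule fundamental_theorem_of_calculus) (use F in auto)
  moreover have "cis c = 1" using unit_exp_of_int[of k] by (simp add: unit_exp_def c_def)
  ultimately show ?thesis using False by (simp add: F_def)
qed

definition trig_sum :: "('i \<Rightarrow> complex) \<Rightarrow> ('i \<Rightarrow> int) \<Rightarrow> 'i set \<Rightarrow> real \<Rightarrow> complex" where
  "trig_sum c k I x = (\<Sum>i\<in>I. c i * unit_exp (of_int (k i) * x))"

lemma continuous_on_trig_sum: "continuous_on A (trig_sum c k I)"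
  unfolding trig_sum_def by (intro continuous_intros)

lemma borel_measurable_trig_sum [measurable]: "trig_sum c k I \<in> borel_measurable borel"
  by (intro borel_measurable_continuous_onI continuous_on_trig_sum)

lemma cnj_trig_sum: "cnj (trig_sum c k I x) = trig_sum (\<lambda>i. cnj (c i)) (\<lambda>i. - k i) I x"
  by (simp add: trig_sum_def cnj_unit_exp)

lemma trig_sum_mult:
  "trig_sum c k I x * trig_sum d l J x
    = trig_sum (\<lambda>(i, j). c i * d j) (\<lambda>(i, j). k i + l j) (I \<times> J) x"
proof -
  have "trig_sum c k I x * trig_sum d l J x
      = (\<Sum>(i, j)\<in>I \<times> J. (c i * unit_exp (of_int (k i) * x)) * (d j * unit_exp (of_int (l j) * x)))"
    unfolding trig_sum_def sum_product by (rule sum.cartesian_product)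
  also have "\<dots> = trig_sum (\<lambda>(i, j). c i * d j) (\<lambda>(i, j). k i + l j) (I \<times> J) x"
    unfolding trig_sum_def by (intro sum.cong) (auto simp: distrib_right unit_exp_add)
  finally show ?thesis .
qed

lemma has_integral_trig_sum:
  assumes "finite I"
  shows "(trig_sum c k I has_integral (\<Sum>i\<in>I. if k i = 0 then c i else 0)) {0..1}"
proof -
  have "((\<lambda>x. \<Sum>i\<in>I. c i * unit_exp (of_int (k i) * x)) has_integral
      (\<Sum>i\<in>I. c i * (if k i = 0 then 1 else 0))) {0..1}"
    by (intro has_integral_sum assms has_integral_mult_right has_integral_unit_exp)
  then show ?thesis by (simp add: trig_sum_def[abs_def] if_distrib[of "(*) _"] cong: if_cong)
qed

lemma has_integral_trig_sum_inner:
  assumes "finite I" "finite J"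
  shows "((\<lambda>x. trig_sum c k I x * cnj (trig_sum d l J x)) has_integral
    (\<Sum>i\<in>I. \<Sum>j\<in>J. if k i = l j then c i * cnj (d j) else 0)) {0..1}"
proof -
  have "((\<lambda>x. trig_sum c k I x * cnj (trig_sum d l J x)) has_integral
      (\<Sum>t\<in>I \<times> J. if (case t of (i, j) \<Rightarrow> k i + - l j) = 0
        then case t of (i, j) \<Rightarrow> c i * cnj (d j) else 0)) {0..1}"
    unfolding cnj_trig_sum trig_sum_mult using assms by (intro has_integral_trig_sum) simp
  also have "(\<Sum>t\<in>I \<times> J. if (case t of (i, j) \<Rightarrow> k i + - l j) = 0
      then case t of (i, j) \<Rightarrow> c i * cnj (d j) else 0)
      = (\<Sum>i\<in>I. \<Sum>j\<in>J. if k i = l j then c i * cnj (d j) else 0)"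
    unfolding sum.cartesian_product by (intro sum.cong) auto
  finally show ?thesis .
qed

lemma Lp_pow_2_trig_sum:
  assumes "finite I"
  shows "Lp_pow 2 (trig_sum c k I)
    = ennreal (Re (\<Sum>i\<in>I. \<Sum>j\<in>I. if k i = k j then c i * cnj (c j) else 0))"
proof -
  have "((\<lambda>x. Re (trig_sum c k I x * cnj (trig_sum c k I x))) has_integral
      Re (\<Sum>i\<in>I. \<Sum>j\<in>I. if k i = k j then c i * cnj (c j) else 0)) {0..1}"
    by (rule has_integral_Re[OF has_integral_trig_sum_inner[OF assms assms]])
  then have "((\<lambda>x. cmod (trig_sum c k I x) powr 2) has_integral
      Re (\<Sum>i\<in>I. \<Sum>j\<in>I. if k i = k j then c i * cnj (c j) else 0)) {0..1}"
    unfolding complex_norm_square[symmetric] by simp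
  then show ?thesis
    unfolding Lp_pow_def by (rule nn_integral_has_integral_lebesgue'[rotated]) simp
qed

lemma Parseval_trig_sum:
  assumes "finite I" "inj_on k I"
  shows "Lp_pow 2 (trig_sum c k I) = ennreal (\<Sum>i\<in>I. (cmod (c i))\<^sup>2)"
proof -
  have "(\<Sum>i\<in>I. \<Sum>j\<in>I. if k i = k j then c i * cnj (c j) else 0)
      = (\<Sum>i\<in>I. \<Sum>j\<in>I. if i = j then c i * cnj (c j) else 0)"
    using assms(2) by (intro sum.cong) (auto dest: inj_onD)
  also have "\<dots> = of_real (\<Sum>i\<in>I. (cmod (c i))\<^sup>2)"
    using assms(1) by (simp add: complex_norm_square[symmetric])
  finally show ?thesis by (simp add: Lp_pow_2_trig_sum[OF assms(1)])
qed

section \<open>Distance to the nearest integer\<close>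

definition int_dist :: "real \<Rightarrow> real" where
  "int_dist x = \<bar>x - of_int (round x)\<bar>"

lemma int_dist_nonneg: "0 \<le> int_dist x"
  by (simp add: int_dist_def)

lemma int_dist_le_abs_diff: "int_dist x \<le> \<bar>x - of_int m\<bar>"
  unfolding int_dist_def by (rule round_diff_minimal)

lemma int_dist_le_half: "int_dist x \<le> 1/2"
  unfolding int_dist_def using of_int_round_abs_le[of x] by linarith

lemma int_dist_eq_abs:
  assumes "\<bar>x\<bar> \<le> 1/2"
  shows "int_dist x = \<bar>x\<bar>"
proof (rule antisym)
  show "int_dist x \<le> \<bar>x\<bar>" using int_dist_le_abs_diff[of x 0] by simp
  show "\<bar>x\<bar> \<le> int_dist x"
  proof (cases "round x = 0")
    case False
    then have "\<bar>real_of_int (round x)\<bar> \<ge> 1" by linarith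
    then show ?thesis using assms unfolding int_dist_def by linarith
  qed (simp add: int_dist_def)
qed

lemma int_dist_le_add: "int_dist x \<le> int_dist y + \<bar>x - y\<bar>"
  using int_dist_le_abs_diff[of x "round y"] by (simp add: int_dist_def)

lemma int_dist_add_of_int: "int_dist (of_int m + x) = int_dist x"
proof (rule antisym)
  show "int_dist (of_int m + x) \<le> int_dist x"
    using int_dist_le_abs_diff[of "of_int m + x" "m + round x"] by (simp add: int_dist_def)
  show "int_dist x \<le> int_dist (of_int m + x)"
    using int_dist_le_abs_diff[of x "round (of_int m + x) - m"]
    by (simp add: int_dist_def algebra_simps)
qed

lemma Jordan_inequality_sin:
  assumes "0 \<le> t" "t \<le> pi/2"
  shows "2 / pi * t \<le> sin t"
proof -
  have "concave_on {0..pi/2} sin"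
  proof (rule f''_le0_imp_concave)
    show "((sin :: real \<Rightarrow> real) has_real_derivative cos x) (at x)" for x
      by (auto intro!: derivative_eq_intros)
    show "((cos :: real \<Rightarrow> real) has_real_derivative - sin x) (at x)" for x
      by (auto intro!: derivative_eq_intros)
  qed (auto intro!: sin_ge_zero)
  from concave_onD[OF this, of "2 / pi * t" 0 "pi/2"] show ?thesis
    using assms by (simp add: field_simps)
qed

lemma norm_one_minus_unit_exp: "cmod (1 - unit_exp u) = 2 * \<bar>sin (pi * u)\<bar>"
proof -
  have "(cmod (1 - unit_exp u))\<^sup>2 = (1 - cos (2 * (pi * u)))\<^sup>2 + (sin (2 * (pi * u)))\<^sup>2"
    by (simp add: unit_exp_def cmod_power2 mult.assoc)
  also have "\<dots> = 2 - 2 * cos (2 * (pi * u))"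
    using sin_cos_squared_add[of "2 * (pi * u)"] by (simp add: power2_eq_square algebra_simps)
  also have "\<dots> = (2 * sin (pi * u))\<^sup>2"
    by (simp add: cos_double_sin power2_eq_square)
  finally have "\<bar>cmod (1 - unit_exp u)\<bar> = \<bar>2 * sin (pi * u)\<bar>"
    by (simp only: power2_eq_iff abs_eq_iff)
  then show ?thesis by (simp add: abs_mult)
qed

lemma norm_one_minus_unit_exp_ge: "4 * int_dist u \<le> cmod (1 - unit_exp u)"
proof -
  define v where "v = u - of_int (round u)"
  have v: "\<bar>v\<bar> = int_dist u" by (simp add: v_def int_dist_def)
  have "4 * int_dist u = 2 * (2 / pi * (pi * \<bar>v\<bar>))" by (simp add: v)
  also have "\<dots> \<le> 2 * sin (pi * \<bar>v\<bar>)"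
    using int_dist_le_half[of u] v by (intro mult_left_mono Jordan_inequality_sin) auto
  also have "\<dots> \<le> cmod (1 - unit_exp v)"
    unfolding norm_one_minus_unit_exp by (cases "v \<ge> 0") auto
  also have "unit_exp v = unit_exp u"
    using unit_exp_add_of_int[of "- round u" u] by (simp add: v_def)
  finally show ?thesis .
qed

section \<open>Weyl differencing with tent weights\<close>

definition tent :: "real \<Rightarrow> real \<Rightarrow> real" where
  "tent w t = max 0 (1 - \<bar>t - w\<bar> / w)"

lemma tent_nonneg: "0 \<le> tent w t"
  by (simp add: tent_def)

lemma tent_le_1: "w > 0 \<Longrightarrow> tent w t \<le> 1"
  by (simp add: tent_def)

lemma tent_0: "w > 0 \<Longrightarrow> tent w 0 = 0"
  by (simp add: tent_def)

lemma tent_eq_0: "w > 0 \<Longrightarrow> 2 * w \<le> t \<Longrightarrow> tent w t = 0"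
  by (simp add: tent_def field_simps)

lemma tent_eq_ramps:
  assumes "w > 0" "t \<ge> 0"
  shows "tent w t = (max 0 t - 2 * max 0 (t - w) + max 0 (t - 2 * w)) / w"
  using assms by (auto simp: tent_def max_def abs_if field_simps)

lemma abs_tent_diff_le:
  assumes "w > 0"
  shows "\<bar>tent w (t + 1) - tent w t\<bar> \<le> 1 / w"
proof -
  have "\<bar>tent w (t + 1) - tent w t\<bar> \<le> \<bar>\<bar>t + 1 - w\<bar> / w - \<bar>t - w\<bar> / w\<bar>"
    by (auto simp: tent_def max_def abs_if)
  also have "\<dots> = \<bar>\<bar>t + 1 - w\<bar> - \<bar>t - w\<bar>\<bar> / w"
    using assms by (simp add: diff_divide_distrib[symmetric])
  also have "\<dots> \<le> 1 / w"
    using assms by (intro divide_right_mono) auto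
  finally show ?thesis .
qed

lemma sum_le_of_support:
  fixes f :: "nat \<Rightarrow> real"
  assumes "w \<ge> 1/2" "b \<ge> 0" "\<And>m. f m \<le> b" "\<And>m. 2 * w \<le> real m \<Longrightarrow> f m \<le> 0"
  shows "(\<Sum>m<M. f m) \<le> 4 * w * b"
proof -
  have "(\<Sum>m<M. f m) \<le> (\<Sum>m<M. if real m < 2 * w then b else 0)"
    using assms by (intro sum_mono) auto
  also have "\<dots> = (\<Sum>m\<in>{m\<in>{..<M}. real m < 2 * w}. b)"
    by (rule sum.inter_filter[symmetric]) simp
  also have "\<dots> \<le> (\<Sum>m<nat \<lceil>2 * w\<rceil>. b)"
    using assms by (intro sum_mono2) (auto simp: zless_nat_eq_int_zless less_ceiling_iff)
  also have "\<dots> = real (nat \<lceil>2 * w\<rceil>) * b" by simp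
  also have "\<dots> \<le> 4 * w * b"
    using assms by (intro mult_right_mono) linarith+
  finally show ?thesis .
qed

lemma sum_abs_diff_tent_le:
  assumes "w \<ge> 1/2"
  shows "(\<Sum>m<M. \<bar>tent w (real (m + 1)) - tent w (real m)\<bar>) \<le> 4"
proof -
  have "\<bar>tent w (real (m + 1)) - tent w (real m)\<bar> \<le> 1 / w" for m
    using assms abs_tent_diff_le[of w "real m"] by (simp add: add.commute)
  then have "(\<Sum>m<M. \<bar>tent w (real (m + 1)) - tent w (real m)\<bar>) \<le> 4 * w * (1 / w)"
    using assms by (intro sum_le_of_support) (auto simp: tent_eq_0)
  then show ?thesis using assms by simp
qed

definition second_diff :: "(nat \<Rightarrow> 'a::comm_ring_1) \<Rightarrow> nat \<Rightarrow> 'a" where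
  "second_diff v m = v (m + 2) - 2 * v (m + 1) + v m"

lemma sum_abs_second_diff_ramp_le:
  fixes c :: real
  shows "(\<Sum>m<M. \<bar>second_diff (\<lambda>m. max 0 (real m - c)) m\<bar>) \<le> 1"
proof -
  define slope where "slope m = max 0 (real (m + 1) - c) - max 0 (real m - c)" for m
  have "(\<Sum>m<M. \<bar>second_diff (\<lambda>m. max 0 (real m - c)) m\<bar>) = (\<Sum>m<M. slope (Suc m) - slope m)"
    by (intro sum.cong) (auto simp: slope_def second_diff_def max_def)
  also have "\<dots> = slope M - slope 0" by (rule sum_lessThan_telescope)
  also have "\<dots> \<le> 1" by (auto simp: slope_def max_def)
  finally show ?thesis .
qed

lemma sum_abs_second_diff_tent_le:
  assumes "w > 0"
  shows "(\<Sum>m<M. \<bar>second_diff (\<lambda>m. tent w (real (m + h))) m\<bar>) \<le> 4 / w"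
proof -
  define \<rho> where "\<rho> c = second_diff (\<lambda>m. max 0 (real m - c))" for c
  have "second_diff (\<lambda>m. tent w (real (m + h))) m
      = (\<rho> (- real h) m - 2 * \<rho> (w - real h) m + \<rho> (2 * w - real h) m) / w" for m
    using assms by (simp add: second_diff_def \<rho>_def tent_eq_ramps field_simps)
  then have "\<bar>second_diff (\<lambda>m. tent w (real (m + h))) m\<bar>
      \<le> (\<bar>\<rho> (- real h) m\<bar> + 2 * \<bar>\<rho> (w - real h) m\<bar> + \<bar>\<rho> (2 * w - real h) m\<bar>) / w" for m
    using assms by (simp add: abs_divide divide_right_mono)
  then have "(\<Sum>m<M. \<bar>second_diff (\<lambda>m. tent w (real (m + h))) m\<bar>)
      \<le> (\<Sum>m<M. (\<bar>\<rho> (- real h) m\<bar> + 2 * \<bar>\<rho> (w - real h) m\<bar> + \<bar>\<rho> (2 * w - real h) m\<bar>) / w)"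
    by (rule sum_mono)
  also have "\<dots> = ((\<Sum>m<M. \<bar>\<rho> (- real h) m\<bar>) + 2 * (\<Sum>m<M. \<bar>\<rho> (w - real h) m\<bar>)
      + (\<Sum>m<M. \<bar>\<rho> (2 * w - real h) m\<bar>)) / w"
    by (simp add: sum.distrib sum_divide_distrib[symmetric] sum_distrib_left)
  also have "\<dots> \<le> (1 + 2 * 1 + 1) / w"
    using assms unfolding \<rho>_def
    by (intro divide_right_mono add_mono mult_left_mono sum_abs_second_diff_ramp_le) auto
  finally show ?thesis by simp
qed

lemma abs_second_diff_mult_le:
  fixes f g :: "nat \<Rightarrow> real"
  assumes "\<And>m. \<bar>f m\<bar> \<le> 1" "\<And>m. \<bar>g m\<bar> \<le> 1" "\<And>m. \<bar>g (m + 1) - g m\<bar> \<le> \<delta>"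
  shows "\<bar>second_diff (\<lambda>m. f m * g m) m\<bar>
    \<le> \<bar>second_diff f m\<bar> + \<bar>second_diff g m\<bar> + 2 * \<delta> * \<bar>f (m + 1) - f m\<bar>"
proof -
  have "second_diff (\<lambda>m. f m * g m) m = g (m + 2) * second_diff f m + f m * second_diff g m
      + 2 * ((g (m + 2) - g (m + 1)) * (f (m + 1) - f m))"
    by (simp add: second_diff_def algebra_simps)
  then have "\<bar>second_diff (\<lambda>m. f m * g m) m\<bar>
      \<le> \<bar>g (m + 2) * second_diff f m\<bar> + \<bar>f m * second_diff g m\<bar>
        + 2 * \<bar>(g (m + 2) - g (m + 1)) * (f (m + 1) - f m)\<bar>"
    by linarith
  also have "\<dots> \<le> 1 * \<bar>second_diff f m\<bar> + 1 * \<bar>second_diff g m\<bar> + 2 * (\<delta> * \<bar>f (m + 1) - f m\<bar>)"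
    unfolding abs_mult using assms(1,2) assms(3)[of "m + 1"]
    by (intro add_mono mult_right_mono mult_left_mono) auto
  finally show ?thesis by simp
qed

lemma sum_shift_zero:
  fixes f :: "nat \<Rightarrow> 'a::comm_ring_1"
  assumes "f M = 0"
  shows "(\<Sum>m<M. f (Suc m)) = (\<Sum>m<M. f m) - f 0"
  using sum.lessThan_Suc_shift[of f M] assms by simp

lemma second_diff_summation:
  fixes v :: "nat \<Rightarrow> 'a::comm_ring_1"
  assumes "v 0 = 0" "v M = 0" "v (M + 1) = 0"
  shows "(1 - z)\<^sup>2 * (\<Sum>m<M. v m * z ^ m) = v 1 * z + (\<Sum>m<M. second_diff v m * z ^ (m + 2))"
proof -
  define S where "S = (\<Sum>m<M. v m * z ^ m)"
  have shift1: "(\<Sum>m<M. v (m + 1) * z ^ (m + 1)) = S"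
    using sum_shift_zero[of "\<lambda>m. v m * z ^ m" M] assms by (simp add: S_def)
  have shift2: "(\<Sum>m<M. v (m + 2) * z ^ (m + 2)) = S - v 1 * z"
    using sum_shift_zero[of "\<lambda>m. v (m + 1) * z ^ (m + 1)" M] assms shift1 by simp
  have "(\<Sum>m<M. second_diff v m * z ^ (m + 2))
     = (\<Sum>m<M. v (m + 2) * z ^ (m + 2)) - 2 * z * (\<Sum>m<M. v (m + 1) * z ^ (m + 1)) + z\<^sup>2 * S"
    by (simp add: S_def second_diff_def sum_distrib_left sum.distrib sum_subtractf algebra_simps
        power2_eq_square)
  also have "\<dots> = (1 - z)\<^sup>2 * S - v 1 * z"
    unfolding shift1 shift2 by (simp add: algebra_simps power2_eq_square)
  finally show ?thesis by (simp add: S_def)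
qed

lemma norm_power_sum_le_second_diff:
  fixes v :: "nat \<Rightarrow> real" and z :: complex
  assumes "v 0 = 0" "v M = 0" "v (M + 1) = 0" "cmod z = 1"
  shows "(cmod (1 - z))\<^sup>2 * cmod (\<Sum>m<M. of_real (v m) * z ^ m) \<le> \<bar>v 1\<bar> + (\<Sum>m<M. \<bar>second_diff v m\<bar>)"
proof -
  have of_real: "second_diff (\<lambda>m. complex_of_real (v m)) m = of_real (second_diff v m)" for m
    by (simp add: second_diff_def)
  have "(1 - z)\<^sup>2 * (\<Sum>m<M. of_real (v m) * z ^ m)
      = of_real (v 1) * z + (\<Sum>m<M. of_real (second_diff v m) * z ^ (m + 2))"
    unfolding of_real[symmetric] by (rule second_diff_summation) (use assms in simp_all)
  then have "(cmod (1 - z))\<^sup>2 * cmod (\<Sum>m<M. of_real (v m) * z ^ m)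
      = cmod (of_real (v 1) * z + (\<Sum>m<M. of_real (second_diff v m) * z ^ (m + 2)))"
    by (metis norm_mult norm_power)
  also have "\<dots> \<le> cmod (of_real (v 1) * z) + (\<Sum>m<M. cmod (of_real (second_diff v m) * z ^ (m + 2)))"
    by (rule order_trans[OF norm_triangle_ineq]) (intro add_left_mono norm_sum)
  also have "\<dots> = \<bar>v 1\<bar> + (\<Sum>m<M. \<bar>second_diff v m\<bar>)"
    using assms(4) by (simp add: norm_mult norm_power)
  finally show ?thesis .
qed

lemma sum_abs_second_diff_tent_mult_le:
  assumes "w \<ge> 1/2"
  shows "(\<Sum>m<M. \<bar>second_diff (\<lambda>m. tent w (real m) * tent w (real (m + h))) m\<bar>) \<le> 16 / w"
proof -
  define f where "f m = tent w (real m)" for m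
  define g where "g m = tent w (real (m + h))" for m
  have w: "w > 0" using assms by simp
  have "\<bar>second_diff (\<lambda>m. f m * g m) m\<bar>
      \<le> \<bar>second_diff f m\<bar> + \<bar>second_diff g m\<bar> + 2 * (1 / w) * \<bar>f (m + 1) - f m\<bar>" for m
  proof (rule abs_second_diff_mult_le)
    fix m
    show "\<bar>f m\<bar> \<le> 1" "\<bar>g m\<bar> \<le> 1"
      using w by (simp_all add: f_def g_def tent_nonneg tent_le_1)
    show "\<bar>g (m + 1) - g m\<bar> \<le> 1 / w"
      using abs_tent_diff_le[OF w, of "real (m + h)"] by (simp add: g_def add_ac)
  qed
  then have "(\<Sum>m<M. \<bar>second_diff (\<lambda>m. f m * g m) m\<bar>)
      \<le> (\<Sum>m<M. \<bar>second_diff f m\<bar> + \<bar>second_diff g m\<bar> + 2 * (1 / w) * \<bar>f (m + 1) - f m\<bar>)"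
    by (rule sum_mono)
  also have "\<dots> = (\<Sum>m<M. \<bar>second_diff f m\<bar>) + (\<Sum>m<M. \<bar>second_diff g m\<bar>)
      + 2 * (1 / w) * (\<Sum>m<M. \<bar>f (m + 1) - f m\<bar>)"
    by (simp add: sum.distrib sum_distrib_left)
  also have "\<dots> \<le> 4 / w + 4 / w + 2 * (1 / w) * 4"
    using sum_abs_second_diff_tent_le[OF w, of 0 M] sum_abs_second_diff_tent_le[OF w, of h M]
      sum_abs_diff_tent_le[OF assms, of M] w
    by (intro add_mono mult_left_mono) (simp_all add: f_def[abs_def] g_def[abs_def])
  also have "\<dots> = 16 / w" by simp
  finally show ?thesis by (simp add: f_def g_def)
qed

text \<open>The sharper of two bounds for the correlation sums of tents, up to a constant: the trivial one
  and the one from two summations by parts. Its quadratic decay is what makes Weyl differencing lose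
  no logarithm.\<close>

definition corr_bound :: "real \<Rightarrow> real \<Rightarrow> real" where
  "corr_bound w u = 6 * w / (1 + (w * int_dist u)\<^sup>2)"

lemma corr_bound_nonneg: "w \<ge> 0 \<Longrightarrow> 0 \<le> corr_bound w u"
  by (simp add: corr_bound_def)

lemma norm_tent_correlation_le:
  assumes w: "w \<ge> 1/2" and M: "2 * w \<le> real M"
  shows "cmod (\<Sum>m<M. of_real (tent w (real m) * tent w (real (m + h))) * unit_exp u ^ m)
      \<le> corr_bound w u"
    (is "?X \<le> _")
proof -
  define v where "v m = tent w (real m) * tent w (real (m + h))" for m
  have v: "0 \<le> v m" "v m \<le> tent w (real m)" for m
    using w by (auto simp: v_def tent_nonneg tent_le_1 intro!: mult_left_le)
  have "?X \<le> (\<Sum>m<M. \<bar>v m\<bar>)"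
    by (rule order_trans[OF norm_sum]) (simp add: norm_mult norm_power v_def abs_mult)
  also have "\<dots> \<le> 4 * w * 1"
    using w v tent_le_1[of w]
    by (intro sum_le_of_support) (auto simp: v_def tent_eq_0 intro: order_trans)
  finally have trivial: "?X \<le> 4 * w" by simp
  have "(4 * int_dist u)\<^sup>2 * ?X \<le> (cmod (1 - unit_exp u))\<^sup>2 * ?X"
    by (intro mult_right_mono power_mono norm_one_minus_unit_exp_ge) (auto simp: int_dist_nonneg)
  also have "\<dots> \<le> \<bar>v 1\<bar> + (\<Sum>m<M. \<bar>second_diff v m\<bar>)"
    unfolding v_def[symmetric] using w M
    by (intro norm_power_sum_le_second_diff) (auto simp: v_def tent_0 tent_eq_0)
  also have "\<dots> \<le> 1 / w + 16 / w"
    unfolding v_def using v[of 1] abs_tent_diff_le[of w 0] w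
    by (intro add_mono sum_abs_second_diff_tent_mult_le) (auto simp: v_def tent_0)
  finally have "w * ((4 * int_dist u)\<^sup>2 * ?X) \<le> 17"
    using w by (simp add: field_simps)
  then have "16 * (w * ((w * int_dist u)\<^sup>2 * ?X)) \<le> w * (w * 17)"
    using w by (simp add: power_mult_distrib power2_eq_square mult_ac)
  then have "?X * (1 + (w * int_dist u)\<^sup>2) \<le> 6 * w"
    using trivial w by (simp add: algebra_simps)
  then show ?thesis
    unfolding corr_bound_def by (subst pos_le_divide_eq) (auto simp: add_pos_nonneg)
qed

lemma norm_sum_sq_eq_correlations:
  fixes c :: "nat \<Rightarrow> complex"
  shows "(cmod (\<Sum>l<M. c l))\<^sup>2
    = (\<Sum>l<M. (cmod (c l))\<^sup>2) + 2 * Re (\<Sum>h\<in>{1..<M}. \<Sum>m<M-h. c (m + h) * cnj (c m))"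
proof (induction M)
  case (Suc M)
  have "(\<Sum>h\<in>{1..<Suc M}. \<Sum>m<Suc M-h. c (m + h) * cnj (c m))
     = (\<Sum>h\<in>{1..<Suc M}. (\<Sum>m<M-h. c (m + h) * cnj (c m)) + c M * cnj (c (M - h)))"
    by (intro sum.cong) (auto simp: Suc_diff_le)
  also have "\<dots>
      = (\<Sum>h\<in>{1..<M}. \<Sum>m<M-h. c (m + h) * cnj (c m)) + c M * (\<Sum>h\<in>{1..<Suc M}. cnj (c (M - h)))"
    by (cases "M = 0") (simp_all add: sum.distrib sum_distrib_left distrib_left)
  also have "(\<Sum>h\<in>{1..<Suc M}. cnj (c (M - h))) = cnj (\<Sum>m<M. c m)"
    unfolding cnj_sum by (rule sum.reindex_bij_witness[of _ "\<lambda>m. M - m" "\<lambda>m. M - m"]) auto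
  finally have correlations: "(\<Sum>h\<in>{1..<Suc M}. \<Sum>m<Suc M-h. c (m + h) * cnj (c m))
     = (\<Sum>h\<in>{1..<M}. \<Sum>m<M-h. c (m + h) * cnj (c m)) + c M * cnj (\<Sum>m<M. c m)" .
  have "(cmod (z + w))\<^sup>2 = (cmod z)\<^sup>2 + (cmod w)\<^sup>2 + 2 * Re (w * cnj z)" for z w
    unfolding cmod_power2 by (simp add: algebra_simps power2_eq_square)
  from this[of "\<Sum>l<M. c l" "c M"] show ?case
    unfolding correlations by (simp add: Suc.IH)
qed simp

text \<open>The shift \<open>D\<close> makes room for tents placed anywhere on the line: differencing turns it into
  a phase that is constant in the inner sum, so every bound below is uniform in \<open>D\<close>.\<close>

definition tent_term :: "real \<Rightarrow> real \<Rightarrow> real \<Rightarrow> nat \<Rightarrow> complex" where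
  "tent_term w D x l = of_real (tent w (real l)) * unit_exp ((D + real l)\<^sup>2 * x)"

definition tent_sum :: "real \<Rightarrow> nat \<Rightarrow> real \<Rightarrow> real \<Rightarrow> complex" where
  "tent_sum w M D x = (\<Sum>l<M. tent_term w D x l)"

lemma continuous_on_tent_sum: "continuous_on S (tent_sum w M D)"
  unfolding tent_sum_def tent_term_def by (intro continuous_intros)

lemma norm_tent_term_correlation_le:
  assumes w: "w \<ge> 1/2" and M: "2 * w \<le> real M"
  shows "cmod (\<Sum>m<M-h. tent_term w D x (m + h) * cnj (tent_term w D x m))
      \<le> corr_bound w (real (2 * h) * x)"
proof -
  define \<tau> where "\<tau> m = tent w (real m) * tent w (real (m + h))" for m
  define z where "z = unit_exp (real (2 * h) * x)"
  have "tent_term w D x (m + h) * cnj (tent_term w D x m)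
      = unit_exp ((2 * D * h + h\<^sup>2) * x) * (of_real (\<tau> m) * z ^ m)" for m
  proof -
    have "unit_exp ((D + real (m + h))\<^sup>2 * x) * unit_exp (- ((D + real m)\<^sup>2 * x))
        = unit_exp ((2 * D * h + h\<^sup>2) * x) * z ^ m"
      unfolding z_def unit_exp_power unit_exp_add[symmetric]
      by (rule arg_cong[of _ _ unit_exp]) (simp add: algebra_simps power2_eq_square)
    then show ?thesis by (simp add: tent_term_def \<tau>_def cnj_unit_exp mult_ac)
  qed
  then have "cmod (\<Sum>m<M-h. tent_term w D x (m + h) * cnj (tent_term w D x m))
      = cmod (\<Sum>m<M-h. of_real (\<tau> m) * z ^ m)"
    by (simp add: sum_distrib_left[symmetric] norm_mult)
  also have "(\<Sum>m<M-h. of_real (\<tau> m) * z ^ m) = (\<Sum>m<M. of_real (\<tau> m) * z ^ m)"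
    using w M by (intro sum.mono_neutral_left) (auto simp: \<tau>_def tent_eq_0)
  also have "cmod \<dots> \<le> corr_bound w (real (2 * h) * x)"
    unfolding \<tau>_def z_def by (rule norm_tent_correlation_le[OF w M])
  finally show ?thesis .
qed

lemma norm_tent_sum_sq_le:
  assumes w: "w \<ge> 1/2" and M: "2 * w \<le> real M"
  shows "(cmod (tent_sum w M D x))\<^sup>2 \<le> 4 * w + 2 * (\<Sum>t\<in>{1..nat \<lfloor>4 * w\<rfloor>}. corr_bound w (real t * x))"
proof -
  define C where "C h = (\<Sum>m<M-h. tent_term w D x (m + h) * cnj (tent_term w D x m))" for h
  define H where "H = {h\<in>{1..<M}. real h < 2 * w}"
  have "tent_term w D x (m + h) = 0" if "2 * w \<le> real h" for m h
    using that w by (simp add: tent_term_def tent_eq_0)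
  then have C_eq_0: "C h = 0" if "h \<in> {1..<M} - H" for h
    using that by (auto simp: C_def H_def not_less)
  have "(\<Sum>l<M. (cmod (tent_term w D x l))\<^sup>2) \<le> 4 * w * 1"
    using w by (intro sum_le_of_support)
      (auto simp: tent_term_def norm_mult tent_nonneg tent_le_1 tent_eq_0 power_le_one)
  moreover have "Re (\<Sum>h\<in>{1..<M}. C h) \<le> (\<Sum>t\<in>{1..nat \<lfloor>4 * w\<rfloor>}. corr_bound w (real t * x))"
  proof -
    have "Re (\<Sum>h\<in>{1..<M}. C h) = Re (\<Sum>h\<in>H. C h)"
      using C_eq_0 by (intro arg_cong[of _ _ Re] sum.mono_neutral_right) (auto simp: H_def)
    also have "\<dots> \<le> (\<Sum>h\<in>H. cmod (C h))"
      by (rule order_trans[OF complex_Re_le_cmod norm_sum])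
    also have "\<dots> \<le> (\<Sum>h\<in>H. corr_bound w (real (2 * h) * x))"
      unfolding C_def by (intro sum_mono norm_tent_term_correlation_le w M)
    also have "\<dots> = (\<Sum>t\<in>(\<lambda>h. 2 * h) ` H. corr_bound w (real t * x))"
      by (subst sum.reindex) (auto simp: inj_on_def)
    also have "\<dots> \<le> (\<Sum>t\<in>{1..nat \<lfloor>4 * w\<rfloor>}. corr_bound w (real t * x))"
      using w by (intro sum_mono2 corr_bound_nonneg) (auto simp: H_def le_nat_iff le_floor_iff)
    finally show ?thesis .
  qed
  ultimately show ?thesis
    unfolding tent_sum_def norm_sum_sq_eq_correlations C_def[symmetric] by simp
qed

section \<open>Summing the correlation bounds near a rational\<close>

lemma sum_mult_residues:
  fixes a :: int and g :: "int \<Rightarrow> 'a::comm_monoid_add"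
  assumes "coprime a (int Q)" "Q > 0"
  shows "(\<Sum>t<Q. g ((a * int t) mod int Q)) = (\<Sum>r<Q. g (int r))"
proof -
  have int_sum: "(\<Sum>t<Q. f (int t)) = f 0 + sum f {1..<int Q}" for f :: "int \<Rightarrow> 'a"
  proof -
    have "(\<Sum>t<Q. f (int t)) = sum f {0..<int Q}"
      by (rule sum.reindex_bij_witness[of _ nat int]) auto
    also have "{0..<int Q} = insert 0 {1..<int Q}" using \<open>Q > 0\<close> by auto
    finally show ?thesis by simp
  qed
  have "(\<Sum>m\<in>{1..<int Q}. g ((a * m) mod int Q)) = sum g {1..<int Q}"
    using bij_betw_int_remainders_mult[OF assms(1)] by (rule sum.reindex_bij_betw)
  then show ?thesis
    using int_sum[of g] int_sum[of "\<lambda>m. g ((a * m) mod int Q)"] by simp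
qed

lemma sum_residues_le:
  fixes a :: int and g :: "int \<Rightarrow> real"
  assumes "coprime a (int Q)" "Q > 0" "\<And>r. g r \<ge> 0"
  shows "(\<Sum>t<T. g ((a * int t) mod int Q)) \<le> real (T div Q + 1) * (\<Sum>r<Q. g (int r))"
proof -
  define n where "n = T div Q + 1"
  define f where "f t = g ((a * int t) mod int Q)" for t
  have "T \<le> n * Q"
    using \<open>Q > 0\<close> by (simp add: n_def dividend_less_div_times less_imp_le)
  then have "(\<Sum>t<T. f t) \<le> (\<Sum>t<n * Q. f t)"
    using assms by (intro sum_mono2) (auto simp: f_def)
  also have "\<dots> = (\<Sum>m<n. sum f {m * Q..<m * Q + Q})"
    by (rule sum.nat_group[symmetric])
  also have "\<dots> = (\<Sum>m<n. \<Sum>t<Q. f t)"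
  proof (rule sum.cong[OF refl])
    fix m
    have "a * int (m * Q + t) = a * int t + a * int m * int Q" for t
      by (simp add: algebra_simps)
    then have "f (m * Q + t) = f t" for t
      by (simp only: f_def mod_mult_self1)
    then show "sum f {m * Q..<m * Q + Q} = (\<Sum>t<Q. f t)"
      using sum.shift_bounds_nat_ivl[of f 0 "m * Q" Q] by (simp add: add.commute lessThan_atLeast0)
  qed
  also have "\<dots> = real n * (\<Sum>r<Q. g (int r))"
    using sum_mult_residues[OF assms(1,2), of g] by (simp add: f_def)
  finally show ?thesis by (simp add: f_def n_def)
qed

lemma sum_inverse_squares_le: "(\<Sum>r=1..n. 1 / (real r)\<^sup>2) \<le> 2"
proof -
  have sums: "(\<lambda>r. 1 / (real r + 1)\<^sup>2) sums (pi\<^sup>2 / 6)"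
    using inverse_squares_sums by (simp add: add.commute)
  have "(\<Sum>r=1..n. 1 / (real r)\<^sup>2) = (\<Sum>r<n. 1 / (real r + 1)\<^sup>2)"
    by (rule sum.reindex_bij_witness[of _ Suc "\<lambda>r. r - 1"]) (auto simp: of_nat_diff)
  also have "\<dots> \<le> pi\<^sup>2 / 6"
    using sum_le_suminf[OF sums_summable[OF sums], of "{..<n}"] sums_unique[OF sums] by simp
  also have "\<dots> \<le> 3.2\<^sup>2 / 6"
    using pi_approx by (intro divide_right_mono power_mono) auto
  also have "\<dots> \<le> 2" by (simp add: power2_eq_square)
  finally show ?thesis .
qed

text \<open>The term \<open>r = 0\<close> vanishes, since it is a division by zero.\<close>

lemma sum_inverse_int_dist_squares_le:
  "(\<Sum>r<Q. 1 / (int_dist (real r / real Q))\<^sup>2) \<le> 4 * (real Q)\<^sup>2"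
proof -
  have pointwise: "1 / (int_dist (real r / real Q))\<^sup>2
      \<le> (real Q)\<^sup>2 * (1 / (real r)\<^sup>2 + 1 / (real (Q - r))\<^sup>2)" if "r \<in> {1..<Q}" for r
  proof -
    define u where "u = real r / real Q"
    have u: "0 < u" "u < 1" "1 - u = real (Q - r) / real Q"
      using that by (auto simp: u_def field_simps of_nat_diff)
    have "int_dist (u - 1) = int_dist u" using int_dist_add_of_int[of "-1" u] by simp
    then have "int_dist u = u \<or> int_dist u = 1 - u"
      using int_dist_eq_abs[of u] int_dist_eq_abs[of "u - 1"] u(1,2) by (cases "u \<le> 1/2") auto
    then have "1 / (int_dist u)\<^sup>2 \<le> 1 / u\<^sup>2 + 1 / (1 - u)\<^sup>2" by auto
    also have "1 / u\<^sup>2 + 1 / (1 - u)\<^sup>2 = (real Q)\<^sup>2 * (1 / (real r)\<^sup>2 + 1 / (real (Q - r))\<^sup>2)"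
      unfolding u(3) by (simp add: u_def power_divide field_simps)
    finally show ?thesis by (simp add: u_def)
  qed
  have "(\<Sum>r<Q. 1 / (int_dist (real r / real Q))\<^sup>2)
      = (\<Sum>r\<in>{1..<Q}. 1 / (int_dist (real r / real Q))\<^sup>2)"
    by (rule sum.mono_neutral_right) (auto simp: int_dist_def Suc_le_eq)
  also have "\<dots> \<le> (\<Sum>r\<in>{1..<Q}. (real Q)\<^sup>2 * (1 / (real r)\<^sup>2 + 1 / (real (Q - r))\<^sup>2))"
    by (intro sum_mono pointwise)
  also have "\<dots> = (real Q)\<^sup>2 * ((\<Sum>r\<in>{1..<Q}. 1 / (real r)\<^sup>2) + (\<Sum>r\<in>{1..<Q}. 1 / (real (Q - r))\<^sup>2))"
    by (simp only: sum.distrib sum_distrib_left[symmetric])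
  also have "(\<Sum>r\<in>{1..<Q}. 1 / (real (Q - r))\<^sup>2) = (\<Sum>r\<in>{1..<Q}. 1 / (real r)\<^sup>2)"
    by (rule sum.reindex_bij_witness[of _ "\<lambda>r. Q - r" "\<lambda>r. Q - r"]) auto
  also have "(real Q)\<^sup>2 * ((\<Sum>r\<in>{1..<Q}. 1 / (real r)\<^sup>2) + (\<Sum>r\<in>{1..<Q}. 1 / (real r)\<^sup>2))
      \<le> (real Q)\<^sup>2 * (2 + 2)"
  proof (intro mult_left_mono add_mono)
    have "(\<Sum>r\<in>{1..<Q}. 1 / (real r)\<^sup>2) \<le> (\<Sum>r=1..Q. 1 / (real r)\<^sup>2)"
      by (intro sum_mono2) auto
    also have "\<dots> \<le> 2" by (rule sum_inverse_squares_le)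
    finally show "(\<Sum>r\<in>{1..<Q}. 1 / (real r)\<^sup>2) \<le> 2" "(\<Sum>r\<in>{1..<Q}. 1 / (real r)\<^sup>2) \<le> 2"
      by simp_all
  qed simp
  finally show ?thesis by simp
qed

lemma int_dist_divide_mod:
  assumes "q > 0"
  shows "int_dist (of_int (m mod q) / of_int q) = int_dist (of_int m / of_int q)"
proof -
  have "real_of_int m / of_int q = of_int (m div q * q + m mod q) / of_int q"
    by (simp only: div_mult_mod_eq)
  also have "\<dots> = of_int (m div q) + of_int (m mod q) / of_int q"
    using assms unfolding of_int_add of_int_mult by (simp add: add_divide_distrib)
  finally have "real_of_int m / of_int q = of_int (m div q) + of_int (m mod q) / of_int q" .
  then show ?thesis by (simp only: int_dist_add_of_int)
qed

lemma int_dist_divide_ge: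
  assumes "q > 0" "\<not> q dvd m"
  shows "1 / of_int q \<le> int_dist (of_int m / of_int q)"
proof -
  define k where "k = round (real_of_int m / of_int q)"
  have "m - k * q \<noteq> 0" using assms(2) by auto
  then have "1 \<le> \<bar>real_of_int (m - k * q)\<bar>" by linarith
  then have "1 / of_int q \<le> \<bar>real_of_int (m - k * q)\<bar> / of_int q"
    using assms(1) by (intro divide_right_mono) auto
  also have "\<dots> = \<bar>real_of_int (m - k * q) / of_int q\<bar>"
    using assms(1) by (simp add: abs_divide)
  also have "real_of_int (m - k * q) / of_int q = of_int m / of_int q - of_int k"
    using assms(1) by (simp add: diff_divide_distrib)
  finally show ?thesis by (simp add: int_dist_def k_def)
qed

lemma corr_bound_nonmultiple_le:
  fixes a :: int
  assumes "w > 0" "Q > 0" "\<not> int Q dvd a * int t"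
    "\<bar>real t * (x - of_int a / real Q)\<bar> \<le> 1 / (2 * real Q)"
  shows "corr_bound w (real t * x) \<le> 24 / w * (1 / (int_dist (of_int (a * int t) / real Q))\<^sup>2)"
proof -
  define d where "d = int_dist (of_int (a * int t) / real Q)"
  have d: "1 / real Q \<le> d"
    using int_dist_divide_ge[of "int Q" "a * int t"] assms by (simp add: d_def)
  have "0 < 1 / real Q" using \<open>Q > 0\<close> by simp
  with d have "d > 0" by linarith
  have "d \<le> int_dist (real t * x) + \<bar>of_int (a * int t) / real Q - real t * x\<bar>"
    unfolding d_def by (rule int_dist_le_add)
  also have "of_int (a * int t) / real Q - real t * x = - (real t * (x - of_int a / real Q))"
    using \<open>Q > 0\<close> by (simp add: field_simps)
  finally have half: "d / 2 \<le> int_dist (real t * x)"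
    using assms(4) d by simp
  have "corr_bound w (real t * x) \<le> 6 * w / (w * (d / 2))\<^sup>2"
    unfolding corr_bound_def using assms \<open>d > 0\<close> half
    by (intro divide_left_mono add_increasing power_mono mult_left_mono mult_pos_pos add_pos_nonneg)
      auto
  also have "\<dots> = 24 / w * (1 / d\<^sup>2)"
    using assms \<open>d > 0\<close> by (simp add: power2_eq_square field_simps)
  finally show ?thesis by (simp add: d_def)
qed

lemma sum_powr_le:
  fixes \<eta> :: real
  assumes "0 < \<eta>" "\<eta> < 1"
  shows "(\<Sum>k=1..n. real k powr (- \<eta>)) \<le> real n powr (1 - \<eta>) / (1 - \<eta>)"
proof (induction n)
  case (Suc n)
  define N where "N = real (Suc n)"
  define y where "y = (real n / N) powr (1 - \<eta>)"
  have N: "N > 0" by (simp add: N_def)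
  have "1 + 1 / (1 - \<eta>) * (y - 1) \<le> y powr (1 / (1 - \<eta>))"
    using assms by (intro Bernoulli_inequality_powr) (auto simp: y_def)
  also have "\<dots> = 1 - 1 / N"
    using assms N by (simp add: y_def powr_powr) (simp add: N_def field_simps)
  finally have "(1 - \<eta>) / N \<le> 1 - y"
    using assms N by (simp add: field_simps)
  then have "N powr (1 - \<eta>) * ((1 - \<eta>) / N) \<le> N powr (1 - \<eta>) * (1 - y)"
    by (rule mult_left_mono) simp
  also have "\<dots> = N powr (1 - \<eta>) - real n powr (1 - \<eta>)"
    using N by (simp add: y_def powr_divide right_diff_distrib)
  also have "N powr (1 - \<eta>) * ((1 - \<eta>) / N) = N powr (- \<eta>) * (1 - \<eta>)"
    using N by (simp add: powr_diff powr_minus field_simps)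
  finally have "N powr (- \<eta>) \<le> (N powr (1 - \<eta>) - real n powr (1 - \<eta>)) / (1 - \<eta>)"
    using assms by (simp add: field_simps)
  then show ?case using Suc by (simp add: N_def diff_divide_distrib)
qed (use assms in auto)

lemma corr_bound_le_powr:
  fixes \<eta> \<tau> \<beta> :: real
  assumes "w > 0" "0 < \<eta>" "\<eta> < 1" "0 < \<tau>" "\<tau> \<le> 1" "\<beta> \<ge> 0" and u: "w * int_dist u = 4 * (\<tau> * \<beta>)"
  shows "corr_bound w u \<le> 12 * w * (\<tau> powr (- \<eta>) * (1 + \<beta>) powr (- \<eta>))"
proof -
  define X where "X = 1 + (w * int_dist u)\<^sup>2"
  have "X > 0" by (simp add: X_def add_pos_nonneg)
  have "\<tau> powr \<eta> * (1 + \<beta>) powr \<eta> = (\<tau> + \<tau> * \<beta>) powr \<eta>"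
    by (simp add: powr_mult[symmetric] distrib_left)
  also have "\<dots> \<le> (1 + \<tau> * \<beta>) powr \<eta>"
    using assms by (intro powr_mono2) auto
  also have "\<dots> \<le> (1 + \<tau> * \<beta>) powr 1"
    using assms by (intro powr_mono) auto
  also have "\<dots> = 1 + \<tau> * \<beta>"
    using assms by simp
  also have "\<dots> \<le> 2 * X"
    unfolding X_def u using zero_le_power2[of "1 - \<tau> * \<beta> / 2"] zero_le_power2[of "\<tau> * \<beta>"]
    by (simp add: power2_eq_square algebra_simps)
  finally have "12 * w / (2 * X) \<le> 12 * w / (\<tau> powr \<eta> * (1 + \<beta>) powr \<eta>)"
    using assms \<open>X > 0\<close> by (intro divide_left_mono mult_pos_pos) auto
  then show ?thesis
    by (simp add: corr_bound_def X_def[symmetric] powr_minus_divide)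
qed

definition major_arc :: "real \<Rightarrow> real \<Rightarrow> real \<Rightarrow> real \<Rightarrow> real" where
  "major_arc \<eta> w q \<beta> = w\<^sup>2 / q * (1 + w\<^sup>2 * \<bar>\<beta>\<bar>) powr (- \<eta>)"

lemma major_arc_nonneg: "q \<ge> 0 \<Longrightarrow> 0 \<le> major_arc \<eta> w q \<beta>"
  by (simp add: major_arc_def)

lemma sum_corr_bound_multiples_le:
  assumes "w > 0" and q: "q > 0" "real n \<le> 4 * w / q" and \<eta>: "0 < \<eta>" "\<eta> < 1"
    and \<beta>: "\<And>k. k \<in> {1..n} \<Longrightarrow> \<bar>real k * q * \<beta>\<bar> \<le> 1/2"
  shows "(\<Sum>k=1..n. corr_bound w (real k * q * \<beta>)) \<le> 48 / (1 - \<eta>) * major_arc \<eta> w q \<beta>"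
proof -
  define v where "v = 4 * w / q"
  define P where "P = (1 + w\<^sup>2 * \<bar>\<beta>\<bar>) powr (- \<eta>)"
  have v: "v > 0" using assms by (simp add: v_def)
  have "corr_bound w (real k * q * \<beta>) \<le> 12 * w * P * v powr \<eta> * real k powr (- \<eta>)"
    if k: "k \<in> {1..n}" for k
  proof -
    have "corr_bound w (real k * q * \<beta>) \<le> 12 * w * ((real k / v) powr (- \<eta>) * P)"
      unfolding P_def
    proof (rule corr_bound_le_powr)
      have "real k \<le> real n" using k by simp
      then show "real k / v \<le> 1" using q(2) v by (simp add: v_def[symmetric])
      show "w * int_dist (real k * q * \<beta>) = 4 * (real k / v * (w\<^sup>2 * \<bar>\<beta>\<bar>))"
        using assms k by (simp add: int_dist_eq_abs \<beta> abs_mult v_def power2_eq_square)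
    qed (use assms v k in auto)
    also have "(real k / v) powr (- \<eta>) = v powr \<eta> * real k powr (- \<eta>)"
      using v by (simp add: powr_divide powr_minus field_simps)
    finally show ?thesis by (simp add: mult_ac)
  qed
  then have "(\<Sum>k=1..n. corr_bound w (real k * q * \<beta>))
      \<le> 12 * w * P * v powr \<eta> * (\<Sum>k=1..n. real k powr (- \<eta>))"
    unfolding sum_distrib_left by (rule sum_mono)
  also have "\<dots> \<le> 12 * w * P * v powr \<eta> * (v powr (1 - \<eta>) / (1 - \<eta>))"
  proof (intro mult_left_mono)
    have "(\<Sum>k=1..n. real k powr (- \<eta>)) \<le> real n powr (1 - \<eta>) / (1 - \<eta>)"
      by (rule sum_powr_le[OF \<eta>])
    also have "\<dots> \<le> v powr (1 - \<eta>) / (1 - \<eta>)"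
      using q \<eta> by (intro divide_right_mono powr_mono2) (auto simp: v_def)
    finally show "(\<Sum>k=1..n. real k powr (- \<eta>)) \<le> v powr (1 - \<eta>) / (1 - \<eta>)" .
  qed (use assms in \<open>auto simp: P_def\<close>)
  also have "\<dots> = 12 / (1 - \<eta>) * w * P * (v powr \<eta> * v powr (1 - \<eta>))" by simp
  also have "v powr \<eta> * v powr (1 - \<eta>) = v" using v by (simp flip: powr_add)
  also have "12 / (1 - \<eta>) * w * P * v = 48 / (1 - \<eta>) * major_arc \<eta> w q \<beta>"
    by (simp add: v_def P_def major_arc_def power2_eq_square)
  finally show ?thesis .
qed

lemma sum_corr_bound_nonmultiples_le:
  fixes a :: int
  assumes w: "w \<ge> 1/2" and Q: "Q > 0" "real Q \<le> 10 * w" "coprime a (int Q)" and T: "real T \<le> 4 * w"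
    and x: "\<And>t. t \<le> T \<Longrightarrow> \<bar>real t * (x - of_int a / real Q)\<bar> \<le> 1 / (2 * real Q)"
  shows "(\<Sum>t\<in>{t\<in>{1..T}. \<not> Q dvd t}. corr_bound w (real t * x)) \<le> 15360 * w"
proof -
  define g where "g r = 1 / (int_dist (of_int r / real Q))\<^sup>2" for r :: int
  have g_mod: "g (m mod int Q) = g m" for m
    using int_dist_divide_mod[of "int Q" m] Q by (simp add: g_def)
  have "corr_bound w (real t * x) \<le> 24 / w * g (a * int t)" if "t \<in> {1..T}" "\<not> Q dvd t" for t
    unfolding g_def using that w Q x[of t]
    by (intro corr_bound_nonmultiple_le) (auto simp: coprime_dvd_mult_right_iff coprime_commute)
  then have "(\<Sum>t\<in>{t\<in>{1..T}. \<not> Q dvd t}. corr_bound w (real t * x))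
      \<le> (\<Sum>t\<in>{t\<in>{1..T}. \<not> Q dvd t}. 24 / w * g (a * int t))"
    by (intro sum_mono) auto
  also have "\<dots> \<le> (\<Sum>t<T + 1. 24 / w * g (a * int t))"
    using w by (intro sum_mono2) (auto simp: g_def)
  also have "\<dots> = 24 / w * (\<Sum>t<T + 1. g ((a * int t) mod int Q))"
    unfolding g_mod sum_distrib_left ..
  also have "\<dots> \<le> 24 / w * (real ((T + 1) div Q + 1) * (\<Sum>r<Q. g (int r)))"
    using w Q by (intro mult_left_mono sum_residues_le) (auto simp: g_def)
  also have "\<dots> \<le> 24 / w * (real ((T + 1) div Q + 1) * (4 * (real Q)\<^sup>2))"
    using w sum_inverse_int_dist_squares_le[of Q] by (intro mult_left_mono) (auto simp: g_def)
  also have "\<dots> = 96 / w * (real (((T + 1) div Q) * Q) + real Q) * real Q"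
    by (simp add: algebra_simps power2_eq_square)
  also have "\<dots> \<le> 96 / w * (6 * w + 10 * w) * (10 * w)"
  proof (intro mult_mono mult_left_mono add_mono Q)
    have "real (((T + 1) div Q) * Q) \<le> real (T + 1)"
      by (simp only: of_nat_le_iff div_times_less_eq_dividend)
    also have "\<dots> \<le> 6 * w" using T w by simp
    finally show "real (((T + 1) div Q) * Q) \<le> 6 * w" .
  qed (use w in auto)
  also have "\<dots> = 15360 * w" using w by simp
  finally show ?thesis .
qed

lemma sum_corr_bound_multiples_of_denominator_le:
  fixes a :: int
  assumes "w > 0" "Q > 0" "real T \<le> 4 * w" and \<eta>: "0 < \<eta>" "\<eta> < 1"
    and \<beta>: "\<And>t. t \<le> T \<Longrightarrow> \<bar>real t * (x - of_int a / real Q)\<bar> \<le> 1 / (2 * real Q)"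
  shows "(\<Sum>t\<in>{t\<in>{1..T}. Q dvd t}. corr_bound w (real t * x))
    \<le> 48 / (1 - \<eta>) * major_arc \<eta> w (real Q) (x - of_int a / real Q)"
proof -
  define \<beta> where "\<beta> = x - of_int a / real Q"
  have "(\<Sum>t\<in>{t\<in>{1..T}. Q dvd t}. corr_bound w (real t * x))
      = (\<Sum>k=1..T div Q. corr_bound w (real (k * Q) * x))"
  proof (rule sum.reindex_bij_witness[of _ "\<lambda>k. k * Q" "\<lambda>t. t div Q"])
    fix k assume "k \<in> {1..T div Q}"
    then show "k * Q \<in> {t\<in>{1..T}. Q dvd t}" "k * Q div Q = k"
      using \<open>Q > 0\<close> by (auto simp: less_eq_div_iff_mult_less_eq)
  qed (use \<open>Q > 0\<close> in \<open>auto simp: div_le_mono dvd_imp_le div_greater_zero_iff Suc_le_eq\<close>)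
  also have "\<dots> = (\<Sum>k=1..T div Q. corr_bound w (real k * real Q * \<beta>))"
  proof (rule sum.cong[OF refl])
    fix k
    have "real (k * Q) * x = of_int (int k * a) + real k * real Q * \<beta>"
      using \<open>Q > 0\<close> by (simp add: \<beta>_def field_simps)
    then show "corr_bound w (real (k * Q) * x) = corr_bound w (real k * real Q * \<beta>)"
      by (simp only: corr_bound_def int_dist_add_of_int)
  qed
  also have "\<dots> \<le> 48 / (1 - \<eta>) * major_arc \<eta> w (real Q) \<beta>"
  proof (rule sum_corr_bound_multiples_le[OF _ _ _ \<eta>])
    have "real (T div Q) \<le> real T / real Q" by (rule of_nat_div_le_of_nat)
    also have "\<dots> \<le> 4 * w / real Q" using assms by (intro divide_right_mono) auto
    finally show "real (T div Q) \<le> 4 * w / real Q" .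
    fix k assume "k \<in> {1..T div Q}"
    then have "k * Q \<le> T" using \<open>Q > 0\<close> by (auto simp: less_eq_div_iff_mult_less_eq)
    from \<beta>[OF this] have "\<bar>real k * real Q * \<beta>\<bar> \<le> 1 / (2 * real Q)" by (simp add: \<beta>_def)
    also have "\<dots> \<le> 1/2" using \<open>Q > 0\<close> by simp
    finally show "\<bar>real k * real Q * \<beta>\<bar> \<le> 1/2" .
  qed (use assms in auto)
  finally show ?thesis by (simp add: \<beta>_def)
qed

lemma norm_tent_sum_sq_le_major_arc:
  fixes a :: int
  assumes w: "w \<ge> 1/2" "2 * w \<le> real M" and \<eta>: "0 < \<eta>" "\<eta> < 1"
    and Q: "Q > 0" "real Q \<le> 10 * w" "coprime a (int Q)"
    and x: "\<bar>x - of_int a / real Q\<bar> \<le> 1 / (8 * w * real Q)"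
  shows "(cmod (tent_sum w M D x))\<^sup>2
      \<le> 40000 / (1 - \<eta>) * (w + major_arc \<eta> w (real Q) (x - of_int a / real Q))"
proof -
  define T where "T = nat \<lfloor>4 * w\<rfloor>"
  define Z where "Z = major_arc \<eta> w (real Q) (x - of_int a / real Q)"
  have Z: "Z \<ge> 0" by (simp add: Z_def major_arc_nonneg)
  have T: "real T \<le> 4 * w" using w by (simp add: T_def)
  have small: "\<bar>real t * (x - of_int a / real Q)\<bar> \<le> 1 / (2 * real Q)" if "t \<le> T" for t
  proof -
    have "\<bar>real t * (x - of_int a / real Q)\<bar> \<le> 4 * w * (1 / (8 * w * real Q))"
      unfolding abs_mult using that T x w by (intro mult_mono) auto
    then show ?thesis using w by simp
  qed
  have "(\<Sum>t\<in>{1..T}. corr_bound w (real t * x))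
      = (\<Sum>t\<in>{t\<in>{1..T}. Q dvd t}. corr_bound w (real t * x))
        + (\<Sum>t\<in>{t\<in>{1..T}. \<not> Q dvd t}. corr_bound w (real t * x))"
    by (subst sum.union_disjoint[symmetric]) (auto intro!: sum.cong)
  also have "\<dots> \<le> 48 / (1 - \<eta>) * Z + 15360 * w"
    unfolding Z_def using w Q \<eta> T small
    by (intro add_mono sum_corr_bound_multiples_of_denominator_le sum_corr_bound_nonmultiples_le)
      auto
  finally have "(cmod (tent_sum w M D x))\<^sup>2 \<le> 4 * w + 2 * (48 / (1 - \<eta>) * Z + 15360 * w)"
    using norm_tent_sum_sq_le[OF w, of D x] by (simp add: T_def)
  also have "\<dots> = 30724 * w + 96 / (1 - \<eta>) * Z" by simp
  also have "\<dots> \<le> 40000 / (1 - \<eta>) * w + 40000 / (1 - \<eta>) * Z"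
    using \<eta> Z w by (intro add_mono mult_right_mono) (auto simp: field_simps)
  finally show ?thesis by (simp add: Z_def distrib_left)
qed

section \<open>Integration over the major arcs\<close>

lemma Dirichlet_approx_unit_interval:
  fixes x :: real
  assumes "N > 0" "x \<in> {0..1}"
  obtains a Q :: nat where "coprime a Q" "Q \<in> {1..N}" "a \<in> {0..Q}"
    "\<bar>x - real a / real Q\<bar> \<le> 1 / (real N * real Q)"
proof -
  obtain h q where hq: "coprime h q" "0 < q" "q \<le> int N" "\<bar>of_int q * x - of_int h\<bar> < 1 / real N"
    using Dirichlet_approx_coprime[OF \<open>N > 0\<close>] by metis
  have "1 / real N \<le> 1" using \<open>N > 0\<close> by simp
  then have "\<bar>of_int q * x - of_int h\<bar> < 1" using hq(4) by linarith
  moreover have "0 \<le> of_int q * x" "of_int q * x \<le> of_int q"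
    using assms(2) hq(2) by (auto intro: mult_left_le)
  ultimately have "real_of_int h > -1" "real_of_int h < of_int q + 1" by linarith+
  then have h: "0 \<le> h" "h \<le> q" by linarith+
  have "x - of_int h / of_int q = (of_int q * x - of_int h) / of_int q"
    using hq(2) by (simp add: field_simps)
  then have "\<bar>x - of_int h / of_int q\<bar> = \<bar>of_int q * x - of_int h\<bar> / of_int q"
    using hq(2) by (simp add: abs_divide)
  also have "\<dots> \<le> (1 / real N) / of_int q"
    using hq by (intro divide_right_mono) auto
  finally have approx: "\<bar>x - of_int h / of_int q\<bar> \<le> 1 / (real N * of_int q)" by simp
  show thesis
  proof (rule that[of "nat h" "nat q"])
    show "coprime (nat h) (nat q)"
      using hq h by (simp add: coprime_int_iff[symmetric])
  qed (use hq h approx in auto)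
qed

lemma powr_add_le:
  fixes u v r :: real
  assumes "u \<ge> 0" "v \<ge> 0" "r \<ge> 0"
  shows "(u + v) powr r \<le> 2 powr r * (u powr r + v powr r)"
proof -
  have "(u + v) powr r \<le> (2 * max u v) powr r" using assms by (intro powr_mono2) auto
  also have "\<dots> = 2 powr r * max u v powr r" by (rule powr_mult)
  also have "\<dots> \<le> 2 powr r * (u powr r + v powr r)"
    by (intro mult_left_mono) (auto simp: max_def)
  finally show ?thesis .
qed

lemma norm_tent_sum_powr_le_major_arcs:
  assumes w: "w \<ge> 1/2" "2 * w \<le> real M" and \<eta>: "0 < \<eta>" "\<eta> < 1" and "x \<in> {0..1}" "r \<ge> 0"
  shows "cmod (tent_sum w M D x) powr (2 * r) \<le> (80000 / (1 - \<eta>)) powr r *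
      (w powr r + (\<Sum>Q\<in>{1..nat \<lceil>8 * w\<rceil>}. \<Sum>a\<in>{0..Q}. major_arc \<eta> w (real Q) (x - real a / real Q)
        powr r))"
proof -
  define N where "N = nat \<lceil>8 * w\<rceil>"
  have N: "N > 0" "8 * w \<le> real N" "real N \<le> 10 * w" using w unfolding N_def by linarith+
  obtain a Q :: nat where aQ: "coprime a Q" "Q \<in> {1..N}" "a \<in> {0..Q}"
    and approx: "\<bar>x - real a / real Q\<bar> \<le> 1 / (real N * real Q)"
    using Dirichlet_approx_unit_interval[OF N(1) \<open>x \<in> {0..1}\<close>] by metis
  have "1 / (real N * real Q) \<le> 1 / (8 * w * real Q)"
    using N aQ w by (intro divide_left_mono mult_right_mono) auto
  with approx have near: "\<bar>x - of_int (int a) / real Q\<bar> \<le> 1 / (8 * w * real Q)" by simp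
  define Z where "Z Q a = major_arc \<eta> w (real Q) (x - real a / real Q)" for Q a :: nat
  define K where "K = 40000 / (1 - \<eta>)"
  have K: "K \<ge> 0" using \<eta> by (simp add: K_def)
  have "cmod (tent_sum w M D x) powr (2 * r) = ((cmod (tent_sum w M D x))\<^sup>2) powr r"
    by (simp add: powr_powr[symmetric])
  also have "\<dots> \<le> (K * (w + Z Q a)) powr r"
    using norm_tent_sum_sq_le_major_arc[OF w \<eta> _ _ _ near, of D] aQ N \<open>r \<ge> 0\<close>
    by (intro powr_mono2) (auto simp: Z_def K_def)
  also have "\<dots> = K powr r * (w + Z Q a) powr r"
    by (rule powr_mult)
  also have "\<dots> \<le> K powr r * (2 powr r * (w powr r + Z Q a powr r))"
    using w \<open>r \<ge> 0\<close> by (intro mult_left_mono powr_add_le) (auto simp: Z_def major_arc_nonneg)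
  also have "\<dots> = (K * 2) powr r * (w powr r + Z Q a powr r)"
    unfolding powr_mult by simp
  also have "\<dots> \<le> (K * 2) powr r * (w powr r + (\<Sum>Q\<in>{1..N}. \<Sum>a\<in>{0..Q}. Z Q a powr r))"
  proof (intro mult_left_mono add_left_mono)
    have "Z Q a powr r \<le> (\<Sum>a\<in>{0..Q}. Z Q a powr r)"
      using aQ by (intro member_le_sum) auto
    also have "\<dots> \<le> (\<Sum>Q\<in>{1..N}. \<Sum>a\<in>{0..Q}. Z Q a powr r)"
      using aQ by (intro member_le_sum[of Q _ "\<lambda>Q. \<Sum>a\<in>{0..Q}. Z Q a powr r"])
        (auto intro!: sum_nonneg)
    finally show "Z Q a powr r \<le> (\<Sum>Q\<in>{1..N}. \<Sum>a\<in>{0..Q}. Z Q a powr r)" .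
  qed simp
  finally show ?thesis by (simp add: Z_def N_def K_def)
qed

lemma nn_integral_powr_decay_atLeast:
  fixes \<rho> A :: real
  assumes "\<rho> > 1" "A > 0"
  shows "(\<integral>\<^sup>+ x. ennreal ((1 + A * x) powr (- \<rho>)) * indicator {0..} x \<partial>lborel)
      = ennreal (1 / (A * (\<rho> - 1)))"
proof -
  define F where "F x = - ((1 + A * x) powr (1 - \<rho>)) / (A * (\<rho> - 1))" for x :: real
  have "(\<integral>\<^sup>+ x. ennreal ((1 + A * x) powr (- \<rho>)) * indicator {0..} x \<partial>lborel) = 0 - F 0"
  proof (rule nn_integral_FTC_atLeast)
    fix x :: real assume "0 \<le> x"
    then have "1 + A * x > 0" using assms by (simp add: add_pos_nonneg)
    then have "((\<lambda>x. (1 + A * x) powr (1 - \<rho>)) has_real_derivative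
        (1 - \<rho>) * (1 + A * x) powr (1 - \<rho> - of_nat 1) * A) (at x)"
      by (intro DERIV_fun_powr) (auto intro!: derivative_eq_intros)
    then have "(F has_real_derivative
        - ((1 - \<rho>) * (1 + A * x) powr (1 - \<rho> - of_nat 1) * A) / (A * (\<rho> - 1))) (at x)"
      unfolding F_def by (intro DERIV_cdivide DERIV_minus)
    also have "- ((1 - \<rho>) * (1 + A * x) powr (1 - \<rho> - of_nat 1) * A) / (A * (\<rho> - 1))
        = (1 + A * x) powr - \<rho>"
      using assms by (simp add: divide_simps) (simp add: algebra_simps)
    finally show "DERIV F x :> (1 + A * x) powr - \<rho>" .
  next
    have "((\<lambda>x. (1 + A * x) powr (1 - \<rho>)) \<longlongrightarrow> 0) at_top"
      using assms
      by (intro tendsto_neg_powr filterlim_tendsto_add_at_top[OF tendsto_const]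
            filterlim_tendsto_pos_mult_at_top[OF tendsto_const] filterlim_ident) auto
    then have "(F \<longlongrightarrow> - 0 / (A * (\<rho> - 1))) at_top"
      unfolding F_def using assms by (intro tendsto_intros) auto
    then show "(F \<longlongrightarrow> 0) at_top" by simp
  qed simp_all
  then show ?thesis by (simp add: F_def)
qed

lemma nn_integral_powr_decay_le:
  fixes \<rho> A c :: real
  assumes "\<rho> > 1" "A > 0"
  shows "(\<integral>\<^sup>+ x. ennreal ((1 + A * \<bar>x - c\<bar>) powr (- \<rho>)) \<partial>lborel) \<le> ennreal (2 / (A * (\<rho> - 1)))"
proof -
  define g where "g x = ennreal ((1 + A * \<bar>x\<bar>) powr (- \<rho>))" for x :: real
  have [measurable]: "g \<in> borel_measurable borel" unfolding g_def by measurable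
  have right: "(\<integral>\<^sup>+ x. g x * indicator {0..} x \<partial>lborel) = ennreal (1 / (A * (\<rho> - 1)))"
    unfolding nn_integral_powr_decay_atLeast[OF assms, symmetric]
    by (intro nn_integral_cong) (auto simp: g_def indicator_def)
  have left: "(\<integral>\<^sup>+ x. g x * indicator {..0} x \<partial>lborel) = (\<integral>\<^sup>+ x. g x * indicator {0..} x \<partial>lborel)"
    by (subst nn_integral_real_affine[where c = "-1" and t = 0])
      (auto simp: g_def indicator_def intro!: nn_integral_cong)
  have "(\<integral>\<^sup>+ x. ennreal ((1 + A * \<bar>x - c\<bar>) powr (- \<rho>)) \<partial>lborel) = (\<integral>\<^sup>+ x. g x \<partial>lborel)"
    by (subst nn_integral_real_affine[where c = 1 and t = c]) (auto simp: g_def[abs_def])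
  also have "\<dots> \<le> (\<integral>\<^sup>+ x. g x * indicator {0..} x + g x * indicator {..0} x \<partial>lborel)"
    by (intro nn_integral_mono) (auto simp: indicator_def)
  also have "\<dots>
      = (\<integral>\<^sup>+ x. g x * indicator {0..} x \<partial>lborel) + (\<integral>\<^sup>+ x. g x * indicator {..0} x \<partial>lborel)"
    by (rule nn_integral_add) auto
  also have "\<dots> = ennreal (2 / (A * (\<rho> - 1)))"
    unfolding left right using assms by (simp flip: ennreal_plus)
  finally show ?thesis .
qed

lemma nn_integral_major_arc_powr_le:
  assumes "w > 0" "q > 0" "\<eta> * r > 1"
  shows "(\<integral>\<^sup>+ x. ennreal (major_arc \<eta> w q (x - c) powr r) \<partial>lborel)
    \<le> ennreal (2 / (\<eta> * r - 1) * w powr (2 * r - 2) * q powr (- r))"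
proof -
  have "major_arc \<eta> w q (x - c) powr r = (w\<^sup>2 / q) powr r * (1 + w\<^sup>2 * \<bar>x - c\<bar>) powr (- (\<eta> * r))"
    for x
    unfolding major_arc_def by (subst powr_mult) (simp add: powr_powr)
  then have "(\<integral>\<^sup>+ x. ennreal (major_arc \<eta> w q (x - c) powr r) \<partial>lborel)
      = ennreal ((w\<^sup>2 / q) powr r) *
          (\<integral>\<^sup>+ x. ennreal ((1 + w\<^sup>2 * \<bar>x - c\<bar>) powr (- (\<eta> * r))) \<partial>lborel)"
    by (simp add: ennreal_mult nn_integral_cmult)
  also have "\<dots> \<le> ennreal ((w\<^sup>2 / q) powr r) * ennreal (2 / (w\<^sup>2 * (\<eta> * r - 1)))"
    using assms by (intro mult_left_mono nn_integral_powr_decay_le) auto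
  also have "\<dots> = ennreal ((w\<^sup>2 / q) powr r * (2 / (w\<^sup>2 * (\<eta> * r - 1))))"
    using assms by (intro ennreal_mult[symmetric]) auto
  also have "(w\<^sup>2 / q) powr r = w powr (2 * r) * q powr (- r)"
    using assms by (simp add: powr_divide powr_minus_divide powr_powr flip: powr_numeral)
  also have "w powr (2 * r) * q powr (- r) * (2 / (w\<^sup>2 * (\<eta> * r - 1)))
      = 2 / (\<eta> * r - 1) * (w powr (2 * r) / w\<^sup>2) * q powr (- r)"
    by (simp add: mult_ac)
  also have "w powr (2 * r) / w\<^sup>2 = w powr (2 * r - 2)"
    using assms by (simp add: powr_diff)
  finally show ?thesis .
qed

definition arc_sum :: "real \<Rightarrow> real \<Rightarrow> real" where
  "arc_sum p w = (\<Sum>Q\<in>{1..nat \<lceil>8 * w\<rceil>}. real Q powr (1 - p/2))"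

lemma nn_integral_major_arcs_le:
  fixes p :: real
  assumes "w > 0" "\<eta> * (p/2) > 1"
  shows "(\<Sum>Q\<in>{1..nat \<lceil>8 * w\<rceil>}. \<Sum>a\<in>{0..Q}.
      \<integral>\<^sup>+ x. ennreal (major_arc \<eta> w (real Q) (x - real a / real Q) powr (p/2)) \<partial>lborel)
    \<le> ennreal (4 / (\<eta> * (p/2) - 1) * w powr (p - 2) * arc_sum p w)"
proof -
  define c where "c = 2 / (\<eta> * (p/2) - 1) * w powr (p - 2)"
  have c: "c \<ge> 0" using assms by (simp add: c_def)
  have "(\<Sum>Q\<in>{1..nat \<lceil>8 * w\<rceil>}. \<Sum>a\<in>{0..Q}.
      \<integral>\<^sup>+ x. ennreal (major_arc \<eta> w (real Q) (x - real a / real Q) powr (p/2)) \<partial>lborel)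
    \<le> (\<Sum>Q\<in>{1..nat \<lceil>8 * w\<rceil>}. ennreal (2 * c * real Q powr (1 - p/2)))"
  proof (rule sum_mono)
    fix Q assume Q: "Q \<in> {1..nat \<lceil>8 * w\<rceil>}"
    have "(\<Sum>a\<in>{0..Q}. \<integral>\<^sup>+ x. ennreal (major_arc \<eta> w (real Q)
        (x - real a / real Q) powr (p/2)) \<partial>lborel)
        \<le> (\<Sum>a\<in>{0..Q}. ennreal (c * real Q powr (- (p/2))))"
      using nn_integral_major_arc_powr_le[OF assms(1) _ assms(2), of "real Q"] Q
      by (intro sum_mono) (simp add: c_def)
    also have "\<dots> = ennreal (real (Q + 1) * (c * real Q powr (- (p/2))))"
      using c by (simp add: ennreal_mult ennreal_of_nat_eq_real_of_nat)
    also have "\<dots> \<le> ennreal (2 * c * real Q powr (1 - p/2))"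
    proof (rule ennreal_leI)
      have "real (Q + 1) * (c * real Q powr (- (p/2))) \<le> (2 * real Q) * (c * real Q powr (- (p/2)))"
        using Q c by (intro mult_right_mono) auto
      also have "\<dots> = 2 * c * (real Q * real Q powr (- (p/2)))" by simp
      also have "real Q * real Q powr (- (p/2)) = real Q powr (1 - p/2)"
        using Q by (simp add: powr_diff powr_minus_divide)
      finally show "real (Q + 1) * (c * real Q powr (- (p/2))) \<le> 2 * c * real Q powr (1 - p/2)" .
    qed
    finally show
      "(\<Sum>a\<in>{0..Q}. \<integral>\<^sup>+ x. ennreal (major_arc \<eta> w (real Q) (x - real a / real Q) powr (p/2)) \<partial>lborel)
        \<le> ennreal (2 * c * real Q powr (1 - p/2))" .
  qed
  also have "\<dots> = ennreal (2 * c * arc_sum p w)"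
    using c by (simp add: sum_ennreal arc_sum_def sum_distrib_left)
  also have "2 * c * arc_sum p w = 4 / (\<eta> * (p/2) - 1) * w powr (p - 2) * arc_sum p w"
    by (simp add: c_def)
  finally show ?thesis .
qed

lemma Lp_pow_tent_sum_le:
  assumes w: "w \<ge> 1/2" "2 * w \<le> real M" and \<eta>: "0 < \<eta>" "\<eta> < 1" "\<eta> * (p/2) > 1"
  shows "Lp_pow p (tent_sum w M D) \<le> ennreal ((80000 / (1 - \<eta>)) powr (p/2) *
      (w powr (p/2) + 4 / (\<eta> * (p/2) - 1) * w powr (p - 2) * arc_sum p w))"
proof -
  define C where "C = (80000 / (1 - \<eta>)) powr (p/2)"
  define Z where "Z Q a x = major_arc \<eta> w (real Q) (x - real a / real Q) powr (p/2)" for Q a :: nat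
    and x
  have C: "C \<ge> 0" and Z: "Z Q a x \<ge> 0" for Q a x by (simp_all add: C_def Z_def)
  have p: "p \<ge> 0" using \<eta> by (smt (verit) mult_nonneg_nonpos divide_nonpos_pos)
  have [measurable]: "Z Q a \<in> borel_measurable borel" for Q a
    unfolding Z_def major_arc_def by measurable
  let ?N = "nat \<lceil>8 * w\<rceil>"
  have "Lp_pow p (tent_sum w M D) \<le> (\<integral>\<^sup>+ x. ennreal C * (ennreal (w powr (p/2)) * indicator {0..1} x
      + (\<Sum>Q\<in>{1..?N}. \<Sum>a\<in>{0..Q}. ennreal (Z Q a x))) \<partial>lborel)"
    unfolding Lp_pow_def
  proof (rule nn_integral_mono)
    fix x :: real
    have "ennreal (cmod (tent_sum w M D x) powr p)
        \<le> ennreal (C * (w powr (p/2) + (\<Sum>Q\<in>{1..?N}. \<Sum>a\<in>{0..Q}. Z Q a x)))" if "x \<in> {0..1}"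
      using norm_tent_sum_powr_le_major_arcs[OF w \<eta>(1,2) that, of "p/2" D] p
      by (intro ennreal_leI) (simp add: C_def Z_def)
    then show "ennreal (cmod (tent_sum w M D x) powr p) * indicator {0..1} x \<le> ennreal C *
        (ennreal (w powr (p/2)) * indicator {0..1} x + (\<Sum>Q\<in>{1..?N}. \<Sum>a\<in>{0..Q}. ennreal (Z Q a x)))"
      using C Z by (auto simp: indicator_def ennreal_mult sum_nonneg sum_ennreal)
  qed
  also have "\<dots> = ennreal C * (ennreal (w powr (p/2))
      + (\<Sum>Q\<in>{1..?N}. \<Sum>a\<in>{0..Q}. \<integral>\<^sup>+ x. ennreal (Z Q a x) \<partial>lborel))"
    by (simp add: nn_integral_cmult nn_integral_add nn_integral_sum)
  also have "\<dots> \<le> ennreal C * (ennreal (w powr (p/2))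
      + ennreal (4 / (\<eta> * (p/2) - 1) * w powr (p - 2) * arc_sum p w))"
    unfolding Z_def using w \<eta> by (intro mult_left_mono add_left_mono nn_integral_major_arcs_le) auto
  also have "\<dots> = ennreal (C * (w powr (p/2) + 4 / (\<eta> * (p/2) - 1) * w powr (p - 2) * arc_sum p w))"
    using C \<eta> by (simp add: ennreal_mult arc_sum_def sum_nonneg)
  finally show ?thesis by (simp add: C_def)
qed

text \<open>The summand \<open>2\<close> keeps the factor positive down to \<open>K = 1/2\<close>, the smallest tent used.\<close>

definition growth :: "real \<Rightarrow> real \<Rightarrow> real" where
  "growth p K = (if p < 4 then 1 else if p = 4 then 2 + ln K else K powr (p/2 - 2))"

lemma growth_mono: "0 < x \<Longrightarrow> x \<le> y \<Longrightarrow> growth p x \<le> growth p y"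
  by (auto simp: growth_def intro!: powr_mono2)

lemma ln_gt_minus_1:
  assumes "(K::real) \<ge> 1/2"
  shows "ln K > - 1"
proof -
  have "ln (1/2) \<le> ln K" using assms by (intro ln_mono) auto
  then show ?thesis using ln_2_less_1 by (simp add: ln_div)
qed

lemma growth_pos: "K \<ge> 1/2 \<Longrightarrow> growth p K > 0"
  using ln_gt_minus_1[of K] by (auto simp: growth_def)

lemma arc_sum_le_lt_4:
  assumes "2 < p" "p < 4" "w \<ge> 1/2"
  shows "arc_sum p w \<le> 10 powr (2 - p/2) / (2 - p/2) * w powr (2 - p/2)"
proof -
  have "arc_sum p w \<le> real (nat \<lceil>8 * w\<rceil>) powr (2 - p/2) / (2 - p/2)"
    using sum_powr_le[of "p/2 - 1" "nat \<lceil>8 * w\<rceil>"] assms by (simp add: arc_sum_def)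
  also have "\<dots> \<le> (10 * w) powr (2 - p/2) / (2 - p/2)"
  proof (intro divide_right_mono powr_mono2)
    show "real (nat \<lceil>8 * w\<rceil>) \<le> 10 * w" using assms by linarith
  qed (use assms in auto)
  finally show ?thesis by (simp add: powr_mult)
qed

lemma arc_sum_le_4:
  assumes "w \<ge> 1/2"
  shows "arc_sum 4 w \<le> 10 * (2 + ln w)"
proof -
  define n where "n = nat \<lceil>8 * w\<rceil>"
  have n: "1 \<le> n" "real n \<le> 10 * w" using assms unfolding n_def by linarith+
  then obtain m where m: "n = Suc m" by (cases n) auto
  have "arc_sum 4 w = harm n"
    by (simp add: arc_sum_def n_def harm_def powr_minus)
  also have "harm n - ln (real n) \<le> harm (Suc 0) - ln (real (Suc 0))"
    unfolding m by (rule decseqD[OF decseq_harm_diff_ln]) simp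
  then have "harm n \<le> 1 + ln (real n)" by (simp add: harm_def)
  also have "ln (real n) \<le> ln (10 * w)" using n by (intro ln_mono) auto
  also have "ln (10 * w) = ln 10 + ln w" using assms by (simp add: ln_mult)
  also have "ln 10 \<le> (9 :: real)" using ln_le_minus_one[of "10 :: real"] by simp
  also have "1 + (9 + ln w) \<le> 10 * (2 + ln w)"
    using ln_gt_minus_1[OF assms] by simp
  finally show ?thesis by simp
qed

lemma arc_sum_le_gt_4:
  assumes "p > 4"
  shows "arc_sum p w \<le> (\<Sum>n. real n powr (1 - p/2))"
  unfolding arc_sum_def
  by (intro sum_le_suminf) (use assms in \<open>auto simp: summable_real_powr_iff\<close>)

lemma arc_sum_le:
  assumes "p > 2"
  obtains B where "B > 0" "\<And>w. w \<ge> 1/2 \<Longrightarrow> arc_sum p w \<le> B * (w powr (2 - p/2) * growth p w)"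
proof -
  consider "p < 4" | "p = 4" | "p > 4" by linarith
  then show thesis
  proof cases
    case 1
    then show thesis
      using arc_sum_le_lt_4[OF assms]
      by (intro that[of "10 powr (2 - p/2) / (2 - p/2)"]) (auto simp: growth_def)
  next
    case 2
    then show thesis
      using arc_sum_le_4 by (intro that[of 10]) (auto simp: growth_def)
  next
    case 3
    define B where "B = (\<Sum>n. real n powr (1 - p/2)) + 1"
    have "(\<Sum>n. real n powr (1 - p/2)) \<ge> 0"
      using 3 by (intro suminf_nonneg) (auto simp: summable_real_powr_iff)
    then have B: "B > 0" by (simp add: B_def)
    have "arc_sum p w \<le> B * (w powr (2 - p/2) * growth p w)" if "w \<ge> 1/2" for w
    proof -
      have "w powr (2 - p/2) * growth p w = 1"
        using 3 that by (simp add: growth_def flip: powr_add)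
      then show ?thesis using arc_sum_le_gt_4[OF 3, of w] by (simp add: B_def)
    qed
    with B show thesis by (rule that)
  qed
qed

definition gauss_rate :: "real \<Rightarrow> real \<Rightarrow> real" where
  "gauss_rate p K = sqrt K * growth p K powr (1 / p)"

lemma gauss_rate_nonneg: "K \<ge> 0 \<Longrightarrow> gauss_rate p K \<ge> 0"
  by (simp add: gauss_rate_def)

lemma gauss_rate_mono: "1/2 \<le> x \<Longrightarrow> x \<le> y \<Longrightarrow> p > 0 \<Longrightarrow> gauss_rate p x \<le> gauss_rate p y"
  unfolding gauss_rate_def
  by (intro mult_mono powr_mono2 growth_mono) (auto simp: less_imp_le growth_pos)

lemma gauss_rate_powr:
  assumes "K \<ge> 1/2" "p > 0"
  shows "gauss_rate p K powr p = K powr (p/2) * growth p K"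
proof -
  have "gauss_rate p K powr p = (K powr (1/2)) powr p * (growth p K powr (1/p)) powr p"
    using assms by (simp add: gauss_rate_def powr_mult powr_half_sqrt)
  also have "\<dots> = K powr (p/2) * growth p K"
    using assms growth_pos[of K p] by (simp add: powr_powr)
  finally show ?thesis .
qed

lemma major_arcs_le_growth:
  assumes "p > 2" "c > 0"
  obtains E where "E > 0"
    "\<And>w. w \<ge> 1/2 \<Longrightarrow>
        w powr (p/2) + c * w powr (p - 2) * arc_sum p w \<le> E * (w powr (p/2) * growth p w)"
proof -
  obtain B where B: "B > 0" "\<And>w. w \<ge> 1/2 \<Longrightarrow> arc_sum p w \<le> B * (w powr (2 - p/2) * growth p w)"
    using arc_sum_le[OF \<open>p > 2\<close>] by blast
  define b where "b = 1 / growth p (1/2)"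
  have b: "b > 0" using growth_pos[of "1/2" p] by (simp add: b_def)
  show thesis
  proof (rule that[of "b + c * B"])
    fix w :: real assume w: "w \<ge> 1/2"
    have "1 \<le> b * growth p w"
      using growth_mono[of "1/2" w p] growth_pos[of "1/2" p] w by (simp add: b_def)
    then have "w powr (p/2) * 1 \<le> w powr (p/2) * (b * growth p w)"
      by (rule mult_left_mono) simp
    moreover have "c * w powr (p - 2) * arc_sum p w \<le> c * B * (w powr (p/2) * growth p w)"
    proof -
      have "c * w powr (p - 2) * arc_sum p w
          \<le> c * w powr (p - 2) * (B * (w powr (2 - p/2) * growth p w))"
        using B w \<open>c > 0\<close> by (intro mult_left_mono) auto
      also have "\<dots> = c * B * (w powr (p - 2) * w powr (2 - p/2) * growth p w)" by simp
      also have "w powr (p - 2) * w powr (2 - p/2) = w powr (p/2)" by (simp flip: powr_add)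
      finally show ?thesis .
    qed
    ultimately show
      "w powr (p/2) + c * w powr (p - 2) * arc_sum p w \<le> (b + c * B) * (w powr (p/2) * growth p w)"
      by (simp add: algebra_simps)
  qed (use B b \<open>c > 0\<close> in \<open>simp add: add_pos_pos\<close>)
qed

lemma Lp_bound_tent_sum:
  assumes p: "p > 2"
  obtains C where "C > 0"
    "\<And>w M D. w \<ge> 1/2 \<Longrightarrow> 2 * w \<le> real M \<Longrightarrow> Lp_bound p (tent_sum w M D) (C * gauss_rate p w)"
proof -
  define \<eta> where "\<eta> = (1 + 2 / p) / 2"
  define c where "c = 4 / (\<eta> * (p/2) - 1)"
  define A where "A = (80000 / (1 - \<eta>)) powr (p/2)"
  have \<eta>: "0 < \<eta>" "\<eta> < 1" "\<eta> * (p/2) > 1" using p by (auto simp: \<eta>_def field_simps)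
  have c: "c > 0" and A: "A > 0" using \<eta> by (simp_all add: c_def A_def)
  obtain E where E: "E > 0"
    "\<And>w. w \<ge> 1/2 \<Longrightarrow>
        w powr (p/2) + c * w powr (p - 2) * arc_sum p w \<le> E * (w powr (p/2) * growth p w)"
    using major_arcs_le_growth[OF p c] by blast
  show thesis
  proof (rule that[of "(A * E) powr (1/p)"])
    fix w D :: real and M :: nat assume w: "w \<ge> 1/2" "2 * w \<le> real M"
    have "Lp_pow p (tent_sum w M D)
        \<le> ennreal (A * (w powr (p/2) + c * w powr (p - 2) * arc_sum p w))"
      using Lp_pow_tent_sum_le[OF w \<eta>] by (simp add: A_def c_def)
    also have "\<dots> \<le> ennreal (A * (E * (w powr (p/2) * growth p w)))"
      using A w by (intro ennreal_leI mult_left_mono E) auto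
    also have "A * (E * (w powr (p/2) * growth p w)) = ((A * E) powr (1/p) * gauss_rate p w) powr p"
      using w p A E by (simp add: powr_mult gauss_rate_powr powr_powr)
    finally show "Lp_bound p (tent_sum w M D) ((A * E) powr (1/p) * gauss_rate p w)"
      using w unfolding Lp_bound_def
      by (auto intro!: borel_measurable_continuous_onI continuous_on_tent_sum mult_nonneg_nonneg
          gauss_rate_nonneg)
  qed (use A E in simp)
qed

section \<open>Gauss sums over intervals\<close>

text \<open>The indicator of an interval is a superposition of tents whose widths decrease geometrically
  towards the two endpoints; this is what removes the logarithm that Weyl differencing loses on
  sharply cut sums.\<close>

lemma tent_eq_ramp_diff:
  assumes "w > 0" "t \<ge> 0"
  shows "tent w t / 2 = min 1 (t / w) - min 1 (t / (2 * w))"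
  using assms by (auto simp: tent_def min_def max_def abs_if field_simps)

lemma sum_halving_tents:
  assumes "K > 0" "K / 2 ^ J \<le> u"
  shows "(\<Sum>j<J. tent (K / 2 ^ Suc j) u / 2) = 1 - min 1 (u / K)"
proof -
  have "K / 2 ^ J > 0" using \<open>K > 0\<close> by simp
  then have "u \<ge> 0" using assms(2) by linarith
  have "tent (K / 2 ^ Suc j) u / 2 = min 1 (u / (K / 2 ^ Suc j)) - min 1 (u / (K / 2 ^ j))" for j
    using tent_eq_ramp_diff[of "K / 2 ^ Suc j" u] assms \<open>u \<ge> 0\<close> by simp
  then have "(\<Sum>j<J. tent (K / 2 ^ Suc j) u / 2) = min 1 (u / (K / 2 ^ J)) - min 1 (u / (K / 2 ^ 0))"
    by (simp only: sum_lessThan_telescope[of "\<lambda>j. min 1 (u / (K / 2 ^ j))"])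
  moreover have "1 \<le> u / (K / 2 ^ J)"
    using assms(2) \<open>K / 2 ^ J > 0\<close> by (subst le_divide_eq_1_pos) auto
  ultimately show ?thesis by simp
qed

lemma sum_tents_eq_1:
  assumes "K > 0" "K / 2 ^ J \<le> t" "K / 2 ^ J \<le> 2 * K - t"
  shows "tent K t + (\<Sum>j<J. tent (K / 2 ^ Suc j) t / 2 + tent (K / 2 ^ Suc j) (2 * K - t) / 2) = 1"
proof -
  have "K / 2 ^ J > 0" using \<open>K > 0\<close> by simp
  then have "0 \<le> t" "t \<le> 2 * K" using assms by linarith+
  then have "tent K t = min 1 (t / K) + min 1 ((2 * K - t) / K) - 1"
    using \<open>K > 0\<close> by (auto simp: tent_def min_def max_def abs_if field_simps)
  then show ?thesis
    using sum_halving_tents[OF assms(1,2)] sum_halving_tents[OF assms(1,3)]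
    by (simp add: sum.distrib)
qed

definition gauss_sum :: "real \<Rightarrow> nat \<Rightarrow> real \<Rightarrow> complex" where
  "gauss_sum D m x = (\<Sum>i<m. unit_exp ((D + real i)\<^sup>2 * x))"

lemma tent_sum_Suc:
  assumes "w > 0"
  shows "tent_sum w (Suc m) (D - 1) x
      = (\<Sum>i<m. of_real (tent w (real i + 1)) * unit_exp ((D + real i)\<^sup>2 * x))"
  using assms unfolding tent_sum_def
  by (subst sum.lessThan_Suc_shift) (simp add: tent_term_def tent_0 add.commute)

lemma tent_sum_reflect:
  assumes "w > 0"
  shows "tent_sum w (Suc m) (- (D + real m)) x
    = (\<Sum>i<m. of_real (tent w (real m - real i)) * unit_exp ((D + real i)\<^sup>2 * x))"
proof -
  have "tent_sum w (Suc m) (- (D + real m)) x = (\<Sum>l<m. tent_term w (- (D + real m)) x (Suc l))"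
    using assms unfolding tent_sum_def
    by (subst sum.lessThan_Suc_shift) (simp add: tent_term_def tent_0)
  also have "\<dots> = (\<Sum>i<m. of_real (tent w (real m - real i)) * unit_exp ((D + real i)\<^sup>2 * x))"
  proof (rule sum.reindex_bij_witness[of _ "\<lambda>i. m - Suc i" "\<lambda>l. m - Suc l"])
    fix l assume "l \<in> {..<m}"
    then have l: "real (m - Suc l) = real m - real (Suc l)" by (simp add: of_nat_diff)
    have "(- (D + real m) + real (Suc l))\<^sup>2 = (D + (real m - real (Suc l)))\<^sup>2"
      by (simp add: power2_eq_square algebra_simps)
    then show "of_real (tent w (real m - real (m - Suc l)))
        * unit_exp ((D + real (m - Suc l))\<^sup>2 * x)
        = tent_term w (- (D + real m)) x (Suc l)"
      unfolding l tent_term_def by simp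
  qed auto
  finally show ?thesis .
qed

lemma gauss_sum_eq_tent_sums:
  fixes m :: nat
  defines "K \<equiv> (real m + 1) / 2"
  assumes J: "K \<le> 2 ^ J"
  shows "gauss_sum D m x
      = tent_sum K (Suc m) (D - 1) x + (\<Sum>j<J. (1/2) * tent_sum (K / 2 ^ Suc j) (Suc m) (D - 1) x
      + (1/2) * tent_sum (K / 2 ^ Suc j) (Suc m) (- (D + real m)) x)"
proof -
  define E where "E i = unit_exp ((D + real i)\<^sup>2 * x)" for i :: nat
  define w where "w j = K / 2 ^ Suc j" for j :: nat
  define \<phi> where "\<phi> i j = tent (w j) (real i + 1) / 2 + tent (w j) (real m - real i) / 2"
    for i j :: nat
  have K: "K > 0" and w: "w j > 0" for j by (simp_all add: K_def w_def)
  have "tent K (real i + 1) + (\<Sum>j<J. \<phi> i j) = 1" if "i < m" for i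
  proof -
    have reflect: "2 * K - (real i + 1) = real m - real i" by (simp add: K_def add_divide_distrib)
    have "K / 2 ^ J \<le> 1" using J by simp
    then have "K / 2 ^ J \<le> real i + 1" "K / 2 ^ J \<le> 2 * K - (real i + 1)"
      unfolding reflect using that by linarith+
    from sum_tents_eq_1[OF K this] show ?thesis
      unfolding reflect \<phi>_def w_def .
  qed
  then have "E i = of_real (tent K (real i + 1) + (\<Sum>j<J. \<phi> i j)) * E i" if "i < m" for i
    using that by simp
  then have "gauss_sum D m x = (\<Sum>i<m. of_real (tent K (real i + 1) + (\<Sum>j<J. \<phi> i j)) * E i)"
    unfolding gauss_sum_def E_def[symmetric] by (intro sum.cong) auto
  also have "\<dots> = (\<Sum>i<m. of_real (tent K (real i + 1)) * E i) + (\<Sum>i<m. \<Sum>j<J. of_real (\<phi> i j) * E i)"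
    by (simp add: distrib_right sum_distrib_right sum.distrib)
  also have "(\<Sum>i<m. \<Sum>j<J. of_real (\<phi> i j) * E i) = (\<Sum>j<J. \<Sum>i<m. of_real (\<phi> i j) * E i)"
    by (rule sum.swap)
  also have "\<dots> = (\<Sum>j<J. (1/2) * (\<Sum>i<m. of_real (tent (w j) (real i + 1)) * E i)
      + (1/2) * (\<Sum>i<m. of_real (tent (w j) (real m - real i)) * E i))"
    by (simp add: \<phi>_def distrib_right sum.distrib sum_divide_distrib)
  finally show ?thesis
    using K w by (simp only: tent_sum_Suc tent_sum_reflect E_def w_def)
qed

lemma gauss_rate_halving:
  assumes "p > 0" "K / 2 ^ j \<ge> 1/2"
  shows "gauss_rate p (K / 2 ^ j) \<le> (1 / sqrt 2) ^ j * gauss_rate p K"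
proof -
  have pos: "0 < K / 2 ^ j" using assms(2) by linarith
  then have "K / 2 ^ j * 1 \<le> K / 2 ^ j * 2 ^ j" by (intro mult_left_mono) auto
  then have "growth p (K / 2 ^ j) powr (1/p) \<le> growth p K powr (1/p)"
    using assms pos by (intro powr_mono2 growth_mono less_imp_le[OF growth_pos]) auto
  moreover have "sqrt (K / 2 ^ j) = (1 / sqrt 2) ^ j * sqrt K"
    by (simp add: real_sqrt_divide real_sqrt_power power_divide)
  ultimately show ?thesis
    unfolding gauss_rate_def using pos by (simp add: mult.assoc mult_left_mono zero_less_divide_iff)
qed

lemma sum_power_Suc_le:
  fixes q :: real
  assumes "0 \<le> q" "q < 1"
  shows "(\<Sum>j<n. q ^ Suc j) \<le> 1 / (1 - q)"
proof -
  have "(\<Sum>j<n. q ^ Suc j) \<le> (\<Sum>j<n. q ^ j)"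
    using assms by (intro sum_mono) (simp add: mult_left_le_one_le)
  also have "\<dots> \<le> (\<Sum>j. q ^ j)"
    using assms by (intro sum_le_suminf summable_geometric) auto
  also have "\<dots> = 1 / (1 - q)" using assms by (simp add: suminf_geometric)
  finally show ?thesis .
qed

lemma ex_dyadic_scale:
  fixes K :: real
  assumes "K \<ge> 1/2"
  obtains J :: nat where "K \<le> 2 ^ J" "\<And>j. j \<le> J \<Longrightarrow> 1/2 \<le> K / 2 ^ j"
proof -
  define J where "J = (LEAST n. K \<le> 2 ^ n)"
  have "\<exists>n. K \<le> 2 ^ n" using real_arch_pow[of 2 K] by (auto intro: less_imp_le)
  then have "K \<le> 2 ^ J" unfolding J_def by (rule LeastI_ex)
  moreover have "1/2 \<le> K / 2 ^ j" if "j \<le> J" for j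
  proof (cases j)
    case (Suc i)
    then have "\<not> K \<le> 2 ^ i" using that not_less_Least[of i "\<lambda>n. K \<le> 2 ^ n"] by (simp add: J_def)
    then show ?thesis using Suc by (simp add: field_simps)
  qed (use assms in simp)
  ultimately show thesis by (rule that)
qed

lemma Lp_bound_gauss_sum_of_tent_sums:
  assumes p: "p \<ge> 1" and C: "C \<ge> 0"
    "\<And>w M D. w \<ge> 1/2 \<Longrightarrow> 2 * w \<le> real M \<Longrightarrow> Lp_bound p (tent_sum w M D) (C * gauss_rate p w)"
    and m: "m \<ge> 1"
  shows "Lp_bound p (gauss_sum D m) (C * (1 + 1 / (1 - 1 / sqrt 2)) * gauss_rate p (real m))"
proof -
  define q where "q = 1 / sqrt 2"
  have q: "0 \<le> q" "q < 1" by (auto simp: q_def)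
  define K where "K = (real m + 1) / 2"
  define w where "w j = K / 2 ^ Suc j" for j
  have K: "1/2 \<le> K" "K \<le> real m" "2 * K = real (Suc m)" using m by (auto simp: K_def)
  obtain J where J: "K \<le> 2 ^ J" "\<And>j. j \<le> J \<Longrightarrow> 1/2 \<le> K / 2 ^ j"
    using ex_dyadic_scale[OF K(1)] by blast
  have half_tent:
    "Lp_bound p (\<lambda>x. (1/2) * tent_sum (w j) (Suc m) D' x) (C * q ^ Suc j * gauss_rate p K / 2)"
    if "j < J" for j D'
  proof -
    have w: "1/2 \<le> w j" using J(2)[of "Suc j"] that by (simp add: w_def)
    then have "w j * 1 \<le> w j * 2 ^ Suc j" by (intro mult_left_mono one_le_power) auto
    then have "2 * w j \<le> real (Suc m)" unfolding K(3)[symmetric] by (simp add: w_def)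
    moreover have "gauss_rate p (w j) \<le> q ^ Suc j * gauss_rate p K"
      unfolding w_def q_def using p w by (intro gauss_rate_halving) (auto simp: w_def)
    then have "C * gauss_rate p (w j) \<le> C * q ^ Suc j * gauss_rate p K"
      using C(1) by (simp add: mult_left_mono mult.assoc)
    ultimately have "Lp_bound p (tent_sum (w j) (Suc m) D') (C * q ^ Suc j * gauss_rate p K)"
      using p w by (intro Lp_bound_mono[OF C(2)]) auto
    from Lp_bound_scale[OF this, of "1/2"] p show ?thesis by (simp add: norm_divide)
  qed
  have "Lp_bound p (gauss_sum D m) (C * gauss_rate p K
      + (\<Sum>j<J. C * q ^ Suc j * gauss_rate p K / 2 + C * q ^ Suc j * gauss_rate p K / 2))"
    unfolding gauss_sum_eq_tent_sums[OF J(1)[unfolded K_def], folded K_def, abs_def]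
        w_def[symmetric]
    using p K by (intro Lp_bound_add Lp_bound_sum half_tent C) auto
  moreover have
    "C * gauss_rate p K
        + (\<Sum>j<J. C * q ^ Suc j * gauss_rate p K / 2 + C * q ^ Suc j * gauss_rate p K / 2)
      = C * (1 + (\<Sum>j<J. q ^ Suc j)) * gauss_rate p K"
    by (simp add: sum_distrib_left sum_distrib_right algebra_simps)
  moreover have "\<dots> \<le> C * (1 + 1 / (1 - q)) * gauss_rate p (real m)"
    using C p K q
    by (intro mult_mono add_mono mult_left_mono sum_power_Suc_le gauss_rate_mono)
      (auto simp: gauss_rate_nonneg)
  ultimately show ?thesis using p by (simp add: q_def Lp_bound_mono)
qed

lemma Lp_bound_gauss_sum:
  assumes p: "p \<ge> 2"
  obtains C where "C > 0"
    "\<And>L m. m \<ge> 1 \<Longrightarrow> Lp_bound p (gauss_sum (real L) m) (C * gauss_rate p (real m))"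
proof (cases "p = 2")
  case False
  with p have "p > 2" by simp
  then obtain C where C: "C > 0"
    "\<And>w M D. w \<ge> 1/2 \<Longrightarrow> 2 * w \<le> real M \<Longrightarrow> Lp_bound p (tent_sum w M D) (C * gauss_rate p w)"
    using Lp_bound_tent_sum by blast
  show thesis
  proof (rule that)
    show "C * (1 + 1 / (1 - 1 / sqrt 2)) > 0" using C(1) by (intro mult_pos_pos add_pos_pos) auto
    show "Lp_bound p (gauss_sum (real L) m) (C * (1 + 1 / (1 - 1 / sqrt 2))
        * gauss_rate p (real m))"
      if "m \<ge> 1" for L m
      using p that less_imp_le[OF C(1)] C(2) by (intro Lp_bound_gauss_sum_of_tent_sums) auto
  qed
next
  case True
  show thesis
  proof (rule that[of 1])
    fix L m :: nat
    have eq: "gauss_sum (real L) m = trig_sum (\<lambda>_. 1) (\<lambda>i. int ((L + i)\<^sup>2)) {..<m}"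
      by (simp add: gauss_sum_def trig_sum_def fun_eq_iff)
    have "Lp_pow 2 (gauss_sum (real L) m) = ennreal (\<Sum>i<m. (cmod 1)\<^sup>2)"
      unfolding eq by (rule Parseval_trig_sum) (auto simp: inj_on_def simp del: of_nat_power)
    moreover have "gauss_sum (real L) m \<in> borel_measurable borel"
      unfolding eq by measurable
    ultimately show "Lp_bound p (gauss_sum (real L) m) (1 * gauss_rate p (real m))"
      by (simp add: Lp_bound_def True gauss_rate_def growth_def)
  qed simp
qed

section \<open>Weighted tails\<close>

lemma abel_summation:
  fixes a z :: "nat \<Rightarrow> 'a::comm_ring_1"
  shows "(\<Sum>i<m. a i * z i) = a m * (\<Sum>j<m. z j) + (\<Sum>i<m. (a i - a (Suc i)) * (\<Sum>j<Suc i. z j))"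
  by (induction m) (simp_all add: algebra_simps)

lemma Lp_bound_abel:
  fixes a :: "nat \<Rightarrow> real"
  assumes z: "\<And>i. i \<le> m \<Longrightarrow> Lp_bound p (\<lambda>x. \<Sum>j<i. z j x) B"
    and a: "\<And>i. a (Suc i) \<le> a i" "\<And>i. 0 \<le> a i" and "p \<ge> 1"
  shows "Lp_bound p (\<lambda>x. \<Sum>i<m. of_real (a i) * z i x) (a 0 * B)"
proof -
  have "Lp_bound p (\<lambda>x. of_real (a m) * (\<Sum>j<m. z j x)
      + (\<Sum>i<m. of_real (a i - a (Suc i)) * (\<Sum>j<Suc i. z j x)))
    (cmod (of_real (a m)) * B + (\<Sum>i<m. cmod (of_real (a i - a (Suc i))) * B))"
    using \<open>p \<ge> 1\<close> by (intro Lp_bound_add Lp_bound_sum Lp_bound_scale z) auto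
  moreover have
    "(\<lambda>x. of_real (a m) * (\<Sum>j<m. z j x) + (\<Sum>i<m. of_real (a i - a (Suc i)) * (\<Sum>j<Suc i. z j x)))
     = (\<lambda>x. \<Sum>i<m. of_real (a i) * z i x)"
    by (simp only: of_real_diff abel_summation[of "\<lambda>i. complex_of_real (a i)"])
  moreover have "cmod (of_real (a m)) * B + (\<Sum>i<m. cmod (of_real (a i - a (Suc i))) * B)
      = (a m + (\<Sum>i<m. a i - a (Suc i))) * B"
    using a by (simp del: of_real_diff add: sum_distrib_right distrib_right)
  moreover have "a m + (\<Sum>i<m. a i - a (Suc i)) = a 0"
    by (simp add: sum_lessThan_telescope')
  ultimately show ?thesis by simp
qed

definition sq_sum :: "real \<Rightarrow> nat \<Rightarrow> nat \<Rightarrow> real \<Rightarrow> complex" where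
  "sq_sum s L M = trig_sum (\<lambda>n. of_real (real n powr (- 2 * s))) (\<lambda>n. int (n\<^sup>2)) {L..<M}"

lemma borel_measurable_sq_sum [measurable]: "sq_sum s L M \<in> borel_measurable borel"
  unfolding sq_sum_def by (rule borel_measurable_trig_sum)

lemma sq_sum_concat: "K \<le> L \<Longrightarrow> L \<le> M \<Longrightarrow> sq_sum s K L x + sq_sum s L M x = sq_sum s K M x"
  unfolding sq_sum_def trig_sum_def by (rule sum.atLeastLessThan_concat)

definition tail_rate :: "real \<Rightarrow> real \<Rightarrow> real \<Rightarrow> real" where
  "tail_rate p s L = L powr (- 2 * s) * gauss_rate p L"

lemma tail_rate_nonneg: "L \<ge> 0 \<Longrightarrow> tail_rate p s L \<ge> 0"
  by (simp add: tail_rate_def gauss_rate_nonneg)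

lemma tail_rate_eq:
  assumes "L \<ge> 0"
  shows "tail_rate p s L = L powr (1/2 - 2 * s) * growth p L powr (1/p)"
proof -
  have "L powr (- 2 * s) * sqrt L = L powr (1/2 - 2 * s)"
    using assms by (simp add: powr_half_sqrt[symmetric] powr_add[symmetric])
  then show ?thesis by (simp add: tail_rate_def gauss_rate_def mult.assoc[symmetric])
qed

lemma Lp_bound_sq_sum_block:
  assumes p: "p \<ge> 2" and s: "s > 0"
  obtains C where "C > 0"
    "\<And>L M. L \<ge> 1 \<Longrightarrow> M \<le> 2 * L \<Longrightarrow> Lp_bound p (sq_sum s L M) (C * tail_rate p s (real L))"
proof -
  obtain C where C: "C > 0"
    "\<And>L m. m \<ge> 1 \<Longrightarrow> Lp_bound p (gauss_sum (real L) m) (C * gauss_rate p (real m))"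
    using Lp_bound_gauss_sum[OF p] by blast
  have "Lp_bound p (sq_sum s L M) (C * tail_rate p s (real L))"
    if L: "L \<ge> 1" and M: "M \<le> 2 * L" for L M
  proof -
    have "Lp_bound p (gauss_sum (real L) i) (C * gauss_rate p (real L))" if "i \<le> L" for i
    proof (cases "i = 0")
      case True
      then show ?thesis using C
        by (simp add: gauss_sum_def[abs_def] Lp_bound_zero gauss_rate_nonneg)
    next
      case False
      have "C * gauss_rate p (real i) \<le> C * gauss_rate p (real L)"
        using C p False that by (intro mult_left_mono gauss_rate_mono) auto
      then show ?thesis using C(2)[of i L] False p by (auto intro: Lp_bound_mono)
    qed
    then have "Lp_bound p (\<lambda>x. \<Sum>i<M - L.
        of_real (real (L + i) powr (- 2 * s)) * unit_exp ((real L + real i)\<^sup>2 * x))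
        (real (L + 0) powr (- 2 * s) * (C * gauss_rate p (real L)))"
      using L M p s by (intro Lp_bound_abel) (auto simp: gauss_sum_def[abs_def] intro!: powr_mono2')
    moreover have
      "(\<Sum>i<M - L. of_real (real (L + i) powr (- 2 * s)) * unit_exp ((real L + real i)\<^sup>2 * x))
          = sq_sum s L M x" for x
      unfolding sq_sum_def trig_sum_def
      by (rule sum.reindex_bij_witness[of _ "\<lambda>n. n - L" "\<lambda>i. L + i"]) auto
    ultimately show ?thesis by (simp add: tail_rate_def mult_ac)
  qed
  with C(1) show thesis by (rule that)
qed

lemma growth_mult_le:
  assumes "x \<ge> 1" "y \<ge> 1"
  shows "growth p (y * x) \<le> growth p y * growth p x"
proof -
  have "ln x \<ge> 0" "ln y \<ge> 0" using assms by auto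
  then have "2 + ln (y * x) \<le> (2 + ln y) * (2 + ln x)"
    using assms by (simp add: ln_mult algebra_simps)
  then show ?thesis using assms by (simp add: growth_def powr_mult)
qed

lemma tail_rate_mult_le:
  assumes "x \<ge> 1" "y \<ge> 1" "p > 0"
  shows "tail_rate p s (y * x) \<le> tail_rate p s y * tail_rate p s x"
proof -
  have "y * x \<ge> 1" using assms mult_mono[of 1 y 1 x] by simp
  have "growth p (y * x) powr (1/p) \<le> (growth p y * growth p x) powr (1/p)"
    using assms \<open>y * x \<ge> 1\<close> by (intro powr_mono2 growth_mult_le less_imp_le[OF growth_pos]) auto
  then have "(y * x) powr (1/2 - 2 * s) * growth p (y * x) powr (1/p)
      \<le> (y * x) powr (1/2 - 2 * s) * (growth p y * growth p x) powr (1/p)"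
    by (intro mult_left_mono) auto
  then show ?thesis
    using assms \<open>y * x \<ge> 1\<close> by (simp add: tail_rate_eq powr_mult mult_ac)
qed

lemma growth_le_powr:
  fixes y \<epsilon> :: real
  assumes "y \<ge> 1" "\<epsilon> > 0"
  shows "growth p y \<le> (2 + 1/\<epsilon>) * y powr (max 0 (p/2 - 2) + \<epsilon>)"
proof -
  have one: "1 \<le> y powr \<epsilon>" "0 \<le> 1/\<epsilon>" using assms by (auto intro: ge_one_powr_ge_zero)
  consider "p < 4" | "p = 4" | "p > 4" by linarith
  then show ?thesis
  proof cases
    case 1
    have "1 * 1 \<le> (2 + 1/\<epsilon>) * y powr \<epsilon>" using one by (intro mult_mono) auto
    then show ?thesis using 1 by (simp add: growth_def)
  next
    case 2
    have "2 + ln y \<le> 2 * y powr \<epsilon> + y powr \<epsilon> / \<epsilon>"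
      using one assms by (intro add_mono ln_powr_bound) auto
    then show ?thesis using 2 by (simp add: growth_def distrib_right)
  next
    case 3
    have "1 * y powr (p/2 - 2) \<le> (2 + 1/\<epsilon>) * y powr (p/2 - 2 + \<epsilon>)"
      using one assms by (intro mult_mono powr_mono) auto
    then show ?thesis using 3 by (simp add: growth_def)
  qed
qed

lemma tail_rate_le_powr:
  assumes p: "p \<ge> 2" and s: "s > s_star p"
  obtains C \<delta> where "C > 0" "\<delta> > 0" "\<And>y. y \<ge> 1 \<Longrightarrow> tail_rate p s y \<le> C * y powr (- \<delta>)"
proof -
  define \<delta> where "\<delta> = s - s_star p"
  define \<epsilon> where "\<epsilon> = p * \<delta>"
  define e where "e = max 0 (p/2 - 2) + \<epsilon>"
  have pos: "\<delta> > 0" "\<epsilon> > 0" using p s by (auto simp: \<delta>_def \<epsilon>_def)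
  have "2 * s_star p = 1/2 + max 0 (p/2 - 2) / p"
    using p by (auto simp: s_star_def max_def field_simps)
  then have exponent: "1/2 - 2 * s + e * (1/p) = - \<delta>"
    using p by (simp add: e_def \<epsilon>_def \<delta>_def add_divide_distrib)
  show thesis
  proof (rule that[of "(2 + 1/\<epsilon>) powr (1/p)" \<delta>])
    have "2 + 1/\<epsilon> > 0" using pos by (intro add_pos_pos) auto
    then show "(2 + 1/\<epsilon>) powr (1/p) > 0" by simp
    fix y :: real assume y: "y \<ge> 1"
    have "growth p y powr (1/p) \<le> ((2 + 1/\<epsilon>) * y powr e) powr (1/p)"
      unfolding e_def using p y pos
      by (intro powr_mono2 growth_le_powr less_imp_le[OF growth_pos]) auto
    also have "\<dots> = (2 + 1/\<epsilon>) powr (1/p) * y powr (e * (1/p))"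
      by (simp only: powr_mult powr_powr)
    finally have
      "tail_rate p s y \<le> y powr (1/2 - 2 * s) * ((2 + 1/\<epsilon>) powr (1/p) * y powr (e * (1/p)))"
      using y by (simp add: tail_rate_eq mult_left_mono)
    also have "\<dots> = (2 + 1/\<epsilon>) powr (1/p) * y powr (1/2 - 2 * s + e * (1/p))"
      unfolding powr_add by simp
    finally show "tail_rate p s y \<le> (2 + 1/\<epsilon>) powr (1/p) * y powr (- \<delta>)"
      unfolding exponent .
  qed (use pos in simp)
qed

lemma tail_rate_tendsto_0:
  assumes "p \<ge> 2" "s > s_star p"
  shows "(\<lambda>n. tail_rate p s (real n)) \<longlonglongrightarrow> 0"
proof -
  obtain C \<delta> where C: "C > 0" "\<delta> > 0" "\<And>y. y \<ge> 1 \<Longrightarrow> tail_rate p s y \<le> C * y powr (- \<delta>)"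
    using tail_rate_le_powr[OF assms] by blast
  have "(\<lambda>n. C * real n powr (- \<delta>)) \<longlonglongrightarrow> C * 0"
    using C by (intro tendsto_intros tendsto_neg_powr filterlim_real_sequentially) auto
  then have upper: "(\<lambda>n. C * real n powr (- \<delta>)) \<longlonglongrightarrow> 0" by simp
  show ?thesis
  proof (rule tendsto_sandwich[OF _ _ tendsto_const upper])
    show "\<forall>\<^sub>F n in sequentially. tail_rate p s (real n) \<le> C * real n powr (- \<delta>)"
      using eventually_ge_at_top[of 1] by eventually_elim (use C(3) in auto)
  qed (simp add: tail_rate_nonneg)
qed

lemma summable_tail_rate_dyadic:
  assumes "p \<ge> 2" "s > s_star p"
  shows "summable (\<lambda>k. tail_rate p s (2 ^ k))"
proof -
  obtain C \<delta> where C: "C > 0" "\<delta> > 0" "\<And>y. y \<ge> 1 \<Longrightarrow> tail_rate p s y \<le> C * y powr (- \<delta>)"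
    using tail_rate_le_powr[OF assms] by blast
  have "(2 ^ k) powr (- \<delta>) = (2 powr (- \<delta>)) ^ k" for k
    by (simp add: powr_realpow[symmetric] powr_powr mult.commute)
  then have dominated: "norm (tail_rate p s (2 ^ k)) \<le> C * (2 powr (- \<delta>)) ^ k" for k
    using C(3)[of "2 ^ k"] by (simp add: tail_rate_nonneg)
  have "2 powr (- \<delta>) < (1 :: real)"
    using C(2) powr_less_mono[of "- \<delta>" 0 2] by simp
  then have "summable (\<lambda>k. C * (2 powr (- \<delta>)) ^ k)"
    by (intro summable_mult summable_geometric) simp
  then show ?thesis
    by (rule summable_comparison_test'[where N = 0]) (rule dominated)
qed

lemma Lp_bound_sq_sum_dyadic:
  assumes p: "p \<ge> 2" and C: "C > 0"
    "\<And>L M. L \<ge> 1 \<Longrightarrow> M \<le> 2 * L \<Longrightarrow> Lp_bound p (sq_sum s L M) (C * tail_rate p s (real L))"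
    and L: "L \<ge> 1"
  shows "M \<le> 2 ^ j * L \<Longrightarrow> Lp_bound p (sq_sum s L M) (\<Sum>k<j. C * tail_rate p s (2 ^ k * real L))"
proof (induction j arbitrary: M)
  case 0
  then show ?case using Lp_bound_zero[of 0 p] by (simp add: sq_sum_def trig_sum_def[abs_def])
next
  case (Suc j)
  show ?case
  proof (cases "M \<le> 2 ^ j * L")
    case True
    have "C * tail_rate p s (2 ^ j * real L) \<ge> 0" using C by (simp add: tail_rate_nonneg)
    then show ?thesis using p by (intro Lp_bound_mono[OF Suc.IH[OF True]]) auto
  next
    case False
    have "Lp_bound p (\<lambda>x. sq_sum s L (2 ^ j * L) x + sq_sum s (2 ^ j * L) M x)
      ((\<Sum>k<j. C * tail_rate p s (2 ^ k * real L)) + C * tail_rate p s (real (2 ^ j * L)))"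
      using Suc.prems p L by (intro Lp_bound_add Suc.IH C) auto
    moreover have "sq_sum s L (2 ^ j * L) x + sq_sum s (2 ^ j * L) M x = sq_sum s L M x" for x
      using False by (intro sq_sum_concat) auto
    ultimately show ?thesis by simp
  qed
qed

lemma s_star_ge: "p \<ge> 2 \<Longrightarrow> s_star p \<ge> 1/4"
  by (auto simp: s_star_def field_simps)

lemma Lp_bound_sq_sum:
  assumes p: "p \<ge> 2" and s: "s > s_star p"
  obtains C where "C > 0" "\<And>L M. L \<ge> 1 \<Longrightarrow> Lp_bound p (sq_sum s L M) (C * tail_rate p s (real L))"
proof -
  have "s > 0" using s s_star_ge[OF p] by simp
  then obtain C where C: "C > 0"
    "\<And>L M. L \<ge> 1 \<Longrightarrow> M \<le> 2 * L \<Longrightarrow> Lp_bound p (sq_sum s L M) (C * tail_rate p s (real L))"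
    using Lp_bound_sq_sum_block[OF p] by blast
  define T where "T = (\<Sum>k. tail_rate p s (2 ^ k)) + 1"
  have T: "T > 0"
    using suminf_nonneg[OF summable_tail_rate_dyadic[OF p s]] by (simp add: T_def tail_rate_nonneg)
  have partial: "(\<Sum>k<j. tail_rate p s (2 ^ k)) \<le> T" for j
    using sum_le_suminf[OF summable_tail_rate_dyadic[OF p s], of "{..<j}"]
    by (simp add: T_def tail_rate_nonneg)
  show thesis
  proof (rule that[of "C * T"])
    fix L M :: nat assume L: "L \<ge> 1"
    have "M \<le> 2 ^ M * L" using L less_exp[of M]
      by (metis le_trans less_imp_le mult_le_mono2 mult.right_neutral)
    then have "Lp_bound p (sq_sum s L M) (\<Sum>k<M. C * tail_rate p s (2 ^ k * real L))"
      by (intro Lp_bound_sq_sum_dyadic p C L)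
    moreover have "(\<Sum>k<M. C * tail_rate p s (2 ^ k * real L))
        \<le> (\<Sum>k<M. C * (tail_rate p s (2 ^ k) * tail_rate p s (real L)))"
      using C L p by (intro sum_mono mult_left_mono tail_rate_mult_le) auto
    moreover have "\<dots> = C * (\<Sum>k<M. tail_rate p s (2 ^ k)) * tail_rate p s (real L)"
      by (simp add: sum_distrib_left sum_distrib_right mult.assoc)
    moreover have "\<dots> \<le> C * T * tail_rate p s (real L)"
      using C by (intro mult_left_mono mult_right_mono partial) (auto simp: tail_rate_nonneg)
    ultimately show "Lp_bound p (sq_sum s L M) (C * T * tail_rate p s (real L))"
      using p by (elim Lp_bound_mono) auto
  qed (use C T in simp)
qed

lemma Lp_Cauchy_sq_sum:
  assumes p: "p \<ge> 2" and s: "s > s_star p"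
  shows "Lp_Cauchy p (sq_sum s L)"
  unfolding Lp_Cauchy_def
proof (intro allI impI)
  fix \<epsilon> :: real assume "\<epsilon> > 0"
  obtain C where C: "C > 0" "\<And>L M. L \<ge> 1 \<Longrightarrow> Lp_bound p (sq_sum s L M) (C * tail_rate p s (real L))"
    using Lp_bound_sq_sum[OF p s] by blast
  have "(\<lambda>n. C * tail_rate p s (real n)) \<longlonglongrightarrow> C * 0"
    by (intro tendsto_intros tail_rate_tendsto_0 p s)
  then have "\<forall>\<^sub>F n in sequentially. C * tail_rate p s (real n) < \<epsilon>"
    using \<open>\<epsilon> > 0\<close> by (intro order_tendstoD(2)) auto
  then obtain N where N: "\<And>n. n \<ge> N \<Longrightarrow> C * tail_rate p s (real n) < \<epsilon>"
    unfolding eventually_sequentially by blast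
  define N' where "N' = max N (max L 1)"
  have later: "Lp_bound p (\<lambda>x. sq_sum s L m x - sq_sum s L n x) \<epsilon>" if "N' \<le> n" "n \<le> m" for m n
  proof -
    have "sq_sum s L m x - sq_sum s L n x = sq_sum s n m x" for x
      using sq_sum_concat[of L n m s x] that by (simp add: N'_def algebra_simps)
    moreover have "Lp_bound p (sq_sum s n m) \<epsilon>"
    proof (rule Lp_bound_mono[OF C(2)])
      show "C * tail_rate p s (real n) \<le> \<epsilon>" using N[of n] that by (simp add: N'_def)
    qed (use that p in \<open>auto simp: N'_def\<close>)
    ultimately show ?thesis by simp
  qed
  have "Lp_bound p (\<lambda>x. sq_sum s L m x - sq_sum s L n x) \<epsilon>" if "N' \<le> m" "N' \<le> n" for m n
  proof (cases "n \<le> m")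
    case False
    then show ?thesis using Lp_bound_uminus[OF later[of m n]] that p by simp
  qed (use later that in simp)
  then show "\<exists>N. \<forall>m\<ge>N. \<forall>n\<ge>N. Lp_bound p (\<lambda>x. sq_sum s L m x - sq_sum s L n x) \<epsilon>"
    by blast
qed

lemma ex_Lp_limit_sq_sum:
  assumes "p \<ge> 2" "s > s_star p"
  shows "\<exists>g. Lp_limit p (sq_sum s L) g"
  using assms by (intro Lp_complete Lp_Cauchy_sq_sum borel_measurable_sq_sum) auto

section \<open>Equal sums of two squares\<close>

lemma card_multiples_ge:
  fixes d P R :: nat
  assumes "d > 0"
  shows "R div d \<le> card {b \<in> {P<..P + R}. d dvd b}"
proof -
  have "{b \<in> {P<..P + R}. d dvd b} = (\<lambda>k. k * d) ` {P div d<..(P + R) div d}"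
    using assms
    by (auto simp: div_less_iff_less_mult less_eq_div_iff_mult_less_eq image_iff elim!: dvdE)
      (metis mult.commute)+
  moreover have "inj (\<lambda>k. k * d)" using assms by (auto simp: inj_on_def)
  ultimately have "card {b \<in> {P<..P + R}. d dvd b} = (P + R) div d - P div d"
    by (simp add: card_image inj_on_subset)
  moreover have "P div d + R div d \<le> (P + R) div d"
    using assms by (simp add: less_eq_div_iff_mult_less_eq distrib_right add_mono)
  ultimately show ?thesis by simp
qed

lemma card_multiples_ge_real:
  assumes "d \<in> {1..X}"
  shows "real X / (2 * real d) \<le> real (card {b \<in> {X<..2*X}. d dvd b})"
proof -
  have "X < d * (X div d) + d"
    using assms dividend_less_times_div[of d X] by simp
  moreover have "d * 1 \<le> d * (X div d)"
    using assms by (intro mult_le_mono2) (simp add: Suc_le_eq div_greater_zero_iff)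
  ultimately have "real X \<le> real (2 * d * (X div d))" unfolding of_nat_le_iff by linarith
  then have "real X / (2 * real d) \<le> real (X div d)" using assms by (simp add: field_simps)
  also have "\<dots> \<le> real (card {b \<in> {X<..2*X}. d dvd b})"
    using card_multiples_ge[of d X X] assms by (simp add: mult_2)
  finally show ?thesis .
qed

lemma sum_divisors_le_mult:
  fixes f g :: "nat \<Rightarrow> real"
  assumes "\<And>n. 0 \<le> f n" "\<And>n. 0 \<le> g n"
  shows "(\<Sum>m\<in>{1..X}. \<Sum>d\<in>{d. d dvd m}. f d * g (m div d)) \<le> (\<Sum>d\<in>{1..X}. f d) * (\<Sum>k\<in>{1..X}. g k)"
proof -
  define h where "h = (\<lambda>(m, d). (d, m div d :: nat))"
  let ?P = "SIGMA m:{1..X}. {d. d dvd m}"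
  have inj: "inj_on h ?P" by (auto simp: inj_on_def h_def)
  have "h ` ?P \<subseteq> {1..X} \<times> {1..X}"
  proof (rule image_subsetI)
    fix t assume "t \<in> ?P"
    then obtain m d where md: "t = (m, d)" "m \<in> {1..X}" "d dvd m" by auto
    then have "d \<ge> 1" "d \<le> m" "m div d \<ge> 1"
      by (auto simp: dvd_imp_le Suc_le_eq div_greater_zero_iff intro!: Nat.gr0I)
    moreover have "m div d \<le> X" using md(2) by (auto intro: order_trans[OF div_le_dividend])
    ultimately show "h t \<in> {1..X} \<times> {1..X}" using md by (simp add: h_def)
  qed
  then have "(\<Sum>(d, k)\<in>h ` ?P. f d * g k) \<le> (\<Sum>(d, k)\<in>{1..X} \<times> {1..X}. f d * g k)"
    using assms by (intro sum_mono2) auto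
  moreover have "(\<Sum>m\<in>{1..X}. \<Sum>d\<in>{d. d dvd m}. f d * g (m div d)) = (\<Sum>(m, d)\<in>?P. f d * g (m div d))"
    by (rule sum.Sigma) (auto intro!: finite_divisors_nat)
  moreover have "\<dots> = (\<Sum>(d, k)\<in>h ` ?P. f d * g k)"
    by (subst sum.reindex[OF inj]) (auto simp: h_def intro!: sum.cong)
  ultimately show ?thesis by (simp add: sum_product sum.cartesian_product)
qed

lemma sum_totient_ge: "ln (real X + 1) / 2 \<le> (\<Sum>d\<in>{1..X}. real (totient d) / (real d)\<^sup>2)"
proof -
  have convolution:
    "1 / real m = (\<Sum>d\<in>{d. d dvd m}. real (totient d) / (real d)\<^sup>2 * (1 / (real (m div d))\<^sup>2))"
    if "m \<in> {1..X}" for m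
  proof -
    have "(\<Sum>d\<in>{d. d dvd m}. real (totient d) / (real d)\<^sup>2 * (1 / (real (m div d))\<^sup>2))
        = (\<Sum>d\<in>{d. d dvd m}. real (totient d) / (real m)\<^sup>2)"
      using that by (intro sum.cong) (auto simp: power_mult_distrib elim!: dvdE)
    also have "\<dots> = real (\<Sum>d\<in>{d. d dvd m}. totient d) / (real m)\<^sup>2"
      by (simp add: sum_divide_distrib)
    also have "\<dots> = 1 / real m"
      using that by (simp add: totient_divisor_sum power2_eq_square)
    finally show ?thesis ..
  qed
  have "ln (real X + 1) \<le> (\<Sum>m\<in>{1..X}. 1 / real m)"
    using ln_le_harm[of X] by (simp add: harm_def inverse_eq_divide)
  also have "\<dots>
      = (\<Sum>m\<in>{1..X}. \<Sum>d\<in>{d. d dvd m}. real (totient d) / (real d)\<^sup>2 * (1 / (real (m div d))\<^sup>2))"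
    by (intro sum.cong refl convolution)
  also have "\<dots> \<le> (\<Sum>d\<in>{1..X}. real (totient d) / (real d)\<^sup>2) * (\<Sum>k\<in>{1..X}. 1 / (real k)\<^sup>2)"
    by (rule sum_divisors_le_mult) auto
  also have "\<dots> \<le> (\<Sum>d\<in>{1..X}. real (totient d) / (real d)\<^sup>2) * 2"
    by (intro mult_left_mono sum_inverse_squares_le sum_nonneg) auto
  finally show ?thesis by simp
qed

lemma sum_gcd_ge_sum_totient:
  assumes "finite A" "0 \<notin> A"
  shows "(\<Sum>d\<in>{1..X}. real (totient d) * (real (card {b \<in> A. d dvd b}))\<^sup>2)
      \<le> (\<Sum>a\<in>A. \<Sum>c\<in>A. real (gcd a c))"
proof -
  have square: "real (totient d) * (real (card {b \<in> A. d dvd b}))\<^sup>2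
      = (\<Sum>a\<in>A. \<Sum>c\<in>A. if d dvd a \<and> d dvd c then real (totient d) else 0)" for d
  proof -
    have card: "real (card {b \<in> A. d dvd b}) = (\<Sum>b\<in>A. if d dvd b then 1 else 0)"
      using \<open>finite A\<close> by (simp add: sum.If_cases Int_def)
    show ?thesis
      unfolding card power2_eq_square sum_product unfolding sum_distrib_left
      by (intro sum.cong refl) auto
  qed
  have "(\<Sum>d\<in>{1..X}. real (totient d) * (real (card {b \<in> A. d dvd b}))\<^sup>2)
      = (\<Sum>a\<in>A. \<Sum>c\<in>A. \<Sum>d\<in>{1..X}. if d dvd a \<and> d dvd c then real (totient d) else 0)"
    unfolding square by (rule trans[OF sum.swap]) (intro sum.cong refl sum.swap)
  also have "\<dots> \<le> (\<Sum>a\<in>A. \<Sum>c\<in>A. real (gcd a c))"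
  proof (intro sum_mono)
    fix a c assume "a \<in> A" "c \<in> A"
    then have "gcd a c > 0" using assms by (metis gcd_pos_nat neq0_conv)
    have "(\<Sum>d\<in>{1..X}. if d dvd a \<and> d dvd c then real (totient d) else 0)
        = (\<Sum>d\<in>{d\<in>{1..X}. d dvd a \<and> d dvd c}. real (totient d))"
      by (rule sum.inter_filter[symmetric]) simp
    also have "\<dots> \<le> (\<Sum>d\<in>{d. d dvd gcd a c}. real (totient d))"
      using \<open>gcd a c > 0\<close> by (intro sum_mono2 finite_divisors_nat) auto
    also have "\<dots> = real (gcd a c)"
      using totient_divisor_sum[of "gcd a c"] by (simp only: of_nat_sum[symmetric])
    finally show "(\<Sum>d\<in>{1..X}. if d dvd a \<and> d dvd c then real (totient d) else 0) \<le> real (gcd a c)" .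
  qed
  finally show ?thesis .
qed

lemma sum_gcd_ge: "(real X)\<^sup>2 * ln (real X + 1) / 8 \<le> (\<Sum>a\<in>{X<..2*X}. \<Sum>c\<in>{X<..2*X}. real (gcd a c))"
proof -
  have "(real X)\<^sup>2 * ln (real X + 1) / 8 = (real X)\<^sup>2 / 4 * (ln (real X + 1) / 2)" by simp
  also have "\<dots> \<le> (real X)\<^sup>2 / 4 * (\<Sum>d\<in>{1..X}. real (totient d) / (real d)\<^sup>2)"
    by (intro mult_left_mono sum_totient_ge) auto
  also have "\<dots> = (\<Sum>d\<in>{1..X}. real (totient d) * (real X / (2 * real d))\<^sup>2)"
    by (simp add: sum_distrib_left power_divide power_mult_distrib mult_ac)
  also have "\<dots> \<le> (\<Sum>d\<in>{1..X}. real (totient d) * (real (card {b \<in> {X<..2*X}. d dvd b}))\<^sup>2)"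
    by (intro sum_mono mult_left_mono power_mono card_multiples_ge_real) auto
  also have "\<dots> \<le> (\<Sum>a\<in>{X<..2*X}. \<Sum>c\<in>{X<..2*X}. real (gcd a c))"
    by (rule sum_gcd_ge_sum_totient) auto
  finally show ?thesis .
qed

definition equal_square_sums :: "nat set \<Rightarrow> ((nat \<times> nat) \<times> (nat \<times> nat)) set" where
  "equal_square_sums A = {((i, j), (k, l)). {i, j, k, l} \<subseteq> A \<and> i\<^sup>2 + j\<^sup>2 = k\<^sup>2 + l\<^sup>2}"

lemma finite_equal_square_sums: "finite A \<Longrightarrow> finite (equal_square_sums A)"
  by (rule finite_subset[of _ "(A \<times> A) \<times> (A \<times> A)"]) (auto simp: equal_square_sums_def)

definition divisor_triples :: "nat \<Rightarrow> nat \<Rightarrow> (nat \<times> nat \<times> nat) set" where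
  "divisor_triples X L = (SIGMA a:{X<..2*X}. SIGMA c:{X<..2*X}. {b \<in> {4*L<..8*L}. c dvd a * b})"

lemma gcd_le_card_multiples:
  fixes a c L :: nat
  assumes "0 < c" "c \<le> 4 * L"
  shows "gcd a c \<le> card {b \<in> {4*L<..8*L}. c dvd a * b}"
proof -
  define c' where "c' = c div gcd a c"
  have c: "c = gcd a c * c'" by (simp add: c'_def)
  then have "c' > 0" using assms(1) by (metis gr0I mult_0_right less_irrefl)
  have "gcd a c \<le> 4 * L div c'"
    using \<open>c' > 0\<close> assms(2) c by (simp add: less_eq_div_iff_mult_less_eq)
  also have "\<dots> \<le> card {b \<in> {4*L<..4*L+4*L}. c' dvd b}" by (rule card_multiples_ge[OF \<open>c' > 0\<close>])
  also have "\<dots> \<le> card {b \<in> {4*L<..8*L}. c dvd a * b}"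
  proof (rule card_mono)
    have "c dvd a * b" if "c' dvd b" for b
      using mult_dvd_mono[OF gcd_dvd1 that, of a c] c by simp
    then show "{b \<in> {4*L<..4*L+4*L}. c' dvd b} \<subseteq> {b \<in> {4*L<..8*L}. c dvd a * b}" by auto
  qed simp
  finally show ?thesis .
qed

lemma sum_gcd_le_card_divisor_triples:
  assumes "2 * X \<le> L"
  shows "(\<Sum>a\<in>{X<..2*X}. \<Sum>c\<in>{X<..2*X}. gcd a c) \<le> card (divisor_triples X L)"
proof -
  have card: "card (divisor_triples X L)
      = (\<Sum>a\<in>{X<..2*X}. \<Sum>c\<in>{X<..2*X}. card {b \<in> {4*L<..8*L}. c dvd a * b})"
    unfolding divisor_triples_def
    by (subst card_SigmaI) (auto simp: card_SigmaI intro!: finite_SigmaI)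
  show ?thesis
    unfolding card by (intro sum_mono gcd_le_card_multiples) (use assms in auto)
qed

text \<open>A factorisation \<open>a b = c d\<close> yields \<open>(b + a)\<^sup>2 + (d - c)\<^sup>2 = (b - a)\<^sup>2 + (d + c)\<^sup>2\<close>.\<close>

definition square_quadruple :: "nat \<times> nat \<times> nat \<Rightarrow> (nat \<times> nat) \<times> (nat \<times> nat)" where
  "square_quadruple = (\<lambda>(a, c, b). ((b + a, a * b div c - c), (b - a, a * b div c + c)))"

lemma divisor_triplesD:
  assumes "(a, c, b) \<in> divisor_triples X L" "2 * X \<le> L"
  shows "0 < a" "a \<le> L" "0 < c" "c \<le> L" "4 * L < b" "b \<le> 8 * L"
    "c * (a * b div c) = a * b" "2 * L \<le> a * b div c" "a * b div c \<le> 16 * L"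
proof -
  from assms have t: "X < a" "a \<le> 2 * X" "X < c" "c \<le> 2 * X" "4 * L < b" "b \<le> 8 * L" "c dvd a * b"
    by (auto simp: divisor_triples_def)
  then show "0 < a" "a \<le> L" "0 < c" "c \<le> L" "4 * L < b" "b \<le> 8 * L" "c * (a * b div c) = a * b"
    using assms(2) by auto
  have "c * (2 * L) \<le> (2 * a) * (2 * L)" using t by (intro mult_le_mono1) auto
  also have "\<dots> = a * (4 * L)" by simp
  also have "\<dots> \<le> a * b" using t by (intro mult_le_mono2) auto
  finally show "2 * L \<le> a * b div c" using t
    by (simp add: less_eq_div_iff_mult_less_eq mult.commute)
  have "a * b \<le> (2 * c) * (8 * L)" using t by (intro mult_le_mono) auto
  then have "a * b div c \<le> (c * (16 * L)) div c" by (intro div_le_mono) simp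
  then show "a * b div c \<le> 16 * L" using t by simp
qed

lemma square_quadruple_mem:
  assumes "t \<in> divisor_triples X L" "2 * X \<le> L"
  shows "square_quadruple t \<in> equal_square_sums {L..17*L}"
proof -
  obtain a c b where t: "t = (a, c, b)" by (metis prod_cases3)
  define d where "d = a * b div c"
  note bounds = divisor_triplesD[OF assms[unfolded t], folded d_def]
  have "int a * int b = int c * int d" using bounds(7) by (metis of_nat_mult)
  then have "(int (b + a))\<^sup>2 + (int (d - c))\<^sup>2 = (int (b - a))\<^sup>2 + (int (d + c))\<^sup>2"
    using bounds(2,4,5,8) by (simp add: of_nat_diff power2_eq_square algebra_simps)
  then have "(b + a)\<^sup>2 + (d - c)\<^sup>2 = (b - a)\<^sup>2 + (d + c)\<^sup>2"
    by (simp only: of_nat_power[symmetric] of_nat_add[symmetric] of_nat_eq_iff)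
  moreover have "b + a \<in> {L..17*L}" "d - c \<in> {L..17*L}" "b - a \<in> {L..17*L}" "d + c \<in> {L..17*L}"
    unfolding atLeastAtMost_iff using bounds(1-6,8,9) by linarith+
  ultimately show ?thesis
    by (simp add: t square_quadruple_def d_def[symmetric] equal_square_sums_def)
qed

lemma inj_on_square_quadruple:
  assumes "2 * X \<le> L"
  shows "inj_on square_quadruple (divisor_triples X L)"
proof (rule inj_onI)
  fix t t' assume mem: "t \<in> divisor_triples X L" "t' \<in> divisor_triples X L"
    and eq: "square_quadruple t = square_quadruple t'"
  obtain a c b a' c' b' where e: "t = (a, c, b)" "t' = (a', c', b')" by (metis prod_cases3)
  note bounds = divisor_triplesD[OF mem(1)[unfolded e] assms]
      divisor_triplesD[OF mem(2)[unfolded e] assms]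
  have "b + a = b' + a'" "b - a = b' - a'"
    "a * b div c - c = a' * b' div c' - c'" "a * b div c + c = a' * b' div c' + c'"
    using eq by (auto simp: e square_quadruple_def)
  then show "t = t'" using bounds by (auto simp: e)
qed

lemma card_equal_square_sums_ge:
  assumes "L \<ge> 2"
  shows "(real L)\<^sup>2 * ln (real L) / 256 \<le> real (card (equal_square_sums {L..17*L}))"
proof -
  define X where "X = L div 2"
  have X: "2 * X \<le> L" "real L / 4 \<le> real X" using assms by (auto simp: X_def)
  have "real L \<le> (real L / 4 + 1)\<^sup>2"
    using zero_le_power2[of "real L / 4 - 1"] by (simp add: power2_eq_square algebra_simps)
  then have "ln (real L) \<le> ln ((real L / 4 + 1)\<^sup>2)" using assms by (intro ln_mono) auto
  also have "\<dots> = 2 * ln (real L / 4 + 1)" by (simp add: ln_realpow)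
  also have "\<dots> \<le> 2 * ln (real X + 1)" using X by (intro mult_left_mono ln_mono) auto
  finally have ln: "ln (real L) / 2 \<le> ln (real X + 1)" by simp
  have "(real L)\<^sup>2 * ln (real L) / 256 = (real L / 4)\<^sup>2 * (ln (real L) / 2) / 8"
    by (simp add: power_divide)
  also have "\<dots> \<le> (real X)\<^sup>2 * ln (real X + 1) / 8"
    using assms by (intro divide_right_mono mult_mono power_mono X ln) auto
  also have "\<dots> \<le> (\<Sum>a\<in>{X<..2*X}. \<Sum>c\<in>{X<..2*X}. real (gcd a c))" by (rule sum_gcd_ge)
  also have "\<dots> = real (\<Sum>a\<in>{X<..2*X}. \<Sum>c\<in>{X<..2*X}. gcd a c)" by simp
  also have "\<dots> \<le> real (card (divisor_triples X L))"
    unfolding of_nat_le_iff by (rule sum_gcd_le_card_divisor_triples[OF X(1)])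
  also have "card (divisor_triples X L) \<le> card (equal_square_sums {L..17*L})"
    using X(1) square_quadruple_mem
    by (intro card_inj_on_le[OF inj_on_square_quadruple] finite_equal_square_sums) auto
  finally show ?thesis by simp
qed

section \<open>Lower bounds\<close>

lemma Lp_lower_bound_2_sq_sum:
  assumes s: "s \<ge> 0" and L: "L \<ge> 1" and M: "2 * L \<le> M"
  shows "Lp_lower_bound 2 (sq_sum s L M) (2 powr (- 2 * s) * tail_rate 2 s (real L))"
proof -
  define b where "b = 2 powr (- 2 * s) * tail_rate 2 s (real L)"
  have "b \<ge> 0" by (simp add: b_def tail_rate_nonneg)
  have "b = (2 * real L) powr (- 2 * s) * real L powr (1/2)"
    by (simp add: b_def tail_rate_def gauss_rate_def growth_def powr_mult powr_half_sqrt)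
  then have "b powr 2 = (\<Sum>n\<in>{L..<2*L}. ((2 * real L) powr (- 2 * s))\<^sup>2)"
    using L by (simp add: power_mult_distrib powr_half_sqrt)
  also have "\<dots> \<le> (\<Sum>n\<in>{L..<2*L}. (real n powr (- 2 * s))\<^sup>2)"
    using L s by (intro sum_mono power_mono powr_mono2') auto
  also have "\<dots> \<le> (\<Sum>n\<in>{L..<M}. (real n powr (- 2 * s))\<^sup>2)"
    using M by (intro sum_mono2) auto
  finally have "ennreal (b powr 2) \<le> ennreal (\<Sum>n\<in>{L..<M}. (real n powr (- 2 * s))\<^sup>2)"
    by (rule ennreal_leI)
  also have "\<dots> = Lp_pow 2 (sq_sum s L M)"
    unfolding sq_sum_def
    by (subst Parseval_trig_sum) (auto simp: inj_on_def simp del: of_nat_power)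
  finally show ?thesis using \<open>b \<ge> 0\<close> by (simp only: Lp_lower_bound_def b_def)
qed

lemma Lp_pow_4_trig_sum_squares:
  fixes a :: "nat \<Rightarrow> real"
  assumes "finite B"
  shows "Lp_pow 4 (trig_sum (\<lambda>n. of_real (a n)) (\<lambda>n. int (n\<^sup>2)) B)
    = ennreal (\<Sum>((i, j), (k, l))\<in>equal_square_sums B. a i * a j * (a k * a l))"
proof -
  define S where "S = trig_sum (\<lambda>n. complex_of_real (a n)) (\<lambda>n. int (n\<^sup>2)) B"
  define \<kappa> where "\<kappa> = (\<lambda>(i, j). int (i\<^sup>2) + int (j\<^sup>2))"
  define b where "b = (\<lambda>(i, j). a i * a j)"
  have square: "S x * S x = trig_sum (\<lambda>i. of_real (b i)) \<kappa> (B \<times> B) x" for x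
    unfolding S_def trig_sum_mult by (simp add: \<kappa>_def b_def case_prod_unfold)
  have "Lp_pow 4 S = Lp_pow 2 (\<lambda>x. S x * S x)"
    by (simp add: Lp_pow_def norm_mult power2_eq_square power4_eq_xxxx mult.assoc)
  also have "\<dots> = ennreal (Re (\<Sum>i\<in>B \<times> B. \<Sum>j\<in>B \<times> B.
      if \<kappa> i = \<kappa> j then of_real (b i) * cnj (of_real (b j)) else 0))"
    unfolding square using assms by (intro Lp_pow_2_trig_sum) simp
  also have "Re (\<Sum>i\<in>B \<times> B. \<Sum>j\<in>B \<times> B. if \<kappa> i = \<kappa> j then of_real (b i) * cnj (of_real (b j)) else 0)
      = (\<Sum>i\<in>B \<times> B. \<Sum>j\<in>B \<times> B. if \<kappa> i = \<kappa> j then b i * b j else 0)"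
    unfolding Re_sum by (intro sum.cong refl) simp
  also have "\<dots> = (\<Sum>(i, j)\<in>(B \<times> B) \<times> (B \<times> B). if \<kappa> i = \<kappa> j then b i * b j else 0)"
    by (rule sum.cartesian_product)
  also have "\<dots> = (\<Sum>((i, j), (k, l))\<in>equal_square_sums B. a i * a j * (a k * a l))"
    using assms by (intro sum.mono_neutral_cong_right)
      (auto simp: equal_square_sums_def \<kappa>_def b_def
        simp flip: of_nat_add of_nat_power split: if_splits)
  finally show ?thesis by (simp only: S_def)
qed

lemma tail_rate_4_power_le:
  assumes "L \<ge> 2"
  shows "tail_rate 4 s L ^ 4 \<le> (L powr (- 2 * s)) ^ 4 * (4 * L\<^sup>2 * ln L)"
proof -
  have "ln 2 \<le> ln L" using assms by (intro ln_mono) auto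
  then have "2/3 \<le> ln L" using ln2_ge_two_thirds by linarith
  have "tail_rate 4 s L ^ 4 = (L powr (- 2 * s)) ^ 4 * sqrt L ^ 4 * ((2 + ln L) powr (1/4)) ^ 4"
    by (simp add: tail_rate_def gauss_rate_def growth_def power_mult_distrib)
  also have "sqrt L ^ 4 = L\<^sup>2"
    using assms by (simp add: real_sqrt_power_even)
  also have "((2 + ln L) powr (1/4)) ^ 4 = 2 + ln L"
    using \<open>2/3 \<le> ln L\<close> by (simp add: powr_power)
  also have "(L powr (- 2 * s)) ^ 4 * L\<^sup>2 * (2 + ln L) \<le> (L powr (- 2 * s)) ^ 4 * L\<^sup>2 * (4 * ln L)"
    using \<open>2/3 \<le> ln L\<close> by (intro mult_left_mono) auto
  finally show ?thesis by (simp add: mult_ac)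
qed

lemma Lp_lower_bound_4_sq_sum:
  assumes s: "s \<ge> 0" and L: "L \<ge> 2" and M: "17 * L < M"
  shows "Lp_lower_bound 4 (sq_sum s L M) (17 powr (- 2 * s) / 6 * tail_rate 4 s (real L))"
proof -
  define a where "a n = real n powr (- 2 * s)" for n
  define c where "c = (17 * real L) powr (- 2 * s)"
  define b where "b = 17 powr (- 2 * s) / 6 * tail_rate 4 s (real L)"
  have c: "c \<ge> 0" "\<And>n. n \<in> {L..17*L} \<Longrightarrow> c \<le> a n" and "b \<ge> 0"
    using L s by (auto simp: a_def b_def c_def tail_rate_nonneg intro!: powr_mono2')
  have "b powr 4 = (17 powr (- 2 * s) / 6) ^ 4 * tail_rate 4 s (real L) ^ 4"
    using \<open>b \<ge> 0\<close> by (simp add: b_def power_mult_distrib power_divide)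
  also have "\<dots> \<le> (17 powr (- 2 * s) / 6) ^ 4
      * ((real L powr (- 2 * s)) ^ 4 * (4 * (real L)\<^sup>2 * ln (real L)))"
    using L by (intro mult_left_mono tail_rate_4_power_le) auto
  also have "\<dots> = c ^ 4 * ((real L)\<^sup>2 * ln (real L) / 324)"
    by (simp add: c_def powr_mult power_mult_distrib power_divide)
  also have "\<dots> \<le> c ^ 4 * ((real L)\<^sup>2 * ln (real L) / 256)"
    using L by (intro mult_left_mono divide_left_mono) auto
  also have "\<dots> \<le> c ^ 4 * real (card (equal_square_sums {L..17*L}))"
    using L by (intro mult_left_mono card_equal_square_sums_ge) auto
  also have "\<dots> = (\<Sum>((i, j), (k, l))\<in>equal_square_sums {L..17*L}. c * c * (c * c))"
    by (simp add: case_prod_unfold eval_nat_numeral)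
  also have "\<dots> \<le> (\<Sum>((i, j), (k, l))\<in>equal_square_sums {L..17*L}. a i * a j * (a k * a l))"
    using c by (intro sum_mono) (auto simp: equal_square_sums_def a_def intro!: mult_mono)
  also have "\<dots> \<le> (\<Sum>((i, j), (k, l))\<in>equal_square_sums {L..<M}. a i * a j * (a k * a l))"
    using M by (intro sum_mono2 finite_equal_square_sums) (auto simp: equal_square_sums_def a_def)
  finally have "ennreal (b powr 4) \<le> Lp_pow 4 (sq_sum s L M)"
    unfolding sq_sum_def a_def[symmetric]
    by (subst Lp_pow_4_trig_sum_squares) (auto intro: ennreal_leI)
  then show ?thesis using \<open>b \<ge> 0\<close> by (simp only: Lp_lower_bound_def b_def)
qed

text \<open>Not normalised: its mean is \<open>Q\<close> and its maximum is \<open>Q\<^sup>2\<close>.\<close>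

definition Fejer_kernel :: "nat \<Rightarrow> real \<Rightarrow> real" where
  "Fejer_kernel Q x = (cmod (trig_sum (\<lambda>_. 1) int {..<Q} x))\<^sup>2"

lemma Fejer_kernel_nonneg: "0 \<le> Fejer_kernel Q x"
  by (simp add: Fejer_kernel_def)

lemma Fejer_kernel_le: "Fejer_kernel Q x \<le> (real Q)\<^sup>2"
proof -
  have "cmod (trig_sum (\<lambda>_. 1) int {..<Q} x) \<le> (\<Sum>m<Q. cmod (1 * unit_exp (of_int (int m) * x)))"
    unfolding trig_sum_def by (rule norm_sum)
  then show ?thesis unfolding Fejer_kernel_def by (intro power_mono) (auto simp: norm_mult)
qed

lemma has_integral_Fejer_kernel:
  "((\<lambda>x. Re (unit_exp (real n * x)) * Fejer_kernel Q x) has_integral real (Q - n)) {0..1}"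
proof -
  define D where "D = trig_sum (\<lambda>_. 1) int {..<Q}"
  have shifted: "unit_exp (real n * x) * D x = trig_sum (\<lambda>_. 1) (\<lambda>m. int (m + n)) {..<Q} x" for x
    by (simp add: D_def trig_sum_def sum_distrib_left unit_exp_add[symmetric] algebra_simps)
  have "(\<Sum>m<Q. \<Sum>m'<Q. if int (m + n) = int m' then 1 * cnj 1 else 0)
      = (\<Sum>m<Q. if m + n < Q then 1 else (0::complex))"
    by (intro sum.cong refl) (simp add: sum.delta' del: of_nat_add)
  also have "\<dots> = (\<Sum>m<Q - n. 1)"
    by (rule sum.mono_neutral_cong_right) auto
  finally have diagonal:
    "(\<Sum>m<Q. \<Sum>m'<Q. if int (m + n) = int m' then 1 * cnj 1 else 0) = complex_of_nat (Q - n)"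
    by simp
  have "((\<lambda>x. unit_exp (real n * x) * D x * cnj (D x)) has_integral complex_of_nat (Q - n)) {0..1}"
    unfolding shifted diagonal[symmetric] unfolding D_def by (rule has_integral_trig_sum_inner) auto
  from has_integral_Re[OF this]
  have "((\<lambda>x. Re (unit_exp (real n * x) * D x * cnj (D x))) has_integral real (Q - n)) {0..1}"
    by (simp only: complex_Re_of_nat)
  moreover have "Re (unit_exp (real n * x) * D x * cnj (D x))
      = Re (unit_exp (real n * x)) * Fejer_kernel Q x" for x
    unfolding mult.assoc complex_norm_square[symmetric] Fejer_kernel_def D_def by simp
  ultimately show ?thesis by (simp only:)
qed

text \<open>Testing against the Fejer kernel of degree \<open>8 L\<^sup>2\<close>, which concentrates on \<open>\<bar>x\<bar> \<lesssim> L\<^bsup>-2\<^esup>\<close>,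
  avoids any pointwise control of the infinite tail near the origin.\<close>

lemma Lp_pow_sq_sum_ge:
  assumes s: "s \<ge> 0" and L: "L \<ge> 1" and M: "2 * L \<le> M" and p: "p \<ge> 1"
  defines "b \<equiv> real L * (2 * real L) powr (- 2 * s) / 2"
  shows "ennreal (b powr p / (8 * (real L)\<^sup>2)) \<le> Lp_pow p (sq_sum s L M)"
proof -
  define Q where "Q = 8 * L\<^sup>2"
  define W where "W = (\<Sum>n\<in>{L..<M}. real n powr (- 2 * s) * real (Q - n\<^sup>2))"
  have Q: "real Q = 8 * (real L)\<^sup>2" "real Q > 0" and b: "b > 0" using L by (auto simp: Q_def b_def)
  have "((\<lambda>x. \<Sum>n\<in>{L..<M}. real n powr (- 2 * s)
      * (Re (unit_exp (real (n\<^sup>2) * x)) * Fejer_kernel Q x))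
      has_integral W) {0..1}"
    unfolding W_def
    by (intro has_integral_sum has_integral_mult_right has_integral_Fejer_kernel) auto
  then have W: "((\<lambda>x. Re (sq_sum s L M x) * Fejer_kernel Q x) has_integral W) {0..1}"
    by (simp add: sq_sum_def trig_sum_def sum_distrib_right mult.assoc)
  have "b * real Q = (\<Sum>n\<in>{L..<2*L}. (2 * real L) powr (- 2 * s) * (real Q / 2))"
    by (simp add: b_def)
  also have "\<dots> \<le> (\<Sum>n\<in>{L..<2*L}. real n powr (- 2 * s) * real (Q - n\<^sup>2))"
  proof (intro sum_mono mult_mono)
    fix n assume n: "n \<in> {L..<2*L}"
    show "(2 * real L) powr (- 2 * s) \<le> real n powr (- 2 * s)"
      using n s L by (intro powr_mono2') auto
    have "n\<^sup>2 \<le> (2 * L)\<^sup>2" using n by (intro power_mono) auto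
    then have "Q \<le> 2 * (Q - n\<^sup>2)" by (simp add: Q_def power_mult_distrib)
    then have "real Q \<le> real (2 * (Q - n\<^sup>2))" by (simp only: of_nat_le_iff)
    then show "real Q / 2 \<le> real (Q - n\<^sup>2)" by simp
  qed auto
  also have "\<dots> \<le> W" unfolding W_def using M by (intro sum_mono2) auto
  finally have "b * real Q \<le> W" .
  moreover have "continuous_on {0..1} (sq_sum s L M)"
    unfolding sq_sum_def by (rule continuous_on_trig_sum)
  moreover have "(Fejer_kernel Q has_integral real Q) {0..1}"
    using has_integral_Fejer_kernel[of 0 Q] by simp
  ultimately have "ennreal (b powr p * real Q / (real Q)\<^sup>2) \<le> Lp_pow p (sq_sum s L M)"
    using b Q p W
    by (intro Lp_pow_ge_weighted_mean[where \<phi> = "Fejer_kernel Q"] Fejer_kernel_nonneg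
          Fejer_kernel_le) auto
  also have "b powr p * real Q / (real Q)\<^sup>2 = b powr p / (8 * (real L)\<^sup>2)"
    using Q by (simp add: power2_eq_square)
  finally show ?thesis .
qed

lemma Lp_lower_bound_sq_sum_gt_4:
  assumes s: "s \<ge> 0" and L: "L \<ge> 1" and M: "2 * L \<le> M" and p: "p > 4"
  shows "Lp_lower_bound p (sq_sum s L M) (2 powr (- 2 * s) / 2 / 8 powr (1/p)
      * tail_rate p s (real L))"
proof -
  have "(real L powr (p/2 - 2)) powr (1/p) = real L powr (1/2) / real L powr (2/p)"
    using p by (simp add: powr_powr powr_diff[symmetric] field_simps)
  moreover have "real L powr (1/2) * real L powr (1/2) = real L"
    using L by (simp flip: powr_add)
  ultimately have "tail_rate p s (real L) = real L powr (- 2 * s) * real L / real L powr (2/p)"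
    using p L by (simp add: tail_rate_def gauss_rate_def growth_def powr_half_sqrt mult.assoc)
  then have "2 powr (- 2 * s) / 2 / 8 powr (1/p) * tail_rate p s (real L)
      = real L * (2 * real L) powr (- 2 * s) / 2 / (8 powr (1/p) * real L powr (2/p))"
    by (simp add: powr_mult mult_ac)
  also have "\<dots> powr p = (real L * (2 * real L) powr (- 2 * s) / 2) powr p / (8 * (real L)\<^sup>2)"
    using p L by (simp add: powr_divide powr_mult powr_powr)
  finally show ?thesis
    using Lp_pow_sq_sum_ge[OF s L M, of p] p by (simp add: Lp_lower_bound_def tail_rate_nonneg)
qed

lemma Lp_lower_bound_sq_sum:
  assumes p: "p \<ge> 2" and s: "s \<ge> 0"
  obtains c where "c > 0"
    "\<And>L M. L \<ge> 2 \<Longrightarrow> 17 * L < M \<Longrightarrow> Lp_lower_bound p (sq_sum s L M) (c * tail_rate p s (real L))"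
proof -
  consider "p < 4" | "p = 4" | "p > 4" by linarith
  then show thesis
  proof cases
    case 1
    have "Lp_lower_bound p (sq_sum s L M) (2 powr (- 2 * s) * tail_rate p s (real L))"
      if "L \<ge> 2" "17 * L < M" for L M
    proof (rule Lp_lower_bound_mono_exponent)
      have "tail_rate p s (real L) = tail_rate 2 s (real L)"
        using 1 by (simp add: tail_rate_def gauss_rate_def growth_def)
      then show "Lp_lower_bound 2 (sq_sum s L M) (2 powr (- 2 * s) * tail_rate p s (real L))"
        using Lp_lower_bound_2_sq_sum[OF s, of L M] that by simp
    qed (use p in auto)
    then show thesis by (intro that) auto
  next
    case 2
    then show thesis
      using Lp_lower_bound_4_sq_sum[OF s] by (intro that[of "17 powr (- 2 * s) / 6"]) auto
  next
    case 3
    then show thesis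
      using Lp_lower_bound_sq_sum_gt_4[OF s]
      by (intro that[of "2 powr (- 2 * s) / 2 / 8 powr (1/p)"]) auto
  qed
qed

lemma Lp_limit_sq_sum_lower_bound:
  assumes p: "p \<ge> 2" and s: "s \<ge> 0"
  obtains c where "c > 0"
    "\<And>L g. L \<ge> 2 \<Longrightarrow> Lp_limit p (sq_sum s L) g \<Longrightarrow> Lp_lower_bound p g (c * tail_rate p s (real L))"
proof -
  obtain c where c: "c > 0"
    "\<And>L M. L \<ge> 2 \<Longrightarrow> 17 * L < M \<Longrightarrow> Lp_lower_bound p (sq_sum s L M) (c * tail_rate p s (real L))"
    using Lp_lower_bound_sq_sum[OF p s] by blast
  show thesis
  proof (rule that[OF c(1)])
    fix L g assume L: "L \<ge> 2" and g: "Lp_limit p (sq_sum s L) g"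
    show "Lp_lower_bound p g (c * tail_rate p s (real L))"
    proof (rule Lp_lower_bound_limit[OF g])
      show "\<forall>\<^sub>F M in sequentially. Lp_lower_bound p (sq_sum s L M) (c * tail_rate p s (real L))"
        using eventually_gt_at_top[of "17 * L"] by eventually_elim (rule c(2)[OF L])
    qed (use p in auto)
  qed
qed

lemma Lp_limit_sq_sum_bound:
  assumes p: "p \<ge> 2" and s: "s > s_star p"
  obtains C where "C > 0"
    "\<And>L g. L \<ge> 1 \<Longrightarrow> Lp_limit p (sq_sum s L) g \<Longrightarrow> Lp_bound p g (C * tail_rate p s (real L))"
proof -
  obtain C where C: "C > 0" "\<And>L M. L \<ge> 1 \<Longrightarrow> Lp_bound p (sq_sum s L M) (C * tail_rate p s (real L))"
    using Lp_bound_sq_sum[OF p s] by blast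
  show thesis
  proof (rule that[OF C(1)])
    fix L g assume "L \<ge> 1" "Lp_limit p (sq_sum s L) g"
    then show "Lp_bound p g (C * tail_rate p s (real L))"
      using p by (intro Lp_bound_limit[OF _ C(2)]) auto
  qed
qed

section \<open>Flatness\<close>

lemma enn2real_Lp_pow_bounds:
  assumes "Lp_bound p g A" "Lp_lower_bound p g a"
  shows "a powr p \<le> enn2real (Lp_pow p g)" "enn2real (Lp_pow p g) \<le> A powr p"
proof -
  have upper: "Lp_pow p g \<le> ennreal (A powr p)" using assms(1) by (simp add: Lp_bound_def)
  then show "enn2real (Lp_pow p g) \<le> A powr p" by (rule enn2real_leI[rotated]) simp
  have "ennreal (a powr p) \<le> Lp_pow p g" using assms(2) by (simp add: Lp_lower_bound_def)
  moreover have "Lp_pow p g < top" using upper by (rule le_less_trans) simp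
  ultimately have "enn2real (ennreal (a powr p)) \<le> enn2real (Lp_pow p g)" by (rule enn2real_mono)
  then show "a powr p \<le> enn2real (Lp_pow p g)" by simp
qed

lemma flatness_bounds:
  assumes g: "Lp_bound p g A" "Lp_lower_bound p g a"
    and g2: "Lp_bound 2 g B" "Lp_lower_bound 2 g b" and "0 < b" "p > 0"
  shows "(a / B) powr p \<le> flatness p g" "flatness p g \<le> (A / b) powr p"
proof -
  define P where "P = enn2real (Lp_pow p g)"
  define T where "T = enn2real (Lp_pow 2 g)"
  have P: "a powr p \<le> P" "P \<le> A powr p"
    unfolding P_def by (rule enn2real_Lp_pow_bounds[OF g])+
  have T: "b powr 2 \<le> T" "T \<le> B powr 2"
    unfolding T_def by (rule enn2real_Lp_pow_bounds[OF g2])+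
  have half: "(c powr 2) powr (p/2) = c powr p" for c :: real
    unfolding powr_powr by simp
  have "0 < b powr 2" using \<open>0 < b\<close> by simp
  have "b powr p \<le> T powr (p/2)" unfolding half[symmetric]
    using T \<open>p > 0\<close> by (intro powr_mono2) auto
  moreover have "T powr (p/2) \<le> B powr p" unfolding half[symmetric]
    using T \<open>0 < b powr 2\<close> \<open>p > 0\<close> by (intro powr_mono2) linarith+
  moreover have "0 < b powr p" using \<open>0 < b\<close> by simp
  ultimately show "(a / B) powr p \<le> flatness p g" "flatness p g \<le> (A / b) powr p"
    unfolding flatness_def P_def[symmetric] T_def[symmetric] powr_divide
    using P by (auto intro!: frac_le order_trans[of 0 "a powr p" P])
qed

lemma tail_rate_ratio_powr:
  assumes "L \<ge> 1" "p > 0"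
  shows "(tail_rate p s L / tail_rate 2 s L) powr p = growth p L"
proof -
  have "tail_rate p s L / tail_rate 2 s L = growth p L powr (1/p)"
    using assms by (simp add: tail_rate_def gauss_rate_def growth_def[of 2])
  then show ?thesis using assms growth_pos[of L p] by (simp add: powr_powr)
qed

lemma flatness_sq_sum:
  assumes p: "p \<ge> 2" and s: "s > s_star p"
  obtains c C where "c > 0" "C > 0"
    "\<And>L g. L \<ge> 2 \<Longrightarrow> Lp_limit p (sq_sum s L) g \<Longrightarrow>
       c * growth p (real L) \<le> flatness p g \<and> flatness p g \<le> C * growth p (real L)"
proof -
  have s0: "s \<ge> 0" and s2: "s > s_star 2" using s s_star_ge[OF p] by (simp_all add: s_star_def)
  obtain c where c: "c > 0"
    "\<And>L g. L \<ge> 2 \<Longrightarrow> Lp_limit p (sq_sum s L) g \<Longrightarrow> Lp_lower_bound p g (c * tail_rate p s (real L))"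
    using Lp_limit_sq_sum_lower_bound[OF p s0] by blast
  obtain C where C: "C > 0"
    "\<And>L g. L \<ge> 1 \<Longrightarrow> Lp_limit p (sq_sum s L) g \<Longrightarrow> Lp_bound p g (C * tail_rate p s (real L))"
    using Lp_limit_sq_sum_bound[OF p s] by blast
  obtain c\<^sub>2 where c2: "c\<^sub>2 > 0"
    "\<And>L g. L \<ge> 2 \<Longrightarrow> Lp_limit 2 (sq_sum s L) g \<Longrightarrow> Lp_lower_bound 2 g (c\<^sub>2 * tail_rate 2 s (real L))"
    using Lp_limit_sq_sum_lower_bound[OF order_refl s0] by blast
  obtain C\<^sub>2 where C2: "C\<^sub>2 > 0"
    "\<And>L g. L \<ge> 1 \<Longrightarrow> Lp_limit 2 (sq_sum s L) g \<Longrightarrow> Lp_bound 2 g (C\<^sub>2 * tail_rate 2 s (real L))"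
    using Lp_limit_sq_sum_bound[OF order_refl s2] by blast
  show thesis
  proof (rule that[of "(c / C\<^sub>2) powr p" "(C / c\<^sub>2) powr p"])
    fix L g assume L: "L \<ge> 2" and g: "Lp_limit p (sq_sum s L) g"
    have L1: "L \<ge> 1" using L by simp
    have g2: "Lp_limit 2 (sq_sum s L) g"
      using p by (intro Lp_limit_antimono_exponent[OF g]) auto
    have pos: "0 < c\<^sub>2 * tail_rate 2 s (real L)" "p > 0"
      using L p c2(1) by (simp_all add: tail_rate_def gauss_rate_def growth_def)
    note flatness_bounds[OF C(2)[OF L1 g] c(2)[OF L g] C2(2)[OF L1 g2] c2(2)[OF L g2] pos]
    moreover have "(a * tail_rate p s (real L) / (b * tail_rate 2 s (real L))) powr p
        = (a / b) powr p * growth p (real L)" for a b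
      unfolding times_divide_times_eq[symmetric] powr_mult
      using tail_rate_ratio_powr[of "real L" p s] L p by simp
    ultimately show "(c / C\<^sub>2) powr p * growth p (real L) \<le> flatness p g
        \<and> flatness p g \<le> (C / c\<^sub>2) powr p * growth p (real L)"
      by simp
  qed (use c C c2 C2 in auto)
qed

definition cutoff :: "nat \<Rightarrow> nat" where
  "cutoff N = max 1 (nat \<lceil>sqrt (real N)\<rceil>)"

lemma cutoff_le_iff: "cutoff N \<le> n \<longleftrightarrow> 1 \<le> n \<and> N \<le> n\<^sup>2"
proof -
  have "sqrt (real N) \<le> real n \<longleftrightarrow> real N \<le> real (n\<^sup>2)"
    using real_sqrt_le_iff[of "real N" "(real n)\<^sup>2"] by simp
  then show ?thesis
    unfolding cutoff_def by (auto simp: nat_le_iff ceiling_le_iff)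
qed

lemma cutoff_bounds:
  assumes "N \<ge> 1"
  shows "sqrt (real N) \<le> real (cutoff N)" "real (cutoff N) \<le> 2 * sqrt (real N)"
proof -
  have "sqrt (real N) \<ge> 1" using assms by simp
  then show "sqrt (real N) \<le> real (cutoff N)" "real (cutoff N) \<le> 2 * sqrt (real N)"
    unfolding cutoff_def by linarith+
qed

lemma Rs_high_partial_eq_sq_sum: "Rs_high_partial s N M = sq_sum s (cutoff N) (Suc M)"
proof -
  have "{n. 1 \<le> n \<and> N \<le> n\<^sup>2 \<and> n \<le> M} = {cutoff N..<Suc M}"
    by (auto simp: cutoff_le_iff)
  then show ?thesis
    by (simp add: fun_eq_iff Rs_high_partial_def sq_sum_def trig_sum_def unit_exp_def mult.assoc)
qed

lemma Lp_limit_Rs_high_partial: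
  "Lp_limit p (Rs_high_partial s N) g \<longleftrightarrow> Lp_limit p (sq_sum s (cutoff N)) g"
  unfolding Lp_limit_def Rs_high_partial_eq_sq_sum
  using filterlim_sequentially_Suc[of "\<lambda>M. Lp_pow p (\<lambda>x. sq_sum s (cutoff N) M x - g x)" "nhds 0"]
  by simp

lemma growth_cutoff_bounds:
  fixes p :: real
  assumes N: "N \<ge> 3"
  defines "K \<equiv> max 4 (2 powr (p/2 - 2))"
  shows "1/2 * flat_rate p N \<le> growth p (real (cutoff N))
      \<and> growth p (real (cutoff N)) \<le> K * flat_rate p N"
proof -
  define L where "L = real (cutoff N)"
  have L: "sqrt (real N) \<le> L" "L \<le> 2 * sqrt (real N)" using cutoff_bounds[of N] N
    by (auto simp: L_def)
  have "sqrt (real N) > 0" using N by simp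
  consider "p < 4" | "p = 4" | "p > 4" by linarith
  then have "1/2 * flat_rate p N \<le> growth p L \<and> growth p L \<le> K * flat_rate p N"
  proof cases
    case 1
    then show ?thesis by (simp add: growth_def flat_rate_def K_def)
  next
    case 2
    have "1 \<le> ln (real N)" using exp_le N by (simp add: ln_ge_iff)
    then have "4 * ln (real N) \<le> K * ln (real N)" by (intro mult_right_mono) (auto simp: K_def)
    moreover have "ln (sqrt (real N)) \<le> ln L" "ln L \<le> ln (2 * sqrt (real N))"
      using L \<open>sqrt (real N) > 0\<close> by (intro ln_mono; linarith)+
    then have "ln (real N) / 2 \<le> ln L" "ln L \<le> 1 + ln (real N) / 2"
      using N ln_2_less_1 by (simp_all add: ln_mult ln_sqrt)
    ultimately have "ln (real N) / 2 \<le> 2 + ln L" "2 + ln L \<le> K * ln (real N)"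
      using \<open>1 \<le> ln (real N)\<close> by linarith+
    then show ?thesis using 2 by (simp add: growth_def flat_rate_def)
  next
    case 3
    have sqrt: "sqrt (real N) powr (p/2 - 2) = real N powr (p/4 - 1)"
      by (simp add: powr_half_sqrt[symmetric] powr_powr algebra_simps)
    have "sqrt (real N) powr (p/2 - 2) \<le> L powr (p/2 - 2)"
      "L powr (p/2 - 2) \<le> (2 * sqrt (real N)) powr (p/2 - 2)"
      using L 3 \<open>sqrt (real N) > 0\<close> by (intro powr_mono2; linarith)+
    moreover have "2 powr (p/2 - 2) * real N powr (p/4 - 1) \<le> K * real N powr (p/4 - 1)"
      by (intro mult_right_mono) (auto simp: K_def)
    moreover have "0 \<le> real N powr (p/4 - 1)" by simp
    ultimately have "1/2 * real N powr (p/4 - 1) \<le> L powr (p/2 - 2)"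
      "L powr (p/2 - 2) \<le> K * real N powr (p/4 - 1)"
      unfolding powr_mult sqrt by linarith+
    then show ?thesis using 3 by (simp add: growth_def flat_rate_def)
  qed
  then show ?thesis by (simp only: L_def)
qed

lemma flatness_Rs_high_partial:
  assumes "p \<ge> 2" and "s > s_star p"
  obtains c C where "c > 0" "C > 0"
    "\<And>N g. N \<ge> 3 \<Longrightarrow> Lp_limit p (Rs_high_partial s N) g \<Longrightarrow>
       c * flat_rate p N \<le> flatness p g \<and> flatness p g \<le> C * flat_rate p N"
proof -
  obtain c C where cC: "c > 0" "C > 0" and flat: "\<And>L g. L \<ge> 2 \<Longrightarrow> Lp_limit p (sq_sum s L) g \<Longrightarrow>
      c * growth p (real L) \<le> flatness p g \<and> flatness p g \<le> C * growth p (real L)"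
    using flatness_sq_sum[OF assms] by blast
  define K where "K = max 4 (2 powr (p/2 - 2))"
  show thesis
  proof (rule that[of "c * (1/2)" "C * K"])
    fix N g assume N: "N \<ge> 3" and g: "Lp_limit p (Rs_high_partial s N) g"
    have "\<not> cutoff N \<le> 1" using N by (simp add: cutoff_le_iff)
    then have "c * growth p (real (cutoff N)) \<le> flatness p g
        \<and> flatness p g \<le> C * growth p (real (cutoff N))"
      using g by (intro flat) (simp_all add: Lp_limit_Rs_high_partial)
    moreover have "c * (1/2 * flat_rate p N) \<le> c * growth p (real (cutoff N))"
      "C * growth p (real (cutoff N)) \<le> C * (K * flat_rate p N)"
      using growth_cutoff_bounds[OF N, of p] cC by (simp_all add: K_def)
    ultimately show
      "c * (1/2) * flat_rate p N \<le> flatness p g \<and> flatness p g \<le> C * K * flat_rate p N"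
      unfolding mult.assoc by linarith
  qed (use cC in \<open>simp_all add: K_def\<close>)
qed

theorem theoremA:
  fixes p s :: real
  assumes "p \<ge> 2" and "s > s_star p"
  shows "(\<forall>N. \<exists>g. Lp_limit p (Rs_high_partial s N) g) \<and>
    (\<exists>c C. c > 0 \<and> C > 0 \<and>
      (\<forall>\<^sub>F N in sequentially. \<forall>g. Lp_limit p (Rs_high_partial s N) g \<longrightarrow>
          c * flat_rate p N \<le> flatness p g \<and> flatness p g \<le> C * flat_rate p N))"
proof
  show "\<forall>N. \<exists>g. Lp_limit p (Rs_high_partial s N) g"
    unfolding Lp_limit_Rs_high_partial using ex_Lp_limit_sq_sum[OF assms] by blast
  obtain c C where "c > 0" "C > 0" and "\<And>N g. N \<ge> 3 \<Longrightarrow> Lp_limit p (Rs_high_partial s N) g \<Longrightarrow>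
      c * flat_rate p N \<le> flatness p g \<and> flatness p g \<le> C * flat_rate p N"
    using flatness_Rs_high_partial[OF assms] by blast
  then show "\<exists>c C. c > 0 \<and> C > 0 \<and>
      (\<forall>\<^sub>F N in sequentially. \<forall>g. Lp_limit p (Rs_high_partial s N) g \<longrightarrow>
          c * flat_rate p N \<le> flatness p g \<and> flatness p g \<le> C * flat_rate p N)"
    unfolding eventually_sequentially by blast
qed

end
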